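(* Let $g\in L^2(\mathbb{R}^m)$ and let $\Lambda$ be a countable family of points of $\mathbb{R}^{2m}$ (repetitions allowed) such that $\mathcal{G}(g,\Lambda)$ is a frame for $L^2(\mathbb{R}^m)$. Fix $O\in\mathbb{R}^{2m}$, an invertible $M\in\mathbb{R}^{2m\times2m}$, and set $\Lambda_n=\Lambda\cap MQ_n(O)$. Then the ultrafilter frame measure function of $\mathcal{G}(g,\Lambda)$ with respect to $(\Lambda,(\Lambda_n)_n)$ is $$\mu(\mathcal{G}(g,\Lambda))(p)=\frac{1}{D(\Lambda;p,M)}\quad\text{for all }p\in\mathbb{N}^*.$$
   Context: For $\lambda=(t,\omega)\in\mathbb{R}^m\times\mathbb{R}^m$ and phase $\varphi_\lambda$, $g_\lambda(x)=e^{i\varphi_\lambda}e^{2\pi i\langle\omega,x\rangle}g(x-t)$ and $\mathcal{G}(g,\Lambda)=\{g_\lambda\}_{\lambda\in\Lambda}$ (arbitrary fixed phases), indexed by $\Lambda$. $Q_n(c)=\{\lambda\in\mathbb{R}^{2m}:\|\lambda-c\|_\infty\le n/2\}$; $\Lambda_n$ is the set of indices whose points lie in $MQ_n(O)$, counted with multiplicity. $\mathbb{N}^*$ is the set of free ultrafilters on $\mathbb{N}$ and $p\text{-}\lim$ the limit of a bounded sequence along $p$ ($p\text{-}\lim\mathbf{x}=c$ iff $\{n:|x_n-c|<\varepsilon\}\in p$ for all $\varepsilon>0$). $D(\Lambda;p,M)=p\text{-}\lim_n\frac{|\Lambda_n|}{\mathrm{vol}(MQ_n(O))}$. With $\tilde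 g_\lambda$ the canonical dual frame, $\mu(\mathcal{G}(g,\Lambda))(p)=p\text{-}\lim_n\frac{1}{|\Lambda_n|}\sum_{\lambda\in\Lambda_n}\langle g_\lambda,\tilde g_\lambda\rangle$. *)

theory Defs
  imports "HOL-Analysis.Analysis"
begin

section \<open>L^2(R^m) (functions up to a.e. equality, handled via integrals)\<close>

definition L2 :: "(real^'m \<Rightarrow> complex) \<Rightarrow> bool" where
  "L2 f \<longleftrightarrow> f \<in> borel_measurable lebesgue \<and> integrable lebesgue (\<lambda>x. (cmod (f x))\<^sup>2)"

definition l2_inner :: "(real^'m \<Rightarrow> complex) \<Rightarrow> (real^'m \<Rightarrow> complex) \<Rightarrow> complex" where
  "l2_inner f h = (LINT x|lebesgue. f x * cnj (h x))"

definition l2_normsq :: "(real^'m \<Rightarrow> complex) \<Rightarrow> real" where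
  "l2_normsq f = (LINT x|lebesgue. (cmod (f x))\<^sup>2)"

definition tpart :: "real^('m + 'm) \<Rightarrow> real^'m" where
  "tpart l = (\<chi> i. l $ Inl i)"

definition wpart :: "real^('m + 'm) \<Rightarrow> real^'m" where
  "wpart l = (\<chi> i. l $ Inr i)"

definition gabor_atom :: "(real^'m \<Rightarrow> complex) \<Rightarrow> real \<Rightarrow> real^('m + 'm) \<Rightarrow> real^'m \<Rightarrow> complex" where
  "gabor_atom g ph l x = cis ph * cis (2 * pi * (wpart l \<bullet> x)) * g (x - tpart l)"

text \<open>The family G(g,Lambda) indexed by a countable index type 'i, with points lam i and phases ph i.\<close>
definition is_frame :: "('i \<Rightarrow> real^'m \<Rightarrow> complex) \<Rightarrow> bool" where
  "is_frame G \<longleftrightarrow> (\<forall>i. L2 (G i)) \<and>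
     (\<exists>A B. 0 < A \<and> A \<le> B \<and> (\<forall>f. L2 f \<longrightarrow>
        (\<lambda>i. (cmod (l2_inner f (G i)))\<^sup>2) summable_on UNIV \<and>
        A * l2_normsq f \<le> (\<Sum>\<^sub>\<infinity>i. (cmod (l2_inner f (G i)))\<^sup>2) \<and>
        (\<Sum>\<^sub>\<infinity>i. (cmod (l2_inner f (G i)))\<^sup>2) \<le> B * l2_normsq f))"

text \<open>d is (a representative of) the canonical dual element S^{-1} (G i), where
  S h = sum_mu <h, G mu> G mu is the frame operator; S d = G i is expressed weakly.\<close>
definition is_canonical_dual :: "('i \<Rightarrow> real^'m \<Rightarrow> complex) \<Rightarrow> 'i \<Rightarrow> (real^'m \<Rightarrow> complex) \<Rightarrow> bool" where
  "is_canonical_dual G i d \<longleftrightarrow> L2 d \<and>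
     (\<forall>f. L2 f \<longrightarrow> (\<Sum>\<^sub>\<infinity>\<mu>. l2_inner d (G \<mu>) * l2_inner (G \<mu>) f) = l2_inner (G i) f)"

text \<open>The value <g_lambda, tilde g_lambda> (independent of the representative).\<close>
definition dual_diag :: "('i \<Rightarrow> real^'m \<Rightarrow> complex) \<Rightarrow> 'i \<Rightarrow> complex" where
  "dual_diag G i = (THE c. \<exists>d. is_canonical_dual G i d \<and> c = l2_inner (G i) d)"

definition cube :: "nat \<Rightarrow> real^'k \<Rightarrow> (real^'k) set" where
  "cube n c = {x. \<forall>j. \<bar>x $ j - c $ j\<bar> \<le> real n / 2}"

definition MQ :: "real^'k^'k \<Rightarrow> nat \<Rightarrow> real^'k \<Rightarrow> (real^'k) set" where
  "MQ M n c0 = (\<lambda>x. M *v x) ` cube n c0"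

definition Lambda_n :: "('i \<Rightarrow> real^'k) \<Rightarrow> real^'k^'k \<Rightarrow> real^'k \<Rightarrow> nat \<Rightarrow> 'i set" where
  "Lambda_n lam M c0 n = {i. lam i \<in> MQ M n c0}"

definition free_ultrafilter :: "nat filter \<Rightarrow> bool" where
  "free_ultrafilter p \<longleftrightarrow> p \<noteq> bot \<and> (\<forall>A. eventually (\<lambda>n. n \<in> A) p \<or> eventually (\<lambda>n. n \<notin> A) p)
     \<and> (\<forall>A. finite A \<longrightarrow> eventually (\<lambda>n. n \<notin> A) p)"

definition plim :: "nat filter \<Rightarrow> (nat \<Rightarrow> 'a::t2_space) \<Rightarrow> 'a" where
  "plim p x = Lim p x"

definition density :: "('i \<Rightarrow> real^'k) \<Rightarrow> nat filter \<Rightarrow> real^'k^'k \<Rightarrow> real^'k \<Rightarrow> real" where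
  "density lam p M c0 = plim p (\<lambda>n. real (card (Lambda_n lam M c0 n)) / measure lborel (MQ M n c0))"

definition frame_measure :: "('i \<Rightarrow> real^'m \<Rightarrow> complex) \<Rightarrow> ('i \<Rightarrow> real^('m+'m)) \<Rightarrow> real^('m+'m)^('m+'m)
    \<Rightarrow> real^('m+'m) \<Rightarrow> nat filter \<Rightarrow> complex" where
  "frame_measure G lam M c0 p = plim p (\<lambda>n. (1 / of_nat (card (Lambda_n lam M c0 n))) *
      (\<Sum>i\<in>Lambda_n lam M c0 n. dual_diag G i))"

end

theory Submission
  imports "HOL-Probability.Characteristic_Functions" Defs
begin

text \<open>
  Let \<open>\<phi>\<^sub>z\<close> be the time-frequency shifts of the indicator of the unit cube and \<open>d\<^sub>\<lambda>\<close> the canonical dual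
  of \<open>g\<^sub>\<lambda>\<close>. The function \<open>F(\<lambda>,z) = \<langle>\<phi>\<^sub>z, g\<^sub>\<lambda>\<rangle> \<langle>d\<^sub>\<lambda>, \<phi>\<^sub>z\<rangle>\<close> integrates to
  \<open>\<langle>d\<^sub>\<lambda>, g\<^sub>\<lambda>\<rangle>\<close> over \<open>z\<close> (Moyal's identity, from Plancherel) and sums to \<open>1\<close> over \<open>\<lambda>\<close>
  (frame reconstruction). Hence \<open>\<Sum>\<langle>g\<^sub>\<lambda>, d\<^sub>\<lambda>\<rangle>\<close> over \<open>\<lambda>\<close> in a parallelepiped \<open>P\<close> differs from the
  volume of \<open>P\<close> at most by the integral of \<open>\<bar>F\<bar>\<close> over the pairs with exactly one of \<open>\<lambda>\<close>, \<open>z\<close> in \<open>P\<close>.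
  As \<open>\<bar>\<langle>\<phi>\<^sub>z, g\<^sub>\<lambda>\<rangle>\<bar>\<close> depends on \<open>z - \<lambda>\<close> only and is square integrable, the Cauchy-Schwarz
  inequality and dominated convergence show that this is of smaller order than the volume. Dividing by the number of
  points in \<open>P\<close> gives the theorem.
\<close>

section \<open>The space of square-integrable functions\<close>

text \<open>The index points have no structure, so the canonical dual of an atom is in general not a
  time-frequency shift, and no decay of it away from its index point is available. Only totals
  survive: the dual elements have bounded norms, and the dual Bessel inequality bounds the square
  sum of their coefficients against a unit atom. Cauchy-Schwarz is therefore used asymmetrically:
  the dual factor contributes just O(n^D) with D = 2m, and all smallness comes from the factor of g.
  That factor counts the index points separated from their shift by u by the boundary of the
  parallelepiped, weighted by a fixed integrable function of u; the count is o(n^D) for fixed u and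
  O(n^D) uniformly. Both estimates rest on the Bessel bound, which limits how densely points can
  cluster.

  The trace divided by the volume thus converges along the whole sequence, and the ultrafilter only
  selects a limit of the density. This limit is not 0 because the diagonal values are bounded.

  Elements of L^2 are plain functions here, so the frame operator is inverted variationally and
  duals are chosen representatives.\<close>

lemma borel_measurable_cnj [measurable (raw)]:
  "f \<in> borel_measurable M \<Longrightarrow> (\<lambda>x. cnj (f x)) \<in> borel_measurable M"
  by (rule borel_measurable_continuous_on[OF continuous_on_cnj[OF continuous_on_id]])

lemma L2_measurable: "L2 f \<Longrightarrow> f \<in> borel_measurable lebesgue"
  by (simp add: L2_def)

lemma L2_integrable_mult:
  assumes f: "L2 f" and h: "L2 h"
  shows "integrable lebesgue (\<lambda>x. f x * cnj (h x))"
proof (rule Bochner_Integration.integrable_bound)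
  show "integrable lebesgue (\<lambda>x. (cmod (f x))\<^sup>2 + (cmod (h x))\<^sup>2)"
    using f h by (auto simp: L2_def)
  show "(\<lambda>x. f x * cnj (h x)) \<in> borel_measurable lebesgue"
    using f h by (auto simp: L2_def intro!: borel_measurable_cnj)
  have "a * b \<le> a\<^sup>2 + b\<^sup>2" if "0 \<le> a" "0 \<le> b" for a b :: real
    using sum_squares_bound[of a b] mult_nonneg_nonneg[OF that] by linarith
  then show "AE x in lebesgue. norm (f x * cnj (h x)) \<le> norm ((cmod (f x))\<^sup>2 + (cmod (h x))\<^sup>2)"
    by (auto simp: norm_mult)
qed

lemma L2_add:
  assumes f: "L2 f" and h: "L2 h"
  shows "L2 (\<lambda>x. f x + h x)"
proof -
  note [measurable] = L2_measurable[OF f] L2_measurable[OF h]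
  have "integrable lebesgue (\<lambda>x. (cmod (f x + h x))\<^sup>2)"
  proof (rule Bochner_Integration.integrable_bound)
    show "integrable lebesgue (\<lambda>x. 2 * (cmod (f x))\<^sup>2 + 2 * (cmod (h x))\<^sup>2)"
      using f h by (auto simp: L2_def)
    show "AE x in lebesgue. norm ((cmod (f x + h x))\<^sup>2) \<le> norm (2 * (cmod (f x))\<^sup>2 + 2 * (cmod (h x))\<^sup>2)"
    proof (rule AE_I2)
      fix x
      have "(cmod (f x + h x))\<^sup>2 \<le> (cmod (f x) + cmod (h x))\<^sup>2"
        by (intro power_mono norm_triangle_ineq) auto
      also have "\<dots> \<le> 2 * (cmod (f x))\<^sup>2 + 2 * (cmod (h x))\<^sup>2"
        using sum_squares_bound[of "cmod (f x)" "cmod (h x)"] by (simp add: power2_sum)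
      finally show "norm ((cmod (f x + h x))\<^sup>2) \<le> norm (2 * (cmod (f x))\<^sup>2 + 2 * (cmod (h x))\<^sup>2)"
        by simp
    qed
  qed simp
  then show ?thesis by (simp add: L2_def)
qed

lemma L2_scale: "L2 f \<Longrightarrow> L2 (\<lambda>x. c * f x)"
  by (auto simp: L2_def norm_mult power_mult_distrib)

lemma L2_diff: "L2 f \<Longrightarrow> L2 h \<Longrightarrow> L2 (\<lambda>x. f x - h x)"
  using L2_add[of f "\<lambda>x. (-1) * h x"] L2_scale[of h "-1"] by simp

lemma L2_zero: "L2 (\<lambda>x. 0)"
  by (simp add: L2_def)

lemma l2_normsq_nonneg: "0 \<le> l2_normsq f"
  by (simp add: l2_normsq_def)

lemma l2_inner_add: "L2 f \<Longrightarrow> L2 g \<Longrightarrow> L2 h \<Longrightarrow>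
    l2_inner (\<lambda>x. f x + g x) h = l2_inner f h + l2_inner g h"
  using L2_integrable_mult[of f h] L2_integrable_mult[of g h]
  by (simp add: l2_inner_def algebra_simps)

lemma l2_inner_scale: "l2_inner (\<lambda>x. c * f x) h = c * l2_inner f h"
  by (simp add: l2_inner_def mult.assoc)

lemma l2_inner_commute: "l2_inner f h = cnj (l2_inner h f)"
  using Bochner_Integration.integral_cnj[where M=lebesgue and f="\<lambda>x. h x * cnj (f x)"]
  by (simp add: l2_inner_def mult.commute del: integral_cnj)

lemma l2_inner_self: "l2_inner f f = of_real (l2_normsq f)"
  by (simp add: l2_inner_def l2_normsq_def complex_norm_square[symmetric] flip: integral_complex_of_real)

lemma cmod_l2_inner_sq_le:
  assumes f: "L2 f" and h: "L2 h"
  shows "(cmod (l2_inner f h))\<^sup>2 \<le> l2_normsq f * l2_normsq h"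
proof -
  note [measurable] = L2_measurable[OF f] L2_measurable[OF h]
  have nn: "(\<integral>\<^sup>+x. (ennreal (cmod (u x)))\<^sup>2 \<partial>lebesgue) = ennreal (l2_normsq u)" if "L2 u" for u :: "real^'b \<Rightarrow> complex"
    using that unfolding L2_def l2_normsq_def
    by (subst nn_integral_eq_integral[symmetric]) (auto simp: ennreal_power)
  have int: "integrable lebesgue (\<lambda>x. cmod (f x) * cmod (h x))"
    using integrable_norm[OF L2_integrable_mult[OF f h]] by (simp add: norm_mult)
  let ?I = "LINT x|lebesgue. cmod (f x) * cmod (h x)"
  have "ennreal (?I\<^sup>2) = (\<integral>\<^sup>+x. ennreal (cmod (f x)) * ennreal (cmod (h x)) \<partial>lebesgue)\<^sup>2"
    using int by (simp add: nn_integral_eq_integral[OF int] ennreal_power flip: ennreal_mult)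
  also have "\<dots> \<le> (\<integral>\<^sup>+x. (ennreal (cmod (f x)))\<^sup>2 \<partial>lebesgue) * (\<integral>\<^sup>+x. (ennreal (cmod (h x)))\<^sup>2 \<partial>lebesgue)"
    by (intro Cauchy_Schwarz_nn_integral) auto
  also have "\<dots> = ennreal (l2_normsq f * l2_normsq h)"
    using f h by (simp add: nn ennreal_mult l2_normsq_nonneg)
  finally have "?I\<^sup>2 \<le> l2_normsq f * l2_normsq h"
    by (subst (asm) ennreal_le_iff) (simp_all add: l2_normsq_nonneg)
  moreover have "cmod (l2_inner f h) \<le> ?I"
    unfolding l2_inner_def using integral_norm_bound[of lebesgue "\<lambda>x. f x * cnj (h x)"]
    by (simp add: norm_mult)
  ultimately show ?thesis
    by (meson norm_ge_zero order_trans power_mono)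
qed

lemma ennreal_le_suminf: "f n \<le> (\<Sum>n. f n)" for f :: "nat \<Rightarrow> ennreal"
  using sum_le_suminf[OF summableI, of "{n}" f] by simp

text \<open>Along a sequence that is Cauchy at a geometric rate, \<open>4 ^ n * \<bar>u (n + 1) - u n\<bar>\<^sup>2\<close> has a finite
  sum almost everywhere, which forces pointwise convergence.\<close>
lemma L2_complete:
  fixes u :: "nat \<Rightarrow> real^'m \<Rightarrow> complex"
  assumes u: "\<And>n. L2 (u n)"
    and Cauchy: "\<And>n m. n \<le> m \<Longrightarrow> l2_normsq (\<lambda>x. u m x - u n x) \<le> C * (1/16) ^ n"
  obtains v where "L2 v" "\<And>n. l2_normsq (\<lambda>x. v x - u n x) \<le> C * (1/16) ^ n"
proof -
  note [measurable] = L2_measurable[OF u]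
  have C: "0 \<le> C"
    using Cauchy[of 0 0] l2_normsq_nonneg[of "\<lambda>x. u 0 x - u 0 x"] by simp
  have nn: "(\<integral>\<^sup>+x. ennreal ((cmod (w x))\<^sup>2) \<partial>lebesgue) = ennreal (l2_normsq w)" if "L2 w" for w :: "real^'m \<Rightarrow> complex"
    using that unfolding L2_def l2_normsq_def by (intro nn_integral_eq_integral) auto
  define S where "S x = (\<Sum>n. ennreal (4 ^ n * (cmod (u (Suc n) x - u n x))\<^sup>2))" for x
  have [measurable]: "S \<in> borel_measurable lebesgue"
    unfolding S_def by measurable
  have "(\<integral>\<^sup>+x. S x \<partial>lebesgue) = (\<Sum>n. \<integral>\<^sup>+x. ennreal (4 ^ n * (cmod (u (Suc n) x - u n x))\<^sup>2) \<partial>lebesgue)"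
    unfolding S_def by (intro nn_integral_suminf) measurable
  \<comment> \<open>The rate \<open>1/16\<close> is shared out: a factor \<open>1/4\<close> keeps
    the integrals summable, and the weight \<open>4 ^ n\<close> becomes the bound
    \<open>(1/2) ^ n\<close> on the increments after a square root.\<close>
  also have "\<dots> \<le> (\<Sum>n. ennreal (C * (1/4) ^ n))"
  proof (intro suminf_le allI summableI)
    fix n
    have "(\<integral>\<^sup>+x. ennreal (4 ^ n * (cmod (u (Suc n) x - u n x))\<^sup>2) \<partial>lebesgue)
        = ennreal (4 ^ n) * ennreal (l2_normsq (\<lambda>x. u (Suc n) x - u n x))"
      by (subst nn[symmetric]) (simp_all add: ennreal_mult nn_integral_cmult L2_diff u)
    also have "\<dots> \<le> ennreal (4 ^ n) * ennreal (C * (1/16) ^ n)"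
      by (intro mult_left_mono ennreal_leI Cauchy) auto
    also have "\<dots> = ennreal (C * (1/4) ^ n)"
      using C by (simp add: power_divide field_simps flip: ennreal_mult power_mult_distrib)
    finally show "(\<integral>\<^sup>+x. ennreal (4 ^ n * (cmod (u (Suc n) x - u n x))\<^sup>2) \<partial>lebesgue) \<le> ennreal (C * (1/4) ^ n)" .
  qed
  also have "\<dots> < \<infinity>"
    using C by (subst suminf_ennreal2) (auto intro!: summable_mult summable_geometric)
  finally have "AE x in lebesgue. S x \<noteq> \<infinity>"
    by (intro nn_integral_PInf_AE) auto
  then have ae: "AE x in lebesgue. (\<lambda>n. u n x) \<longlonglongrightarrow> lim (\<lambda>n. u n x)"
  proof eventually_elim
    case (elim x)
    then obtain K where K: "S x = ennreal K" "0 \<le> K"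
      by (cases "S x") auto
    have bd: "cmod (u (Suc n) x - u n x) \<le> sqrt K * (1/2) ^ n" for n
    proof -
      have "ennreal (4 ^ n * (cmod (u (Suc n) x - u n x))\<^sup>2) \<le> S x"
        unfolding S_def
        by (rule ennreal_le_suminf)
      then have "4 ^ n * (cmod (u (Suc n) x - u n x))\<^sup>2 \<le> K"
        using K(2) unfolding K(1) by (subst (asm) ennreal_le_iff)
      moreover have "(4::real) ^ n = (2 ^ n)\<^sup>2"
        by (simp add: power2_eq_square flip: power_mult_distrib)
      ultimately have "(2 ^ n * cmod (u (Suc n) x - u n x))\<^sup>2 \<le> K"
        by (simp add: power_mult_distrib)
      then have "2 ^ n * cmod (u (Suc n) x - u n x) \<le> sqrt K"
        by (rule real_le_rsqrt)
      then show ?thesis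
        by (simp add: field_simps power_divide)
    qed
    have "summable (\<lambda>n. u (Suc n) x - u n x)"
      by (rule summable_comparison_test'[where g="\<lambda>n. sqrt K * (1/2) ^ n" and N=0])
         (use bd in \<open>auto intro!: summable_mult summable_geometric\<close>)
    then have "convergent (\<lambda>n. \<Sum>k<n. u (Suc k) x - u k x)"
      by (simp add: summable_iff_convergent)
    then have "convergent (\<lambda>n. u n x - u 0 x)"
      using sum_lessThan_telescope[of "\<lambda>n. u n x"] by simp
    then have "convergent (\<lambda>n. u n x)"
      using convergent_add[OF _ convergent_const[of "u 0 x"], of "\<lambda>n. u n x - u 0 x"] by simp
    then show ?case
      by (simp add: convergent_LIMSEQ_iff)
  qed
  define v where "v x = lim (\<lambda>n. u n x)" for x
  have [measurable]: "v \<in> borel_measurable lebesgue"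
    unfolding v_def by measurable
  \<comment> \<open>Fatou's lemma in \<open>m\<close> turns the pointwise limit into a norm estimate
    with the same constant.\<close>
  have le: "(\<integral>\<^sup>+x. ennreal ((cmod (v x - u n x))\<^sup>2) \<partial>lebesgue) \<le> ennreal (C * (1/16) ^ n)" for n
  proof -
    have "(\<integral>\<^sup>+x. ennreal ((cmod (v x - u n x))\<^sup>2) \<partial>lebesgue)
        = (\<integral>\<^sup>+x. liminf (\<lambda>m. ennreal ((cmod (u m x - u n x))\<^sup>2)) \<partial>lebesgue)"
    proof (rule nn_integral_cong_AE, use ae in eventually_elim)
      case (elim x)
      then have "(\<lambda>m. ennreal ((cmod (u m x - u n x))\<^sup>2)) \<longlonglongrightarrow> ennreal ((cmod (v x - u n x))\<^sup>2)"
        unfolding v_def by (intro tendsto_ennrealI tendsto_intros)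
      then show ?case
        by (rule lim_imp_Liminf[OF sequentially_bot, symmetric])
    qed
    also have "\<dots> \<le> liminf (\<lambda>m. \<integral>\<^sup>+x. ennreal ((cmod (u m x - u n x))\<^sup>2) \<partial>lebesgue)"
      by (intro nn_integral_liminf) measurable
    also have "\<dots> \<le> limsup (\<lambda>m. \<integral>\<^sup>+x. ennreal ((cmod (u m x - u n x))\<^sup>2) \<partial>lebesgue)"
      by (simp add: Liminf_le_Limsup)
    also have "\<dots> \<le> ennreal (C * (1/16) ^ n)"
    proof (rule Limsup_bounded)
      show "\<forall>\<^sub>F m in sequentially. (\<integral>\<^sup>+x. ennreal ((cmod (u m x - u n x))\<^sup>2) \<partial>lebesgue) \<le> ennreal (C * (1/16) ^ n)"
        using eventually_ge_at_top[of n]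
        by eventually_elim (simp add: nn L2_diff u Cauchy ennreal_leI)
    qed
    finally show ?thesis .
  qed
  have d: "L2 (\<lambda>x. v x - u n x)" for n
    unfolding L2_def integrable_iff_bounded using le[of n]
    by (auto simp: order_le_less_trans)
  have "L2 v"
    using L2_add[OF d[of 0] u[of 0]] by simp
  moreover have "l2_normsq (\<lambda>x. v x - u n x) \<le> C * (1/16) ^ n" for n
    using le[of n] C by (simp add: nn d)
  ultimately show thesis using that by blast
qed

section \<open>Inverting the frame operator\<close>

locale l2_frame =
  fixes G :: "'i \<Rightarrow> real^'m \<Rightarrow> complex" and A B :: real
  assumes L2_G: "L2 (G i)"
    and A_pos: "0 < A"
    and summable: "L2 f \<Longrightarrow> (\<lambda>i. (cmod (l2_inner f (G i)))\<^sup>2) summable_on UNIV"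
    and lower: "L2 f \<Longrightarrow> A * l2_normsq f \<le> (\<Sum>\<^sub>\<infinity>i. (cmod (l2_inner f (G i)))\<^sup>2)"
    and upper: "L2 f \<Longrightarrow> (\<Sum>\<^sub>\<infinity>i. (cmod (l2_inner f (G i)))\<^sup>2) \<le> B * l2_normsq f"
begin

definition energy :: "(real^'m \<Rightarrow> complex) \<Rightarrow> real" where
  "energy f = (\<Sum>\<^sub>\<infinity>i. (cmod (l2_inner f (G i)))\<^sup>2)"

text \<open>With S the frame operator, this is the sesquilinear form of S u against f, and
  \<open>energy\<close> is its diagonal. Working with the form avoids constructing S u as a
  function.\<close>

definition form :: "(real^'m \<Rightarrow> complex) \<Rightarrow> (real^'m \<Rightarrow> complex) \<Rightarrow> complex" where
  "form u f = (\<Sum>\<^sub>\<infinity>i. l2_inner u (G i) * l2_inner (G i) f)"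

lemma abs_summable_form:
  assumes u: "L2 u" and f: "L2 f"
  shows "(\<lambda>i. norm (l2_inner u (G i) * l2_inner (G i) f)) summable_on UNIV"
proof (rule Infinite_Sum.abs_summable_on_comparison_test)
  have "(\<lambda>i. (cmod (l2_inner u (G i)))\<^sup>2 + (cmod (l2_inner f (G i)))\<^sup>2) summable_on UNIV"
    by (intro summable_on_add summable u f)
  then show "(\<lambda>i. norm ((cmod (l2_inner u (G i)))\<^sup>2 + (cmod (l2_inner f (G i)))\<^sup>2)) summable_on UNIV"
    by simp
  fix i
  have "a * b \<le> a\<^sup>2 + b\<^sup>2" if "0 \<le> a" "0 \<le> b" for a b :: real
    using sum_squares_bound[of a b] mult_nonneg_nonneg[OF that] by linarith
  then show "norm (l2_inner u (G i) * l2_inner (G i) f) \<le> norm ((cmod (l2_inner u (G i)))\<^sup>2 + (cmod (l2_inner f (G i)))\<^sup>2)"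
    by (simp add: norm_mult l2_inner_commute[of "G i" f])
qed

lemma energy_nonneg: "0 \<le> energy f"
  unfolding energy_def by (intro infsum_nonneg) auto

lemma form_self:
  assumes u: "L2 u"
  shows "form u u = of_real (energy u)"
proof -
  have "l2_inner u (G i) * l2_inner (G i) u = of_real ((cmod (l2_inner u (G i)))\<^sup>2)" for i
    by (simp add: l2_inner_commute[of "G i" u] complex_norm_square[symmetric] del: of_real_power)
  moreover have "((\<lambda>i. complex_of_real ((cmod (l2_inner u (G i)))\<^sup>2)) has_sum of_real (energy u)) UNIV"
    unfolding energy_def by (intro has_sum_of_real has_sum_infsum summable u)
  ultimately show ?thesis
    unfolding form_def by (simp only: infsumI)
qed

text \<open>A quadratic polynomial in \<open>t\<close>. Real \<open>t\<close> is enough for the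
  variational argument, since imaginary parts are recovered later by testing with
  \<open>\<i> * f\<close>.\<close>

lemma energy_add_scaled:
  fixes t :: real
  assumes u: "L2 u" and f: "L2 f"
  shows "energy (\<lambda>x. u x + of_real t * f x) = energy u + 2 * t * Re (form u f) + t\<^sup>2 * energy f"
proof -
  have *: "(cmod (a + of_real t * b))\<^sup>2 = (cmod a)\<^sup>2 + 2 * t * Re (a * cnj b) + t\<^sup>2 * (cmod b)\<^sup>2" for a b :: complex
    unfolding cmod_power2 by (simp add: power2_eq_square algebra_simps)
  have c: "l2_inner (\<lambda>x. u x + of_real t * f x) (G i) = l2_inner u (G i) + of_real t * l2_inner f (G i)" for i
    by (simp add: l2_inner_add u L2_scale f L2_G l2_inner_scale)
  have s: "(\<lambda>i. l2_inner u (G i) * l2_inner (G i) f) summable_on UNIV"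
    using abs_summable_form[OF u f] by (rule abs_summable_summable)
  have sR: "(\<lambda>i. Re (l2_inner u (G i) * l2_inner (G i) f)) summable_on UNIV"
    using summable_on_Re[OF s] by simp
  have "energy (\<lambda>x. u x + of_real t * f x) = (\<Sum>\<^sub>\<infinity>i. (cmod (l2_inner u (G i)))\<^sup>2
      + 2 * t * Re (l2_inner u (G i) * l2_inner (G i) f) + t\<^sup>2 * (cmod (l2_inner f (G i)))\<^sup>2)"
    unfolding energy_def c * by (simp add: l2_inner_commute[of "G _" f])
  also have "\<dots> = energy u + 2 * t * (\<Sum>\<^sub>\<infinity>i. Re (l2_inner u (G i) * l2_inner (G i) f)) + t\<^sup>2 * energy f"
    unfolding energy_def
    by (simp only: infsum_add summable_on_add summable_on_cmult_right summable u f sR infsum_cmult_right')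
  also have "(\<Sum>\<^sub>\<infinity>i. Re (l2_inner u (G i) * l2_inner (G i) f)) = Re (form u f)"
    unfolding form_def using infsum_Re[OF s] by simp
  finally show ?thesis .
qed

lemma form_scale_right: "form u (\<lambda>x. c * f x) = cnj c * form u f"
proof -
  have "l2_inner (G i) (\<lambda>x. c * f x) = cnj c * l2_inner (G i) f" for i
    by (subst (1 2) l2_inner_commute) (simp add: l2_inner_scale)
  then have "form u (\<lambda>x. c * f x) = (\<Sum>\<^sub>\<infinity>i. cnj c * (l2_inner u (G i) * l2_inner (G i) f))"
    by (simp add: form_def mult.left_commute)
  then show ?thesis
    by (simp add: form_def infsum_cmult_right')
qed

text \<open>The Euler equation of the quadratic functional \<open>J h\<close> is \<open>form v f = l2_inner h f\<close>, so a minimizer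
  inverts the frame operator weakly.\<close>
definition J :: "(real^'m \<Rightarrow> complex) \<Rightarrow> (real^'m \<Rightarrow> complex) \<Rightarrow> real" where
  "J h u = energy u - 2 * Re (l2_inner u h)"

lemma J_add_scaled:
  assumes u: "L2 u" and f: "L2 f" and h: "L2 h"
  shows "J h (\<lambda>x. u x + of_real t * f x)
    = J h u + 2 * t * (Re (form u f) - Re (l2_inner f h)) + t\<^sup>2 * energy f"
  by (simp add: J_def energy_add_scaled u f h l2_inner_add L2_scale l2_inner_scale algebra_simps)

lemma two_Re_l2_inner_le:
  assumes u: "L2 u" and h: "L2 h" and s: "0 < s"
  shows "\<bar>2 * Re (l2_inner u h)\<bar> \<le> l2_normsq u / s + s * l2_normsq h"
proof -
  let ?x = "l2_normsq u / s" and ?y = "s * l2_normsq h"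
  have four: "4 * (x * y) \<le> (x + y)\<^sup>2" for x y :: real
    using sum_squares_bound[of x y] by (simp add: power2_sum)
  have "\<bar>2 * Re (l2_inner u h)\<bar>\<^sup>2 = 4 * (Re (l2_inner u h))\<^sup>2"
    by (simp add: power_mult_distrib)
  also have "\<dots> \<le> 4 * (cmod (l2_inner u h))\<^sup>2"
    by (simp add: cmod_power2)
  also have "\<dots> \<le> 4 * (?x * ?y)"
    using cmod_l2_inner_sq_le[OF u h] s by simp
  also have "\<dots> \<le> (?x + ?y)\<^sup>2"
    using four[of ?x ?y] .
  finally show ?thesis
    by (rule power2_le_imp_le) (use s in \<open>simp add: l2_normsq_nonneg\<close>)
qed

text \<open>Nonnegativity of \<open>energy\<close> at \<open>u + s f\<close> and
  \<open>u - s f\<close> gives both signs at once, a weighted Cauchy-Schwarz inequality for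
  \<open>form\<close>.\<close>

lemma two_Re_form_le:
  assumes u: "L2 u" and f: "L2 f" and s: "0 < s"
  shows "\<bar>2 * Re (form u f)\<bar> \<le> energy u / s + s * energy f"
proof -
  have "0 \<le> energy (\<lambda>x. u x + of_real s * f x)" "0 \<le> energy (\<lambda>x. u x + of_real (- s) * f x)"
    by (rule energy_nonneg)+
  then have "s * \<bar>2 * Re (form u f)\<bar> \<le> energy u + s * (s * energy f)"
    by (simp add: energy_add_scaled u f power2_eq_square abs_if del: of_real_minus)
  then have "s * \<bar>2 * Re (form u f)\<bar> \<le> s * (energy u / s + s * energy f)"
    using s by (simp add: distrib_left)
  with s show ?thesis
    using mult_le_cancel_left_pos by blast
qed

text \<open>With the weight \<open>1 / A\<close> the quadratic part of the error is exactly
  \<open>A * l2_normsq u\<close>, which the lower frame bound absorbs into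
  \<open>energy u\<close>.\<close>

lemma J_bounded_below: "L2 u \<Longrightarrow> L2 h \<Longrightarrow> - (l2_normsq h / A) \<le> J h u"
  using two_Re_l2_inner_le[of u h "1 / A"] lower[of u] A_pos
  by (simp add: J_def energy_def mult.commute)

lemma bdd_below_J: "L2 h \<Longrightarrow> bdd_below (J h ` Collect L2)"
  using J_bounded_below by (intro bdd_belowI[where m="- (l2_normsq h / A)"]) auto

lemma J_minimizer:
  assumes h: "L2 h"
  obtains v where "L2 v" "\<And>u. L2 u \<Longrightarrow> J h v \<le> J h u"
proof -
  define J0 where "J0 = Inf (J h ` Collect L2)"
  have J0: "J0 \<le> J h u" if "L2 u" for u
    unfolding J0_def using that by (intro cInf_lower bdd_below_J h) auto
  have "\<exists>u. L2 u \<and> J h u < J0 + (1/16) ^ n" for n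
  proof -
    have "Inf (J h ` Collect L2) < J0 + (1/16) ^ n"
      by (simp add: J0_def)
    then have "\<exists>y \<in> J h ` Collect L2. y < J0 + (1/16) ^ n"
      using L2_zero by (subst (asm) cInf_less_iff) (auto intro: bdd_below_J h)
    then show ?thesis by auto
  qed
  then obtain u where u: "\<And>n. L2 (u n)" and Ju: "\<And>n. J h (u n) < J0 + (1/16) ^ n"
    by metis
  have cau: "l2_normsq (\<lambda>x. u m x - u n x) \<le> (4 / A) * (1/16) ^ n" if "n \<le> m" for n m
  proof -
    let ?d = "\<lambda>x. u m x - u n x"
    have d: "L2 ?d" by (intro L2_diff u)
    \<comment> \<open>Parallelogram identity: \<open>energy ?d\<close> is twice the sum of the two
      values of \<open>J h\<close> minus four times the value at the midpoint. The former are close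
      to the infimum and the latter is at least the infimum, so \<open>energy ?d\<close> is small,
      and the lower frame bound makes the sequence Cauchy.\<close>
    have mid: "J h (\<lambda>x. u n x + of_real (1/2) * ?d x)
        = J h (u n) + (Re (form (u n) ?d) - Re (l2_inner ?d h)) + energy ?d / 4"
      by (subst J_add_scaled) (simp_all add: u d h power2_eq_square)
    have "J h (u m) = J h (\<lambda>x. u n x + of_real 1 * ?d x)"
      by simp
    also have "\<dots> = J h (u n) + 2 * (Re (form (u n) ?d) - Re (l2_inner ?d h)) + energy ?d"
      by (subst J_add_scaled) (simp_all add: u d h)
    finally have "energy ?d = 2 * J h (u m) + 2 * J h (u n) - 4 * J h (\<lambda>x. u n x + of_real (1/2) * ?d x)"
      unfolding mid by simp
    moreover have "J0 \<le> J h (\<lambda>x. u n x + of_real (1/2) * ?d x)"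
      by (intro J0 L2_add L2_scale u d)
    moreover have "(1/16::real) ^ m \<le> (1/16) ^ n"
      by (intro power_decreasing that) auto
    ultimately have "energy ?d \<le> 4 * (1/16) ^ n"
      using Ju[of m] Ju[of n] by linarith
    with lower[OF d] have "A * l2_normsq ?d \<le> 4 * (1/16) ^ n"
      by (simp add: energy_def)
    with A_pos show ?thesis by (simp add: field_simps)
  qed
  obtain v where v: "L2 v" and vn: "\<And>n. l2_normsq (\<lambda>x. v x - u n x) \<le> (4 / A) * (1/16) ^ n"
    using L2_complete[OF u cau] by blast
  \<comment> \<open>\<open>K\<close> collects the errors of expanding \<open>J h\<close> around
    \<open>v\<close>. The cross terms with \<open>v - u n\<close> are split with weights
    \<open>4 ^ n\<close> and \<open>(1/4) ^ n\<close>; since its norm and energy are O(16^-n), each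
    piece is O(4^-n).\<close>
  define K where "K = energy v + \<bar>B\<bar> * (4 / A) + l2_normsq h + 4 / A"
  have le: "J h v \<le> J0 + ((1/16) ^ n + K * (1/4) ^ n)" for n
  proof -
    let ?w = "\<lambda>x. v x - u n x" and ?s = "(1/4::real) ^ n"
    have w: "L2 ?w" by (intro L2_diff u v)
    have q: "(1/16::real) ^ n = ?s * ?s"
      by (simp add: flip: power_mult_distrib)
    have "J h (u n) = J h (\<lambda>x. v x + of_real (-1) * ?w x)"
      by simp
    also have "\<dots> = J h v - 2 * (Re (form v ?w) - Re (l2_inner ?w h)) + energy ?w"
      by (subst J_add_scaled) (simp_all add: v w h del: of_real_minus)
    finally have "J h v = J h (u n) + 2 * (Re (form v ?w) - Re (l2_inner ?w h)) - energy ?w"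
      by simp
    moreover have "2 * Re (form v ?w) \<le> ?s * (energy v + \<bar>B\<bar> * (4 / A))"
    proof -
      \<comment> \<open>The absolute value appears because the locale fixes no sign for
        \<open>B\<close>.\<close>
      have "energy ?w \<le> \<bar>B\<bar> * l2_normsq ?w"
        using upper[OF w] mult_right_mono[OF abs_ge_self[of B] l2_normsq_nonneg[of ?w]]
        by (simp add: energy_def)
      also have "\<dots> \<le> \<bar>B\<bar> * ((4 / A) * (1/16) ^ n)"
        by (intro mult_left_mono vn) auto
      finally have "energy ?w / ?s \<le> ?s * (\<bar>B\<bar> * (4 / A))"
        unfolding q by (simp add: divide_le_eq mult_ac)
      moreover have "2 * Re (form v ?w) \<le> energy v / (1 / ?s) + (1 / ?s) * energy ?w"
        using two_Re_form_le[OF v w, of "1 / ?s"] by simp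
      ultimately show ?thesis by (simp add: algebra_simps)
    qed
    moreover have "- (2 * Re (l2_inner ?w h)) \<le> ?s * (l2_normsq h + 4 / A)"
    proof -
      have "l2_normsq ?w / ?s \<le> ?s * (4 / A)"
        using vn[of n] unfolding q by (simp add: divide_le_eq mult_ac)
      then show ?thesis
        using two_Re_l2_inner_le[OF w h, of ?s] by (simp add: algebra_simps)
    qed
    moreover have "0 \<le> energy ?w" by (rule energy_nonneg)
    moreover have "?s * (energy v + \<bar>B\<bar> * (4 / A)) + ?s * (l2_normsq h + 4 / A) = K * ?s"
      by (simp add: K_def algebra_simps)
    ultimately show ?thesis
      using Ju[of n] by argo
  qed
  have "(\<lambda>n. J0 + ((1/16) ^ n + K * (1/4) ^ n)) \<longlonglongrightarrow> J0 + (0 + K * 0)"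
    by (intro tendsto_intros LIMSEQ_power_zero) auto
  then have "J h v \<le> J0"
    using le by (intro LIMSEQ_le_const) auto
  then show thesis
    using that[OF v] J0 order_trans by blast
qed

lemma frame_operator_surj:
  assumes h: "L2 h"
  obtains v where "L2 v" "\<And>f. L2 f \<Longrightarrow> form v f = l2_inner h f"
proof -
  obtain v where v: "L2 v" and min: "\<And>u. L2 u \<Longrightarrow> J h v \<le> J h u"
    using J_minimizer[OF h] by blast
  have Re: "Re (form v f) = Re (l2_inner h f)" if f: "L2 f" for f
  proof -
    define a b where "a = energy f" and "b = Re (form v f) - Re (l2_inner f h)"
    have a: "0 \<le> a" by (simp add: a_def energy_nonneg)
    \<comment> \<open>Nearly the vertex \<open>- b / a\<close> of the parabola; adding 1 covers
      \<open>a = 0\<close> and still makes the value negative unless \<open>b = 0\<close>.\<close>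
    define t where "t = - b / (a + 1)"
    have "0 \<le> 2 * t * b + t\<^sup>2 * a"
      using min[OF L2_add[OF v L2_scale[OF f, of "of_real t"]]]
      by (simp add: J_add_scaled v f h a_def b_def)
    also have "\<dots> = - (b\<^sup>2 * (a + 2)) / (a + 1)\<^sup>2"
      using a by (simp add: t_def divide_simps) (simp add: power2_eq_square algebra_simps)
    finally have "b\<^sup>2 * (a + 2) \<le> 0"
      using a by (simp add: divide_le_0_iff)
    then have "b = 0"
      using a by (auto simp: mult_le_0_iff)
    then show ?thesis
      by (subst l2_inner_commute) (simp add: b_def)
  qed
  \<comment> \<open>Real variations determine real parts only; the direction \<open>\<i> * f\<close>
    supplies the imaginary part.\<close>
  have "form v f = l2_inner h f" if f: "L2 f" for f
  proof (rule complex_eqI)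
    have "l2_inner h (\<lambda>x. \<i> * f x) = cnj \<i> * l2_inner h f"
      by (subst (1 2) l2_inner_commute) (simp add: l2_inner_scale)
    then show "Im (form v f) = Im (l2_inner h f)"
      using Re[OF L2_scale[OF f, of \<i>]] by (simp add: form_scale_right)
  qed (rule Re[OF f])
  with v show thesis by (rule that)
qed

end

section \<open>Translation invariance of Lebesgue integrals\<close>

lemma integral_lborel_translate:
  fixes f :: "'a::euclidean_space \<Rightarrow> 'b::{banach, second_countable_topology}"
  assumes [measurable]: "f \<in> borel_measurable borel"
  shows "(LINT x|lborel. f (x - v)) = (LINT x|lborel. f x)"
proof -
  have "(LINT x|lborel. f x) = (LINT x|distr lborel borel ((+) (- v)). f x)"
    by (simp add: lborel_distr_plus)
  also have "\<dots> = (LINT x|lborel. f (x - v))"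
    by (subst integral_distr) auto
  finally show ?thesis by simp
qed

lemma integrable_lborel_translate:
  fixes f :: "'a::euclidean_space \<Rightarrow> 'b::{banach, second_countable_topology}"
  assumes "integrable lborel f"
  shows "integrable lborel (\<lambda>x. f (x - v))"
proof -
  have [measurable]: "f \<in> borel_measurable borel" using assms by auto
  have "integrable (distr lborel borel ((+) (- v))) f"
    using assms by (simp add: lborel_distr_plus)
  then show ?thesis
    by (subst (asm) integrable_distr_eq) auto
qed

lemma nn_integral_lborel_translate:
  fixes f :: "'a::euclidean_space \<Rightarrow> ennreal"
  assumes [measurable]: "f \<in> borel_measurable borel"
  shows "(\<integral>\<^sup>+x. f (x - v) \<partial>lborel) = (\<integral>\<^sup>+x. f x \<partial>lborel)"
proof -
  have "(\<integral>\<^sup>+x. f x \<partial>lborel) = (\<integral>\<^sup>+x. f x \<partial>distr lborel borel ((+) (- v)))"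
    by (simp add: lborel_distr_plus)
  also have "\<dots> = (\<integral>\<^sup>+x. f (x - v) \<partial>lborel)"
    by (subst nn_integral_distr) auto
  finally show ?thesis by simp
qed

lemma integrable_complex_indicator:
  assumes "E \<in> sets M" "emeasure M E < \<infinity>"
  shows "integrable M (indicator E :: 'a \<Rightarrow> complex)"
proof -
  have "integrable M (\<lambda>x. complex_of_real (indicator E x))"
    using assms by (intro integrable_of_real integrable_real_indicator) auto
  then show ?thesis
    by (rule Bochner_Integration.integrable_cong[THEN iffD1, rotated -1]) (auto simp: indicator_def)
qed

section \<open>Continuity of translations in the mean\<close>

definition translation_continuous :: "('a::euclidean_space \<Rightarrow> complex) \<Rightarrow> bool" where
  "translation_continuous f \<longleftrightarrow>
    (\<forall>v. v \<longlonglongrightarrow> 0 \<longrightarrow> (\<lambda>n. LINT x|lborel. cmod (f (x - v n) - f x)) \<longlonglongrightarrow> 0)"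

text \<open>The property is closed under L^1 limits because translation preserves L^1 distance: an
  e/3 argument in which the first and third errors coincide.\<close>

lemma translation_continuous_approx:
  fixes f :: "'a::euclidean_space \<Rightarrow> complex"
  assumes f: "integrable lborel f"
    and approx: "\<And>e. 0 < e \<Longrightarrow> \<exists>h. integrable lborel h \<and> translation_continuous h
        \<and> (LINT x|lborel. cmod (f x - h x)) < e"
  shows "translation_continuous f"
  unfolding translation_continuous_def
proof (intro allI impI, rule LIMSEQ_I)
  fix v :: "nat \<Rightarrow> 'a" and e :: real assume v: "v \<longlonglongrightarrow> 0" and e: "0 < e"
  obtain h where h: "integrable lborel h" "translation_continuous h"
    and fh: "(LINT x|lborel. cmod (f x - h x)) < e / 3"
    using approx[of "e / 3"] e by auto
  obtain N where N: "\<And>n. N \<le> n \<Longrightarrow> norm ((LINT x|lborel. cmod (h (x - v n) - h x)) - 0) < e / 3"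
    using LIMSEQ_D[OF h(2)[unfolded translation_continuous_def, rule_format, OF v], of "e / 3"] e by auto
  have "(LINT x|lborel. cmod (f (x - v n) - f x)) < e" if "N \<le> n" for n
  proof -
    note tr = integrable_lborel_translate[where v="v n"]
    have [measurable]: "f \<in> borel_measurable borel" "h \<in> borel_measurable borel"
      using f h by auto
    have "(LINT x|lborel. cmod (f (x - v n) - f x)) \<le> (LINT x|lborel.
        (cmod (f (x - v n) - h (x - v n)) + cmod (h (x - v n) - h x)) + cmod (f x - h x))"
    proof (rule integral_mono)
      fix x
      have "f (x - v n) - f x = (f (x - v n) - h (x - v n)) + (h (x - v n) - h x) - (f x - h x)"
        by simp
      then show "cmod (f (x - v n) - f x)
          \<le> (cmod (f (x - v n) - h (x - v n)) + cmod (h (x - v n) - h x)) + cmod (f x - h x)"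
        by (metis (no_types, lifting) add_mono_thms_linordered_semiring(3) norm_triangle_ineq norm_triangle_ineq4 order_trans)
    qed (intro integrable_norm Bochner_Integration.integrable_add Bochner_Integration.integrable_diff tr f h)+
    also have "\<dots> = (LINT x|lborel. cmod (f (x - v n) - h (x - v n)))
        + (LINT x|lborel. cmod (h (x - v n) - h x)) + (LINT x|lborel. cmod (f x - h x))"
      by (simp add: tr f h)
    also have "(LINT x|lborel. cmod (f (x - v n) - h (x - v n))) = (LINT x|lborel. cmod (f x - h x))"
      by (rule integral_lborel_translate) measurable
    finally show ?thesis
      using N[OF that] fh by simp
  qed
  then show "\<exists>N. \<forall>n\<ge>N. norm ((LINT x|lborel. cmod (f (x - v n) - f x)) - 0) < e"
    by auto
qed

text \<open>For open \<open>U\<close> the overlap \<open>indicator U (x - v n) * indicator U x\<close> tends to \<open>indicator U x\<close> pointwise.\<close>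
lemma translation_continuous_open:
  fixes U :: "'a::euclidean_space set"
  assumes U: "open U" "emeasure lborel U < \<infinity>"
  shows "translation_continuous (indicator U)"
  unfolding translation_continuous_def
proof (intro allI impI)
  fix v :: "nat \<Rightarrow> 'a" assume v: "v \<longlonglongrightarrow> 0"
  let ?i = "indicator U :: 'a \<Rightarrow> real"
  have [measurable]: "U \<in> sets borel" using U by auto
  have i: "integrable lborel ?i"
    using U by (intro integrable_real_indicator) auto
  have prod: "integrable lborel (\<lambda>x. ?i (x - v n) * ?i x)" for n
    by (rule Bochner_Integration.integrable_bound[OF i]) (auto simp: indicator_def)
  have "(\<lambda>n. LINT x|lborel. ?i (x - v n) * ?i x) \<longlonglongrightarrow> (LINT x|lborel. ?i x)"
  proof (rule integral_dominated_convergence)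
    show "AE x in lborel. (\<lambda>n. ?i (x - v n) * ?i x) \<longlonglongrightarrow> ?i x"
    proof (rule AE_I2)
      fix x
      show "(\<lambda>n. ?i (x - v n) * ?i x) \<longlonglongrightarrow> ?i x"
      proof (cases "x \<in> U")
        case True
        have "(\<lambda>n. x - v n) \<longlonglongrightarrow> x - 0" by (intro tendsto_intros v)
        then have "\<forall>\<^sub>F n in sequentially. x - v n \<in> U"
          using topological_tendstoD[OF _ U(1)] True by auto
        then have "\<forall>\<^sub>F n in sequentially. ?i (x - v n) * ?i x = ?i x"
          by eventually_elim (use True in simp)
        then show ?thesis by (rule tendsto_eventually)
      qed simp
    qed
  qed (use i in \<open>auto simp: indicator_def\<close>)
  then have "(\<lambda>n. 2 * (LINT x|lborel. ?i x) - 2 * (LINT x|lborel. ?i (x - v n) * ?i x)) \<longlonglongrightarrow> 2 * (LINT x|lborel. ?i x) - 2 * (LINT x|lborel. ?i x)"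
    by (intro tendsto_intros)
  moreover have "(LINT x|lborel. cmod (indicator U (x - v n) - indicator U x))
      = 2 * (LINT x|lborel. ?i x) - 2 * (LINT x|lborel. ?i (x - v n) * ?i x)" for n
  proof -
    have "(LINT x|lborel. cmod (indicator U (x - v n) - indicator U x))
        = (LINT x|lborel. ?i (x - v n) + ?i x - 2 * (?i (x - v n) * ?i x))"
      by (intro Bochner_Integration.integral_cong) (auto simp: indicator_def)
    also have "\<dots> = (LINT x|lborel. ?i (x - v n)) + (LINT x|lborel. ?i x) - 2 * (LINT x|lborel. ?i (x - v n) * ?i x)"
      using integrable_lborel_translate[OF i, of "v n"] i prod[of n] by simp
    also have "(LINT x|lborel. ?i (x - v n)) = (LINT x|lborel. ?i x)"
      by (rule integral_lborel_translate) measurable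
    finally show ?thesis by simp
  qed
  ultimately show "(\<lambda>n. LINT x|lborel. cmod (indicator U (x - v n) - indicator U x)) \<longlonglongrightarrow> 0"
    by simp
qed

lemma translation_continuous_scale:
  "translation_continuous f \<Longrightarrow> translation_continuous (\<lambda>x. c * f x)"
  unfolding translation_continuous_def
  by (auto simp: norm_mult tendsto_mult_right_zero simp flip: right_diff_distrib)

lemma translation_continuous_add:
  assumes "translation_continuous f" "translation_continuous h"
    and [simp]: "integrable lborel f" "integrable lborel h"
  shows "translation_continuous (\<lambda>x. f x + h x)"
  unfolding translation_continuous_def
proof (intro allI impI)
  fix v :: "nat \<Rightarrow> 'a" assume v: "v \<longlonglongrightarrow> 0"
  note [simp] = integrable_lborel_translate
  have lim: "(\<lambda>n. (LINT x|lborel. cmod (f (x - v n) - f x)) + (LINT x|lborel. cmod (h (x - v n) - h x))) \<longlonglongrightarrow> 0 + 0"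
    using assms v unfolding translation_continuous_def by (intro tendsto_add) auto
  have le: "(LINT x|lborel. cmod (f (x - v n) + h (x - v n) - (f x + h x)))
      \<le> (LINT x|lborel. cmod (f (x - v n) - f x)) + (LINT x|lborel. cmod (h (x - v n) - h x))" for n
  proof -
    have "(LINT x|lborel. cmod (f (x - v n) + h (x - v n) - (f x + h x)))
        \<le> (LINT x|lborel. cmod (f (x - v n) - f x) + cmod (h (x - v n) - h x))"
    proof (intro integral_mono)
      fix x
      show "cmod (f (x - v n) + h (x - v n) - (f x + h x)) \<le> cmod (f (x - v n) - f x) + cmod (h (x - v n) - h x)"
        using norm_triangle_ineq[of "f (x - v n) - f x" "h (x - v n) - h x"] by (simp add: algebra_simps)
    qed simp_all
    then show ?thesis by simp
  qed
  show "(\<lambda>n. LINT x|lborel. cmod (f (x - v n) + h (x - v n) - (f x + h x))) \<longlonglongrightarrow> 0"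
    by (rule tendsto_sandwich[OF _ _ tendsto_const lim[simplified]]) (use le in \<open>auto intro!: always_eventually\<close>)
qed

text \<open>Outer regularity reduces indicators of measurable sets to open sets, where pointwise
  convergence is available; linearity and L^1 closedness do the rest.\<close>

lemma translation_continuous_integrable:
  fixes f :: "'a::euclidean_space \<Rightarrow> complex"
  assumes "integrable lborel f"
  shows "translation_continuous f"
  using assms
proof (induction rule: integrable_induct)
  case (base E c)
  then have E[measurable]: "E \<in> sets borel" and fin: "emeasure lborel E < \<infinity>" by auto
  have int: "integrable lborel (indicator E :: 'a \<Rightarrow> complex)"
    using fin by (intro integrable_complex_indicator) auto
  have "translation_continuous (indicator E :: 'a \<Rightarrow> complex)"
  proof (rule translation_continuous_approx[OF int])
    fix e :: real assume "0 < e"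
    then obtain U where U: "open U" "E \<subseteq> U" "emeasure lborel (U - E) < e"
      using outer_regular_lborel[OF E] by metis
    then have [measurable]: "U \<in> sets borel" by auto
    have "emeasure lborel U = emeasure lborel E + emeasure lborel (U - E)"
      using U by (subst plus_emeasure) (auto simp: Un_absorb1)
    also have "\<dots> < \<infinity>"
      using fin U(3) by (auto simp: order_less_trans)
    finally have fU: "emeasure lborel U < \<infinity>" .
    have "(LINT x|lborel. cmod (indicator E x - indicator U x)) = (LINT x|lborel. indicator (U - E) x)"
      using U by (intro Bochner_Integration.integral_cong) (auto simp: indicator_def)
    also have "\<dots> < e"
      using U(3) by (cases "emeasure lborel (U - E)") (auto simp: measure_def ennreal_less_iff)
    finally show "\<exists>h. integrable lborel h \<and> translation_continuous h \<and> (LINT x|lborel. cmod (indicator E x - h x)) < e"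
      using translation_continuous_open[OF U(1) fU] fU
      by (intro exI[of _ "indicator U"]) (auto intro!: integrable_complex_indicator)
  qed
  moreover have "(\<lambda>x. indicator E x *\<^sub>R c) = (\<lambda>x. c * indicator E x)"
    by (auto simp: indicator_def fun_eq_iff)
  ultimately show ?case
    using translation_continuous_scale by metis
next
  case (add f g)
  then show ?case by (intro translation_continuous_add) auto
next
  case (lim f s)
  have "(\<lambda>i. LINT x|lborel. cmod (f x - s i x)) \<longlonglongrightarrow> (LINT x|(lborel :: 'a measure). 0)"
  proof (rule integral_dominated_convergence)
    show "integrable lborel (\<lambda>x. 3 * cmod (f x))"
      using lim by auto
    show "AE x in lborel. (\<lambda>i. cmod (f x - s i x)) \<longlonglongrightarrow> 0"
    proof (rule AE_I2)
      fix x
      have "(\<lambda>i. cmod (f x - s i x)) \<longlonglongrightarrow> cmod (f x - f x)"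
        by (intro tendsto_intros lim.hyps) auto
      then show "(\<lambda>i. cmod (f x - s i x)) \<longlonglongrightarrow> 0" by simp
    qed
    show "AE x in lborel. norm (cmod (f x - s i x)) \<le> 3 * cmod (f x)" for i
    proof (rule AE_I2)
      fix x
      have "cmod (f x - s i x) \<le> cmod (f x) + cmod (s i x)"
        by (rule norm_triangle_ineq4)
      also have "cmod (s i x) \<le> 2 * cmod (f x)"
        by (rule lim.hyps) auto
      finally show "norm (cmod (f x - s i x)) \<le> 3 * cmod (f x)" by simp
    qed
  qed (use lim.hyps in auto)
  then have conv: "(\<lambda>i. LINT x|lborel. cmod (f x - s i x)) \<longlonglongrightarrow> 0"
    by simp
  show ?case
  proof (rule translation_continuous_approx[OF lim.hyps(4)])
    fix e :: real assume "0 < e"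
    then have "\<forall>\<^sub>F i in sequentially. (LINT x|lborel. cmod (f x - s i x)) < e"
      by (rule order_tendstoD(2)[OF conv])
    then obtain i where "(LINT x|lborel. cmod (f x - s i x)) < e"
      using eventually_happens'[OF sequentially_bot] by blast
    then show "\<exists>h. integrable lborel h \<and> translation_continuous h \<and> (LINT x|lborel. cmod (f x - h x)) < e"
      using lim by blast
  qed
qed

lemma
  fixes f :: "'a::euclidean_space \<Rightarrow> real \<Rightarrow> complex"
  assumes f: "\<And>b. b \<in> Basis \<Longrightarrow> integrable lborel (f b)"
  shows integrable_lborel_prod: "integrable lborel (\<lambda>x. \<Prod>b\<in>Basis. f b (x \<bullet> b))"
    and integral_lborel_prod: "(LINT x|lborel. (\<Prod>b\<in>Basis. f b (x \<bullet> b))) = (\<Prod>b\<in>Basis. (LINT x|lborel. f b x))"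
proof -
  interpret product_sigma_finite "\<lambda>_::'a. lborel :: real measure" ..
  have [measurable]: "f b \<in> borel_measurable borel" if "b \<in> Basis" for b
    using f[OF that] by auto
  have eq: "(\<Prod>b\<in>Basis. f b ((\<Sum>c\<in>Basis. g c *\<^sub>R c) \<bullet> b)) = (\<Prod>b\<in>Basis. f b (g b))" for g
    by (intro prod.cong) auto
  show "integrable lborel (\<lambda>x. \<Prod>b\<in>Basis. f b (x \<bullet> b))"
    by (subst lborel_eq, subst integrable_distr_eq) (auto simp: eq intro!: product_integrable_prod f)
  show "(LINT x|lborel. (\<Prod>b\<in>Basis. f b (x \<bullet> b))) = (\<Prod>b\<in>Basis. (LINT x|lborel. f b x))"
    by (subst lborel_eq, subst integral_distr) (auto simp: eq intro!: product_integral_prod f)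
qed

lemma borel_measurable_cis [measurable (raw)]:
  "f \<in> borel_measurable M \<Longrightarrow> (\<lambda>x. cis (f x)) \<in> borel_measurable M"
  by (rule borel_measurable_continuous_on[OF continuous_on_cis[OF continuous_on_id]])

section \<open>The standard Gaussian on Euclidean space\<close>

text \<open>The product form lets the Fourier transform factor into one-dimensional characteristic
  functions of the standard normal distribution.\<close>

definition gauss :: "'a::euclidean_space \<Rightarrow> real" where
  "gauss x = (\<Prod>b\<in>Basis. std_normal_density (x \<bullet> b))"

lemma borel_measurable_gauss [measurable]: "gauss \<in> borel_measurable borel"
  unfolding gauss_def by measurable

lemma gauss_nonneg: "0 \<le> gauss x"
  unfolding gauss_def by (intro prod_nonneg) (auto simp: normal_density_nonneg)

lemma gauss_eq: "gauss (x::'a::euclidean_space) = (1 / sqrt (2 * pi)) ^ DIM('a) * exp (- (norm x)\<^sup>2 / 2)"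
proof -
  have "gauss x = (1 / sqrt (2 * pi)) ^ DIM('a) * exp (\<Sum>b\<in>Basis. - (x \<bullet> b)\<^sup>2 / 2)"
    by (simp add: gauss_def std_normal_density_def prod.distrib exp_sum prod_dividef power_one_over)
  also have "(\<Sum>b\<in>Basis. - (x \<bullet> b)\<^sup>2 / 2) = - (norm x)\<^sup>2 / 2"
    unfolding power2_norm_eq_inner
    by (subst (2) euclidean_inner) (simp add: power2_eq_square sum_negf sum_divide_distrib)
  finally show ?thesis .
qed

lemma
  fixes v :: "'a::euclidean_space"
  shows integrable_gauss_cis: "integrable lborel (\<lambda>x. of_real (gauss x) * cis (x \<bullet> v))"
    and integral_gauss_cis: "(LINT x|lborel. of_real (gauss x) * cis (x \<bullet> v)) = of_real (exp (- (norm v)\<^sup>2 / 2))"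
proof -
  let ?f = "\<lambda>b t. of_real (std_normal_density t) * cis (t * (v \<bullet> b))"
  have eq: "of_real (gauss x) * cis (x \<bullet> v) = (\<Prod>b\<in>Basis. ?f b (x \<bullet> b))" for x :: 'a
  proof -
    have "cis (\<Sum>b\<in>S. h b) = (\<Prod>b\<in>S. cis (h b))" if "finite S" for S :: "'a set" and h
      using that by (induction S rule: finite_induct) (auto simp flip: cis_mult)
    then show ?thesis
      by (simp add: gauss_def prod.distrib euclidean_inner[of x v])
  qed
  have i: "integrable lborel (?f b)" for b
    by (rule Bochner_Integration.integrable_bound[OF integrable_normal_density[of 1 0]])
       (auto simp: norm_mult normal_density_nonneg)
  have I: "(LINT t|lborel. ?f b t) = of_real (exp (- (v \<bullet> b)\<^sup>2 / 2))" for b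
  proof -
    have "(LINT t|lborel. ?f b t) = (LINT t|lborel. std_normal_density t *\<^sub>R iexp ((v \<bullet> b) * t))"
      by (intro Bochner_Integration.integral_cong) (auto simp: scaleR_conv_of_real cis_conv_exp mult_ac)
    also have "\<dots> = char std_normal_distribution (v \<bullet> b)"
      unfolding char_def by (subst integral_density) (auto simp: normal_density_nonneg)
    finally show ?thesis by (simp add: char_std_normal_distribution)
  qed
  show "integrable lborel (\<lambda>x. of_real (gauss x) * cis (x \<bullet> v))"
    unfolding eq by (intro integrable_lborel_prod i)
  have "(LINT x|lborel. of_real (gauss x) * cis (x \<bullet> v)) = (\<Prod>b\<in>Basis. (LINT t|lborel. ?f b t))"
    unfolding eq by (intro integral_lborel_prod i)
  also have "\<dots> = of_real (exp (\<Sum>b\<in>Basis. - (v \<bullet> b)\<^sup>2 / 2))"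
    by (simp add: I exp_sum)
  also have "(\<Sum>b\<in>Basis. - (v \<bullet> b)\<^sup>2 / 2) = - (norm v)\<^sup>2 / 2"
    unfolding power2_norm_eq_inner
    by (subst (2) euclidean_inner) (simp add: power2_eq_square sum_negf sum_divide_distrib)
  finally show "(LINT x|lborel. of_real (gauss x) * cis (x \<bullet> v)) = of_real (exp (- (norm v)\<^sup>2 / 2))" .
qed

lemma integrable_gauss: "integrable lborel (gauss :: 'a::euclidean_space \<Rightarrow> real)"
proof -
  have "integrable lborel (\<lambda>x. complex_of_real (gauss (x::'a)))"
    using integrable_gauss_cis[of "0::'a"] by simp
  then show ?thesis using integrable_Re by fastforce
qed

lemma integral_gauss: "(LINT x|lborel. gauss (x::'a::euclidean_space)) = 1"
proof -
  have "complex_of_real (LINT x|lborel. gauss (x::'a)) = 1"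
    using integral_gauss_cis[of "0::'a"] by simp
  then show ?thesis by simp
qed

lemma
  fixes f :: "'a::euclidean_space \<Rightarrow> 'b::{banach, second_countable_topology}"
  assumes c: "c \<noteq> 0" and [measurable]: "f \<in> borel_measurable borel"
  shows integral_lborel_affine: "(LINT x|lborel. f x) = \<bar>c\<bar> ^ DIM('a) *\<^sub>R (LINT x|lborel. f (t + c *\<^sub>R x))"
    and integrable_lborel_affine: "integrable lborel f \<Longrightarrow> integrable lborel (\<lambda>x. f (t + c *\<^sub>R x))"
proof -
  have e: "lborel = Nonnegative_Lebesgue_Integration.density (distr lborel borel (\<lambda>x::'a. t + c *\<^sub>R x)) (\<lambda>_. ennreal (\<bar>c\<bar> ^ DIM('a)))"
    using c by (intro lborel_affine) auto
  show "(LINT x|lborel. f x) = \<bar>c\<bar> ^ DIM('a) *\<^sub>R (LINT x|lborel. f (t + c *\<^sub>R x))"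
    using c by (subst e, subst integral_density) (auto simp: integral_distr)
  show "integrable lborel (\<lambda>x. f (t + c *\<^sub>R x))" if "integrable lborel f"
  proof -
    have "integrable lborel (\<lambda>x. \<bar>c\<bar> ^ DIM('a) *\<^sub>R f (t + c *\<^sub>R x))"
      using that c by (subst (asm) e, subst (asm) integrable_density) (auto simp: integrable_distr_eq)
    from integrable_scaleR_right[OF this, of "1 / \<bar>c\<bar> ^ DIM('a)"] show ?thesis
      using c by simp
  qed
qed

text \<open>A convergence factor that increases to 1 as \<open>e\<close> decreases to 0. The scaling
  \<open>2 * pi * e\<close> makes its Fourier transform the probability density of a standard
  Gaussian shrunk by \<open>e\<close>, an approximate identity.\<close>

definition gauss_weight :: "real \<Rightarrow> 'a::euclidean_space \<Rightarrow> real" where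
  "gauss_weight e w = exp (- (norm ((2 * pi * e) *\<^sub>R w))\<^sup>2 / 2)"

lemma borel_measurable_gauss_weight [measurable]: "gauss_weight e \<in> borel_measurable borel"
  unfolding gauss_weight_def[abs_def] by measurable

lemma gauss_weight_eq: "gauss_weight e w = sqrt (2 * pi) ^ DIM('a) * gauss ((2 * pi * e) *\<^sub>R (w::'a::euclidean_space))"
  by (simp add: gauss_weight_def gauss_eq flip: power_mult_distrib)

lemma integrable_gauss_weight: "0 < e \<Longrightarrow> integrable lborel (gauss_weight e :: 'a::euclidean_space \<Rightarrow> real)"
  unfolding gauss_weight_eq[abs_def]
  using integrable_lborel_affine[of "2 * pi * e" gauss 0] integrable_gauss by auto

lemma gauss_weight_transform:
  fixes v :: "'a::euclidean_space"
  assumes e: "0 < e"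
  shows "(LINT w|lborel. of_real (gauss_weight e w) * cis (- (2 * pi) * (w \<bullet> v)))
    = of_real (gauss ((1/e) *\<^sub>R v) / e ^ DIM('a))"
proof -
  let ?c = "2 * pi * e" and ?d = "DIM('a)"
  let ?F = "\<lambda>x::'a. of_real (gauss x) * cis (x \<bullet> (- (1/e) *\<^sub>R v))"
  have "(LINT w|lborel. of_real (gauss_weight e w) * cis (- (2 * pi) * (w \<bullet> v)))
      = (LINT w|lborel. of_real (sqrt (2 * pi) ^ ?d) * ?F (?c *\<^sub>R w))"
    using e by (intro Bochner_Integration.integral_cong) (auto simp: gauss_weight_eq mult.assoc)
  also have "\<dots> = of_real (sqrt (2 * pi) ^ ?d) * (LINT w|lborel. ?F (?c *\<^sub>R w))"
    by (rule integral_mult_right_zero)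
  also have "(LINT w|lborel. ?F (?c *\<^sub>R w)) = of_real (1 / ?c ^ ?d) * (LINT w|lborel. ?F w)"
  proof -
    have "?F \<in> borel_measurable borel" by measurable
    from integral_lborel_affine[OF _ this, of ?c 0] e show ?thesis
      by (simp add: scaleR_conv_of_real)
  qed
  also have "(LINT w|lborel. ?F w) = of_real (exp (- (norm ((1/e) *\<^sub>R v))\<^sup>2 / 2))"
    by (subst integral_gauss_cis) simp
  also have "of_real (sqrt (2 * pi) ^ ?d) * (of_real (1 / ?c ^ ?d) * complex_of_real (exp (- (norm ((1/e) *\<^sub>R v))\<^sup>2 / 2)))
     = of_real (gauss ((1/e) *\<^sub>R v) / e ^ ?d)"
  proof -
    have "sqrt (2 * pi) ^ ?d * (1 / ?c ^ ?d) = (sqrt (2 * pi) / (2 * pi)) ^ ?d / e ^ ?d"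
      by (simp add: power_mult_distrib power_divide)
    also have "sqrt (2 * pi) / (2 * pi) = 1 / sqrt (2 * pi)"
      using real_sqrt_mult_self[of "2 * pi"] by (simp add: field_simps)
    finally have "sqrt (2 * pi) ^ ?d * (1 / ?c ^ ?d) = (1 / sqrt (2 * pi)) ^ ?d / e ^ ?d" .
    then show ?thesis
      unfolding gauss_eq by (simp only: of_real_mult[symmetric] mult.assoc[symmetric]) simp
  qed
  finally show ?thesis .
qed

section \<open>Plancherel theorem\<close>

lemma two_mult_le_weighted:
  fixes a b s :: real
  assumes "0 < s"
  shows "2 * (a * b) \<le> s * a\<^sup>2 + b\<^sup>2 / s"
proof -
  have "0 \<le> (s * a - b)\<^sup>2 / s"
    using assms by simp
  also have "\<dots> = s * a\<^sup>2 + b\<^sup>2 / s - 2 * (a * b)"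
    using assms by (simp add: power2_eq_square field_simps)
  finally show ?thesis by simp
qed

text \<open>The Fourier transform of the autocorrelation is the squared modulus of
  \<open>ft u\<close>, and its value at 0 is the squared norm. Plancherel's identity is thus Fourier
  inversion of it at the origin, which needs its continuity there.\<close>

definition autocorr :: "('a::euclidean_space \<Rightarrow> complex) \<Rightarrow> 'a \<Rightarrow> complex" where
  "autocorr u v = (LINT x|lborel. u x * cnj (u (x - v)))"

definition ft :: "('a::euclidean_space \<Rightarrow> complex) \<Rightarrow> 'a \<Rightarrow> complex" where
  "ft u w = (LINT x|lborel. u x * cis (- (2 * pi) * (w \<bullet> x)))"

locale L1_L2 =
  fixes u :: "'a::euclidean_space \<Rightarrow> complex"
  assumes L1: "integrable lborel u"
    and sq: "integrable lborel (\<lambda>x. (cmod (u x))\<^sup>2)"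
begin

lemma measurable_u [measurable]: "u \<in> borel_measurable borel"
  using L1 by auto

definition N where "N = (LINT x|lborel. (cmod (u x))\<^sup>2)"

lemma N_nonneg: "0 \<le> N"
  by (simp add: N_def)

lemma sq_translate: "integrable lborel (\<lambda>x. (cmod (u (x - v)))\<^sup>2)"
  using integrable_lborel_translate[OF sq] by simp

lemma integral_sq_translate: "(LINT x|lborel. (cmod (u (x - v)))\<^sup>2) = N"
  unfolding N_def by (rule integral_lborel_translate[where f="\<lambda>x. (cmod (u x))\<^sup>2"]) measurable

lemma cmod_mult_translate_le: "cmod (u x) * cmod (u (x - v)) \<le> (cmod (u x))\<^sup>2 / 2 + (cmod (u (x - v)))\<^sup>2 / 2"
  using two_mult_le_weighted[of 1 "cmod (u x)" "cmod (u (x - v))"] by simp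

lemma integrable_mult_translate: "integrable lborel (\<lambda>x. u x * cnj (u (x - v)))"
proof (rule Bochner_Integration.integrable_bound)
  show "integrable lborel (\<lambda>x. (cmod (u x))\<^sup>2 / 2 + (cmod (u (x - v)))\<^sup>2 / 2)"
    using sq sq_translate by auto
qed (auto simp: norm_mult intro!: borel_measurable_times borel_measurable_cnj cmod_mult_translate_le
      measurable_compose[OF _ measurable_u])

lemma integral_cmod_mult_translate_le: "(LINT x|lborel. cmod (u x) * cmod (u (x - v))) \<le> N"
proof -
  have "(LINT x|lborel. cmod (u x) * cmod (u (x - v))) \<le> (LINT x|lborel. (cmod (u x))\<^sup>2 / 2 + (cmod (u (x - v)))\<^sup>2 / 2)"
  proof (rule integral_mono)
    show "integrable lborel (\<lambda>x. cmod (u x) * cmod (u (x - v)))"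
      using integrable_norm[OF integrable_mult_translate] by (simp add: norm_mult)
  qed (use sq sq_translate cmod_mult_translate_le in auto)
  also have "\<dots> = N"
    using sq sq_translate by (simp add: integral_sq_translate) (simp add: N_def)
  finally show ?thesis .
qed

lemma cmod_autocorr_le: "cmod (autocorr u v) \<le> N"
proof -
  have "cmod (autocorr u v) \<le> (LINT x|lborel. cmod (u x * cnj (u (x - v))))"
    unfolding autocorr_def by (rule integral_norm_bound)
  then show ?thesis
    using integral_cmod_mult_translate_le[of v] by (simp add: norm_mult)
qed

lemma autocorr_0: "autocorr u 0 = of_real N"
  unfolding autocorr_def N_def by (simp add: complex_norm_square[symmetric] del: of_real_power flip: integral_complex_of_real)

text \<open>Upgrades continuity of translations from L^1 to what is needed for square-integrable
  \<open>u\<close>. Where \<open>cmod (u x) \<le> K\<close> the L^1 modulus times \<open>K\<close>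
  suffices; on the remaining set a weighted arithmetic-geometric mean leaves a small multiple of
  \<open>N\<close> and a tail of the squared norm.\<close>

lemma cmod_autocorr_diff_le:
  assumes K: "0 \<le> K" and s: "0 < s"
  shows "cmod (autocorr u v - autocorr u 0) \<le> K * (LINT x|lborel. cmod (u (x - v) - u x))
    + s * (4 * N) + (LINT x|lborel. indicator {x. K < cmod (u x)} x * (cmod (u x))\<^sup>2) / s"
proof -
  let ?d = "\<lambda>x. u (x - v) - u x" and ?i = "\<lambda>x. indicator {x. K < cmod (u x)} x * (cmod (u x))\<^sup>2"
  have d[simp]: "integrable lborel (\<lambda>x. cmod (?d x))"
    by (intro integrable_norm Bochner_Integration.integrable_diff integrable_lborel_translate L1)
  have i[simp]: "integrable lborel ?i"
    by (rule Bochner_Integration.integrable_bound[OF sq]) (auto simp: indicator_def)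
  have le1: "cmod (u x * cnj (u (x - v)) - u x * cnj (u (x - 0)))
      \<le> K * cmod (?d x) + s * (2 * (cmod (u (x - v)))\<^sup>2 + 2 * (cmod (u x))\<^sup>2) + ?i x / s" for x
  proof -
    let ?a = "cmod (u x)" and ?b = "cmod (?d x)"
    have e: "cmod (u x * cnj (u (x - v)) - u x * cnj (u (x - 0))) = ?a * ?b"
      by (simp add: norm_mult flip: right_diff_distrib complex_cnj_diff)
    have b: "?b\<^sup>2 \<le> 2 * (cmod (u (x - v)))\<^sup>2 + 2 * (cmod (u x))\<^sup>2"
    proof -
      have "?b\<^sup>2 \<le> (cmod (u (x - v)) + cmod (u x))\<^sup>2"
        by (intro power_mono norm_triangle_ineq4) auto
      also have "\<dots> \<le> 2 * (cmod (u (x - v)))\<^sup>2 + 2 * (cmod (u x))\<^sup>2"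
        using sum_squares_bound[of "cmod (u (x - v))" "cmod (u x)"] by (simp add: power2_sum)
      finally show ?thesis .
    qed
    show ?thesis
    proof (cases "K < ?a")
      case True
      have "2 * (?b * ?a) \<le> s * ?b\<^sup>2 + ?a\<^sup>2 / s"
        by (rule two_mult_le_weighted[OF s])
      also have "s * ?b\<^sup>2 \<le> s * (2 * (cmod (u (x - v)))\<^sup>2 + 2 * (cmod (u x))\<^sup>2)"
        using b s by simp
      finally have "2 * (?b * ?a) \<le> s * (2 * (cmod (u (x - v)))\<^sup>2 + 2 * (cmod (u x))\<^sup>2) + ?a\<^sup>2 / s" by simp
      moreover have "0 \<le> ?b * ?a" "0 \<le> K * ?b" using K by auto
      moreover have ix: "?i x = ?a\<^sup>2" using True by simp
      ultimately have "?b * ?a \<le> K * ?b + s * (2 * (cmod (u (x - v)))\<^sup>2 + 2 * (cmod (u x))\<^sup>2) + ?a\<^sup>2 / s"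
        by linarith
      then show ?thesis
        unfolding e ix mult.commute[of ?a ?b] .
    next
      case False
      then have "?a * ?b \<le> K * ?b" by (intro mult_right_mono) auto
      moreover have "0 \<le> s * (2 * (cmod (u (x - v)))\<^sup>2 + 2 * (cmod (u x))\<^sup>2)" using s by simp
      ultimately show ?thesis unfolding e using False by simp
    qed
  qed
  have "autocorr u v - autocorr u 0 = (LINT x|lborel. u x * cnj (u (x - v)) - u x * cnj (u (x - 0)))"
    unfolding autocorr_def by (intro Bochner_Integration.integral_diff[symmetric] integrable_mult_translate)
  then have "cmod (autocorr u v - autocorr u 0) \<le> (LINT x|lborel. cmod (u x * cnj (u (x - v)) - u x * cnj (u (x - 0))))"
    by (simp only: integral_norm_bound)
  also have "\<dots> \<le> (LINT x|lborel. K * cmod (?d x) + s * (2 * (cmod (u (x - v)))\<^sup>2 + 2 * (cmod (u x))\<^sup>2) + ?i x / s)"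
    by (intro integral_mono le1 integrable_norm Bochner_Integration.integrable_diff integrable_mult_translate)
       (auto intro!: Bochner_Integration.integrable_add integrable_mult_right integrable_divide sq sq_translate)
  also have "\<dots> = K * (LINT x|lborel. cmod (?d x)) + s * (4 * N) + (LINT x|lborel. ?i x) / s"
    using sq sq_translate[of v] d i
    by (simp add: integral_sq_translate del: i) (simp add: N_def)
  finally show ?thesis .
qed

lemma tail_tendsto_0:
  "(\<lambda>k. LINT x|lborel. indicator {x. real k < cmod (u x)} x * (cmod (u x))\<^sup>2) \<longlonglongrightarrow> 0"
proof -
  have "(\<lambda>k. LINT x|lborel. indicator {x. real k < cmod (u x)} x * (cmod (u x))\<^sup>2) \<longlonglongrightarrow> (LINT x|(lborel::'a measure). 0)"
  proof (rule integral_dominated_convergence[OF _ _ sq])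
    show "AE x in lborel. (\<lambda>k. indicator {x. real k < cmod (u x)} x * (cmod (u x))\<^sup>2) \<longlonglongrightarrow> 0"
    proof (rule AE_I2)
      fix x
      have "\<forall>\<^sub>F k in sequentially. indicator {x. real k < cmod (u x)} x * (cmod (u x))\<^sup>2 = 0"
        using eventually_ge_at_top[of "nat \<lceil>cmod (u x)\<rceil>"]
        by eventually_elim (auto simp: indicator_def)
      then show "(\<lambda>k. indicator {x. real k < cmod (u x)} x * (cmod (u x))\<^sup>2) \<longlonglongrightarrow> 0"
        by (rule tendsto_eventually)
    qed
  qed (auto simp: indicator_def)
  then show ?thesis by simp
qed

lemma autocorr_tendsto:
  assumes v: "v \<longlonglongrightarrow> 0"
  shows "(\<lambda>n. autocorr u (v n)) \<longlonglongrightarrow> of_real N"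
proof (rule LIMSEQ_I)
  fix e :: real assume e: "0 < e"
  \<comment> \<open>Choices go in the order \<open>s\<close>, \<open>k\<close>, \<open>n0\<close>:
    the tail is divided by \<open>s\<close>, so the height \<open>k\<close> depends on
    \<open>s\<close>, and the L^1 modulus is multiplied by \<open>k\<close>. The summand 1 guards
    against \<open>N = 0\<close>.\<close>
  define s where "s = e / (12 * (N + 1))"
  have s: "0 < s" using e N_nonneg by (simp add: s_def)
  have sN: "s * (4 * N) < e / 3"
    using e N_nonneg by (simp add: s_def divide_simps)
  obtain k where k: "(LINT x|lborel. indicator {x. real k < cmod (u x)} x * (cmod (u x))\<^sup>2) < s * (e / 3)"
    using order_tendstoD(2)[OF tail_tendsto_0, of "s * (e / 3)"] s e
    by (auto simp: eventually_sequentially)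
  have "(\<lambda>n. LINT x|lborel. cmod (u (x - v n) - u x)) \<longlonglongrightarrow> 0"
    using translation_continuous_integrable[OF L1] v unfolding translation_continuous_def by blast
  then have "(\<lambda>n. real k * (LINT x|lborel. cmod (u (x - v n) - u x))) \<longlonglongrightarrow> 0"
    by (rule tendsto_mult_right_zero)
  then obtain n0 where n0: "\<And>n. n0 \<le> n \<Longrightarrow> real k * (LINT x|lborel. cmod (u (x - v n) - u x)) < e / 3"
    using order_tendstoD(2)[of _ 0 sequentially "e / 3"] e by (auto simp: eventually_sequentially)
  have "cmod (autocorr u (v n) - of_real N) < e" if "n0 \<le> n" for n
  proof -
    have "(LINT x|lborel. indicator {x. real k < cmod (u x)} x * (cmod (u x))\<^sup>2) / s < e / 3"
      using k s by (simp add: divide_simps mult.commute)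
    then show ?thesis
      using cmod_autocorr_diff_le[OF of_nat_0_le_iff s, of "v n" k] n0[OF that] sN
      unfolding autocorr_0 by linarith
  qed
  then show "\<exists>n0. \<forall>n\<ge>n0. cmod (autocorr u (v n) - of_real N) < e" by blast
qed

end

text \<open>Licenses Fubini for kernels \<open>k\<close> that are characters: the remaining product
  of two integrable functions of separate variables controls everything.\<close>

lemma integrable_lborel_pair_bounded:
  fixes f :: "'a::euclidean_space \<Rightarrow> complex" and h :: "'b::euclidean_space \<Rightarrow> complex"
  assumes f: "integrable lborel f" and h: "integrable lborel h"
    and k[measurable]: "case_prod k \<in> borel_measurable (borel \<Otimes>\<^sub>M borel)"
    and k1: "\<And>x y. cmod (k x y) \<le> 1"
  shows "integrable (lborel \<Otimes>\<^sub>M lborel) (\<lambda>(x, y). f x * h y * k x y)"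
proof (rule integrableI_bounded)
  have [measurable]: "f \<in> borel_measurable borel" "h \<in> borel_measurable borel"
    using f h by auto
  have [measurable]: "case_prod k \<in> borel_measurable (lborel \<Otimes>\<^sub>M lborel)"
    using k by (simp cong: measurable_cong_sets sets_pair_measure_cong)
  show "(\<lambda>(x, y). f x * h y * k x y) \<in> borel_measurable (lborel \<Otimes>\<^sub>M lborel)"
    by measurable
  have "(\<integral>\<^sup>+p. ennreal (cmod (case p of (x, y) \<Rightarrow> f x * h y * k x y)) \<partial>(lborel \<Otimes>\<^sub>M lborel))
      \<le> (\<integral>\<^sup>+p. ennreal (cmod (f (fst p))) * ennreal (cmod (h (snd p))) \<partial>(lborel \<Otimes>\<^sub>M lborel))"
  proof (intro nn_integral_mono, clarsimp simp flip: ennreal_mult)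
    fix x y show "cmod (f x * h y * k x y) \<le> cmod (f x) * cmod (h y)"
      using k1[of x y] by (simp add: norm_mult mult_left_le)
  qed
  also have "\<dots> = (\<integral>\<^sup>+x. (\<integral>\<^sup>+y. ennreal (cmod (f x)) * ennreal (cmod (h y)) \<partial>lborel) \<partial>lborel)"
    by (subst lborel.nn_integral_fst[symmetric]) auto
  also have "\<dots> = (\<integral>\<^sup>+x. ennreal (cmod (f x)) \<partial>lborel) * (\<integral>\<^sup>+y. ennreal (cmod (h y)) \<partial>lborel)"
    by (simp add: nn_integral_cmult nn_integral_multc)
  also have "\<dots> < \<infinity>"
    using f h by (auto simp: integrable_iff_bounded ennreal_mult_less_top)
  finally show "(\<integral>\<^sup>+p. ennreal (cmod (case p of (x, y) \<Rightarrow> f x * h y * k x y)) \<partial>(lborel \<Otimes>\<^sub>M lborel)) < \<infinity>" .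
qed

context L1_L2
begin

lemma borel_measurable_ft [measurable]: "ft u \<in> borel_measurable borel"
proof -
  have "(\<lambda>w. LINT x|lborel. u x * cis (- (2 * pi) * (w \<bullet> x))) \<in> borel_measurable borel"
    by (rule lborel.borel_measurable_lebesgue_integral) measurable
  then show ?thesis by (simp add: ft_def[abs_def])
qed

lemma cmod_ft_le: "cmod (ft u w) \<le> (LINT x|lborel. cmod (u x))"
  unfolding ft_def using integral_norm_bound[of lborel "\<lambda>x. u x * cis (- (2 * pi) * (w \<bullet> x))"]
  by (simp add: norm_mult)

lemma integrable_weight_ft:
  assumes e: "0 < e"
  shows "integrable lborel (\<lambda>w. of_real (gauss_weight e w) * cnj (ft u w))"
proof (rule Bochner_Integration.integrable_bound)
  show "integrable lborel (\<lambda>w. (LINT x|lborel. cmod (u x)) * gauss_weight e (w::'a))"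
    by (intro integrable_mult_right integrable_gauss_weight e)
  show "AE w in lborel. norm (of_real (gauss_weight e w) * cnj (ft u w)) \<le> norm ((LINT x|lborel. cmod (u x)) * gauss_weight e w)"
    using cmod_ft_le by (auto simp: norm_mult gauss_weight_def intro!: mult_right_mono order_trans[OF cmod_ft_le])
qed measurable

text \<open>Interchanging the integrals leaves the convolution of the conjugate of \<open>u\<close>
  with the Gaussian kernel of width \<open>e\<close> at \<open>x\<close>; the substitution
  \<open>y = x - e *\<^sub>R s\<close> normalizes the kernel.\<close>

lemma ft_inner_weight:
  assumes e: "0 < e"
  shows "(LINT w|lborel. of_real (gauss_weight e w) * cnj (ft u w) * cis (- (2 * pi) * (w \<bullet> x)))
    = (LINT s|lborel. of_real (gauss s) * cnj (u (x - e *\<^sub>R s)))"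
proof -
  let ?h = "\<lambda>w::'a. complex_of_real (gauss_weight e w)"
  let ?k = "\<lambda>y w. cis (- (2 * pi) * (w \<bullet> (x - y)))"
  have int: "integrable (lborel \<Otimes>\<^sub>M lborel) (\<lambda>(y, w). cnj (u y) * ?h w * ?k y w)"
    by (intro integrable_lborel_pair_bounded integrable_cnj L1 integrable_of_real integrable_gauss_weight e)
       auto
  have "?h w * cnj (ft u w) * cis (- (2 * pi) * (w \<bullet> x)) = (LINT y|lborel. cnj (u y) * ?h w * ?k y w)" for w
  proof -
    have "cnj (ft u w) = (LINT y|lborel. cnj (u y) * cis (2 * pi * (w \<bullet> y)))"
      unfolding ft_def by (subst Bochner_Integration.integral_cnj[symmetric]) (simp add: cis_cnj)
    then have "?h w * cnj (ft u w) * cis (- (2 * pi) * (w \<bullet> x))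
        = (LINT y|lborel. (?h w * cis (- (2 * pi) * (w \<bullet> x))) * (cnj (u y) * cis (2 * pi * (w \<bullet> y))))"
      by (simp only: Bochner_Integration.integral_mult_right_zero) (simp only: mult_ac)
    also have "\<dots> = (LINT y|lborel. cnj (u y) * ?h w * ?k y w)"
    proof (intro Bochner_Integration.integral_cong refl)
      fix y
      have "cis (- (2 * pi) * (w \<bullet> x)) * cis (2 * pi * (w \<bullet> y)) = ?k y w"
        by (simp add: cis_mult inner_diff_right algebra_simps)
      then show "(?h w * cis (- (2 * pi) * (w \<bullet> x))) * (cnj (u y) * cis (2 * pi * (w \<bullet> y))) = cnj (u y) * ?h w * ?k y w"
        by (simp only: mult_ac)
    qed
    finally show ?thesis .
  qed
  then have "(LINT w|lborel. ?h w * cnj (ft u w) * cis (- (2 * pi) * (w \<bullet> x)))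
      = (LINT w|lborel. LINT y|lborel. cnj (u y) * ?h w * ?k y w)"
    by simp
  also have "\<dots> = (LINT y|lborel. LINT w|lborel. cnj (u y) * ?h w * ?k y w)"
    by (rule lborel_pair.Fubini_integral[OF int])
  also have "\<dots> = (LINT y|lborel. cnj (u y) * of_real (gauss ((1/e) *\<^sub>R (x - y)) / e ^ DIM('a)))"
    unfolding mult.assoc
    by (simp only: Bochner_Integration.integral_mult_right_zero gauss_weight_transform[OF e])
  also have "\<dots> = \<bar>- e\<bar> ^ DIM('a) *\<^sub>R (LINT s|lborel. cnj (u (x + (- e) *\<^sub>R s)) *
      of_real (gauss ((1/e) *\<^sub>R (x - (x + (- e) *\<^sub>R s))) / e ^ DIM('a)))"
    using e by (intro integral_lborel_affine) auto
  also have "\<dots> = (LINT s|lborel. of_real (gauss s) * cnj (u (x - e *\<^sub>R s)))"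
    using e by (simp add: mult.commute scaleR_conv_of_real)
  finally show ?thesis .
qed

text \<open>At this point \<open>ft u\<close> is only known to be bounded, so the weight is what
  makes the double integral absolutely convergent. A second interchange collects the product of
  \<open>u\<close> with its translates into \<open>autocorr\<close>, averaged over a Gaussian of
  width \<open>e\<close>.\<close>

lemma weighted_plancherel:
  assumes e: "0 < e"
  shows "(LINT w|lborel. of_real (gauss_weight e w) * of_real ((cmod (ft u w))\<^sup>2))
    = (LINT s|lborel. of_real (gauss s) * autocorr u (e *\<^sub>R s))"
proof -
  let ?h = "\<lambda>w. of_real (gauss_weight e w) * cnj (ft u w)"
  let ?k = "\<lambda>x w. cis (- (2 * pi) * (w \<bullet> x))"
  have int: "integrable (lborel \<Otimes>\<^sub>M lborel) (\<lambda>(x, w). u x * ?h w * ?k x w)"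
    by (intro integrable_lborel_pair_bounded L1 integrable_weight_ft e) auto
  have "of_real (gauss_weight e w) * complex_of_real ((cmod (ft u w))\<^sup>2) = (LINT x|lborel. u x * ?h w * ?k x w)" for w
  proof -
    have "complex_of_real ((cmod (ft u w))\<^sup>2) = cnj (ft u w) * ft u w"
      by (simp add: complex_norm_square mult.commute del: of_real_power)
    then have "of_real (gauss_weight e w) * complex_of_real ((cmod (ft u w))\<^sup>2) = ?h w * ft u w"
      by (simp only: mult.assoc)
    also have "\<dots> = ?h w * (LINT x|lborel. u x * ?k x w)"
      by (subst (2) ft_def) (rule refl)
    also have "\<dots> = (LINT x|lborel. ?h w * (u x * ?k x w))"
      by simp
    finally show ?thesis by (simp only: mult_ac)
  qed
  then have "(LINT w|lborel. of_real (gauss_weight e w) * complex_of_real ((cmod (ft u w))\<^sup>2))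
      = (LINT w|lborel. LINT x|lborel. u x * ?h w * ?k x w)"
    by simp
  also have "\<dots> = (LINT x|lborel. LINT w|lborel. u x * ?h w * ?k x w)"
    by (rule lborel_pair.Fubini_integral[OF int])
  also have "\<dots> = (LINT x|lborel. u x * (LINT s|lborel. of_real (gauss s) * cnj (u (x - e *\<^sub>R s))))"
    unfolding mult.assoc[of "u _"]
    by (simp only: Bochner_Integration.integral_mult_right_zero ft_inner_weight[OF e])
  also have "\<dots> = (LINT x|lborel. LINT s|lborel. u x * (of_real (gauss s) * cnj (u (x - e *\<^sub>R s))))"
    by simp
  also have "\<dots> = (LINT s|lborel. LINT x|lborel. u x * (of_real (gauss s) * cnj (u (x - e *\<^sub>R s))))"
  proof (rule lborel_pair.Fubini_integral)
    show "integrable (lborel \<Otimes>\<^sub>M lborel) (\<lambda>(s, x). u x * (of_real (gauss s) * cnj (u (x - e *\<^sub>R s))))"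
    proof (rule integrableI_bounded)
      show "(\<lambda>(s, x). u x * (of_real (gauss s) * cnj (u (x - e *\<^sub>R s)))) \<in> borel_measurable (lborel \<Otimes>\<^sub>M lborel)"
        by measurable
      have "(\<integral>\<^sup>+p. ennreal (cmod (case p of (s, x) \<Rightarrow> u x * (of_real (gauss s) * cnj (u (x - e *\<^sub>R s))))) \<partial>(lborel \<Otimes>\<^sub>M lborel))
        = (\<integral>\<^sup>+s. (\<integral>\<^sup>+x. ennreal (cmod (u x * (of_real (gauss s) * cnj (u (x - e *\<^sub>R s))))) \<partial>lborel) \<partial>lborel)"
        by (subst lborel.nn_integral_fst[symmetric]) auto
      also have "\<dots> \<le> (\<integral>\<^sup>+s. ennreal (gauss (s::'a) * N) \<partial>lborel)"
      proof (rule nn_integral_mono)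
        fix s :: 'a
        have i: "integrable lborel (\<lambda>x. cmod (u x) * cmod (u (x - e *\<^sub>R s)))"
          using integrable_norm[OF integrable_mult_translate[of "e *\<^sub>R s"]] by (simp add: norm_mult)
        have "(\<integral>\<^sup>+x. ennreal (cmod (u x * (of_real (gauss s) * cnj (u (x - e *\<^sub>R s))))) \<partial>lborel)
          = (\<integral>\<^sup>+x. ennreal (gauss s) * ennreal (cmod (u x) * cmod (u (x - e *\<^sub>R s))) \<partial>lborel)"
          by (intro nn_integral_cong) (simp add: norm_mult gauss_nonneg mult_ac flip: ennreal_mult)
        also have "\<dots> = ennreal (gauss s) * ennreal (LINT x|lborel. cmod (u x) * cmod (u (x - e *\<^sub>R s)))"
          by (subst nn_integral_cmult) (auto simp: nn_integral_eq_integral[OF i])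
        also have "\<dots> \<le> ennreal (gauss s) * ennreal N"
          by (intro mult_left_mono ennreal_leI integral_cmod_mult_translate_le) auto
        finally show "(\<integral>\<^sup>+x. ennreal (cmod (u x * (of_real (gauss s) * cnj (u (x - e *\<^sub>R s))))) \<partial>lborel) \<le> ennreal (gauss s * N)"
          by (simp add: ennreal_mult gauss_nonneg N_nonneg)
      qed
      also have "\<dots> < \<infinity>"
        by (subst nn_integral_eq_integral) (auto simp: gauss_nonneg N_nonneg integrable_gauss)
      finally show "(\<integral>\<^sup>+p. ennreal (cmod (case p of (s, x) \<Rightarrow> u x * (of_real (gauss s) * cnj (u (x - e *\<^sub>R s))))) \<partial>(lborel \<Otimes>\<^sub>M lborel)) < \<infinity>" .
    qed
  qed
  also have "\<dots> = (LINT s|lborel. of_real (gauss s) * autocorr u (e *\<^sub>R s))"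
    unfolding autocorr_def mult.left_commute[of "u _"] by simp
  finally show ?thesis .
qed

text \<open>Removes the weight by letting \<open>e\<close> tend to 0. The autocorrelation side
  converges by domination with \<open>gauss s * N\<close>; on the frequency side monotone
  convergence is used, so square integrability of \<open>ft u\<close> is a result and not a
  premise.\<close>

theorem plancherel: "(\<integral>\<^sup>+w. ennreal ((cmod (ft u w))\<^sup>2) \<partial>lborel) = ennreal N"
proof -
  define e where "e n = 1 / real (Suc n)" for n
  have e: "0 < e n" for n by (simp add: e_def)
  have e0: "e \<longlonglongrightarrow> 0"
    unfolding e_def using LIMSEQ_inverse_real_of_nat by (simp add: inverse_eq_divide)
  have "(\<lambda>n. LINT s|lborel. of_real (gauss s) * autocorr u (e n *\<^sub>R s))
      \<longlonglongrightarrow> (LINT s|lborel. of_real (gauss (s::'a)) * complex_of_real N)"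
  proof (rule integral_dominated_convergence)
    show "integrable lborel (\<lambda>s::'a. gauss s * N)"
      by (intro integrable_mult_left integrable_gauss)
    show "AE s in lborel. (\<lambda>n. of_real (gauss s) * autocorr u (e n *\<^sub>R s)) \<longlonglongrightarrow> of_real (gauss s) * complex_of_real N"
    proof (rule AE_I2)
      fix s :: 'a
      have "(\<lambda>n. e n *\<^sub>R s) \<longlonglongrightarrow> 0 *\<^sub>R s" by (intro tendsto_intros e0)
      then show "(\<lambda>n. of_real (gauss s) * autocorr u (e n *\<^sub>R s)) \<longlonglongrightarrow> of_real (gauss s) * complex_of_real N"
        by (intro tendsto_intros autocorr_tendsto) simp
    qed
    show "AE s in lborel. norm (of_real (gauss s) * autocorr u (e n *\<^sub>R s)) \<le> gauss s * N" for n
      using cmod_autocorr_le by (auto simp: norm_mult gauss_nonneg intro!: mult_left_mono)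
    have [measurable]: "autocorr u \<in> borel_measurable borel"
    proof -
      have "(\<lambda>v. LINT x|lborel. u x * cnj (u (x - v))) \<in> borel_measurable borel"
        by (rule lborel.borel_measurable_lebesgue_integral) measurable
      then show ?thesis by (simp add: autocorr_def[abs_def])
    qed
    show "(\<lambda>s. of_real (gauss s) * autocorr u (e n *\<^sub>R s)) \<in> borel_measurable lborel" for n
      by measurable
  qed measurable
  also have "(LINT s|lborel. of_real (gauss (s::'a)) * complex_of_real N) = of_real N"
    using integral_gauss[where 'a='a] by (simp flip: of_real_mult)
  finally have "(\<lambda>n. LINT w|lborel. of_real (gauss_weight (e n) w) * complex_of_real ((cmod (ft u w))\<^sup>2)) \<longlonglongrightarrow> of_real N"
    by (simp only: weighted_plancherel[OF e])
  then have "(\<lambda>n. complex_of_real (LINT w|lborel. gauss_weight (e n) w * (cmod (ft u w))\<^sup>2)) \<longlonglongrightarrow> of_real N"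
    by (simp only: of_real_mult[symmetric] integral_complex_of_real)
  then have lim1: "(\<lambda>n. LINT w|lborel. gauss_weight (e n) w * (cmod (ft u w))\<^sup>2) \<longlonglongrightarrow> N"
    by (simp only: tendsto_of_real_iff)
  have int: "integrable lborel (\<lambda>w. gauss_weight (e n) w * (cmod (ft u w))\<^sup>2)" for n
  proof (rule Bochner_Integration.integrable_bound)
    show "integrable lborel (\<lambda>w. (LINT x|lborel. cmod (u x))\<^sup>2 * gauss_weight (e n) (w::'a))"
      by (intro integrable_mult_right integrable_gauss_weight e)
    have "(cmod (ft u w))\<^sup>2 \<le> (LINT x|lborel. cmod (u x))\<^sup>2" for w
      by (intro power_mono cmod_ft_le) simp
    then show "AE w in lborel. norm (gauss_weight (e n) w * (cmod (ft u w))\<^sup>2) \<le> norm ((LINT x|lborel. cmod (u x))\<^sup>2 * gauss_weight (e n) w)"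
      by (auto simp: gauss_weight_def)
  qed measurable
  have wlim: "(\<lambda>n. gauss_weight (e n) w) \<longlonglongrightarrow> 1" for w :: 'a
  proof -
    have "(\<lambda>n. gauss_weight (e n) w) \<longlonglongrightarrow> exp (- (norm ((2 * pi * 0) *\<^sub>R w))\<^sup>2 / 2)"
      unfolding gauss_weight_def by (intro tendsto_intros e0) auto
    then show ?thesis by simp
  qed
  have wmono: "gauss_weight (e n) w \<le> gauss_weight (e (Suc n)) w" for n and w :: 'a
    unfolding gauss_weight_def by (auto simp: e_def field_simps intro!: power_mono mult_mono)
  have "(\<lambda>n. \<integral>\<^sup>+w. ennreal (gauss_weight (e n) w * (cmod (ft u w))\<^sup>2) \<partial>lborel) \<longlonglongrightarrow> (\<integral>\<^sup>+w. ennreal ((cmod (ft u w))\<^sup>2) \<partial>lborel)"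
  proof (rule nn_integral_LIMSEQ)
    show "incseq (\<lambda>n w. ennreal (gauss_weight (e n) w * (cmod (ft u w))\<^sup>2))"
      by (intro incseq_SucI le_funI ennreal_leI mult_right_mono wmono) auto
    fix w
    have "(\<lambda>n. ennreal (gauss_weight (e n) w * (cmod (ft u w))\<^sup>2)) \<longlonglongrightarrow> ennreal (1 * (cmod (ft u w))\<^sup>2)"
      by (intro tendsto_ennrealI tendsto_intros wlim)
    then show "(\<lambda>n. ennreal (gauss_weight (e n) w * (cmod (ft u w))\<^sup>2)) \<longlonglongrightarrow> ennreal ((cmod (ft u w))\<^sup>2)"
      by simp
  qed measurable
  moreover have "(\<integral>\<^sup>+w. ennreal (gauss_weight (e n) w * (cmod (ft u w))\<^sup>2) \<partial>lborel)
      = ennreal (LINT w|lborel. gauss_weight (e n) w * (cmod (ft u w))\<^sup>2)" for n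
    by (rule nn_integral_eq_integral[OF int]) (auto simp: gauss_weight_def)
  moreover have "(\<lambda>n. ennreal (LINT w|lborel. gauss_weight (e n) w * (cmod (ft u w))\<^sup>2)) \<longlonglongrightarrow> ennreal N"
    by (intro tendsto_ennrealI lim1)
  ultimately show ?thesis
    using LIMSEQ_unique by force
qed

end

section \<open>Time-frequency space as a product\<close>

definition tf_join :: "(real^'m) \<times> (real^'m) \<Rightarrow> real^('m::finite + 'm)" where
  "tf_join p = (\<chi> j. case j of Inl i \<Rightarrow> fst p $ i | Inr i \<Rightarrow> snd p $ i)"

lemma tpart_tf_join [simp]: "tpart (tf_join p) = fst p"
  by (simp add: tpart_def tf_join_def vec_eq_iff)

lemma wpart_tf_join [simp]: "wpart (tf_join p) = snd p"
  by (simp add: wpart_def tf_join_def vec_eq_iff)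

lemma borel_measurable_tf_join [measurable]: "tf_join \<in> borel_measurable borel"
proof (rule borel_measurable_continuous_onI)
  show "continuous_on UNIV (tf_join :: (real^'m) \<times> (real^'m) \<Rightarrow> _)"
    unfolding tf_join_def
  proof (intro continuous_on_vec_lambda)
    fix j :: "'m + 'm"
    show "continuous_on UNIV (\<lambda>p::(real^'m) \<times> (real^'m). case j of Inl i \<Rightarrow> fst p $ i | Inr i \<Rightarrow> snd p $ i)"
      by (cases j) (auto intro!: continuous_intros)
  qed
qed

lemma borel_measurable_tpart [measurable]: "tpart \<in> borel_measurable borel"
  unfolding tpart_def by (intro borel_measurable_continuous_onI continuous_intros)

lemma borel_measurable_wpart [measurable]: "wpart \<in> borel_measurable borel"
  unfolding wpart_def by (intro borel_measurable_continuous_onI continuous_intros)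

lemma prod_Basis_cart: "(\<Prod>b\<in>Basis. (x::real^'k) \<bullet> b) = (\<Prod>i\<in>UNIV. x $ i)"
proof -
  have "(Basis :: (real^'k) set) = range (\<lambda>i. axis i 1)"
    by (auto simp: Basis_vec_def)
  then have "(\<Prod>b\<in>Basis. x \<bullet> b) = (\<Prod>b\<in>(\<lambda>i. axis i 1) ` UNIV. x \<bullet> b)"
    by (rule prod.cong) (rule refl)
  also have "\<dots> = (\<Prod>i\<in>UNIV. x \<bullet> axis i 1)"
    by (subst prod.reindex) (auto simp: inj_def axis_eq_axis)
  finally show ?thesis
    by (simp add: inner_axis)
qed

text \<open>Lebesgue measure is determined by its values on boxes, and a box in time-frequency space
  is a product of a time box and a frequency box. This allows integrating over frequency alone for a
  fixed time.\<close>

lemma lborel_tf_join: "distr (lborel \<Otimes>\<^sub>M lborel) borel tf_join = (lborel :: (real^('m::finite + 'm)) measure)"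
proof (rule lborel_eqI[symmetric])
  fix l u :: "real^('m::finite + 'm)" assume le: "\<And>b. b \<in> Basis \<Longrightarrow> l \<bullet> b \<le> u \<bullet> b"
  have le': "l $ j \<le> u $ j" for j
    using le[of "axis j 1"] by (simp add: inner_axis axis_in_Basis_iff)
  have [measurable]: "tf_join \<in> lborel \<Otimes>\<^sub>M lborel \<rightarrow>\<^sub>M (borel :: (real^('m::finite + 'm)) measure)"
    using borel_measurable_tf_join by (simp add: borel_prod[symmetric] cong: measurable_cong_sets sets_pair_measure_cong)
  have "tf_join -` box l u \<inter> space (lborel \<Otimes>\<^sub>M lborel) = box (tpart l) (tpart u) \<times> box (wpart l) (wpart u)"
    by (auto simp: tf_join_def mem_box_cart tpart_def wpart_def space_pair_measure split: sum.splits)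
  then have "emeasure (distr (lborel \<Otimes>\<^sub>M lborel) borel tf_join) (box l u)
      = emeasure lborel (box (tpart l) (tpart u)) * emeasure lborel (box (wpart l) (wpart u))"
    by (simp add: emeasure_distr lborel.emeasure_pair_measure_Times)
  also have "\<dots> = ennreal (\<Prod>i\<in>UNIV. tpart u $ i - tpart l $ i) * ennreal (\<Prod>i\<in>UNIV. wpart u $ i - wpart l $ i)"
  proof -
    have "emeasure lborel (box a b) = ennreal (\<Prod>i\<in>UNIV. b $ i - a $ i)" if "\<And>i. a $ i \<le> b $ i" for a b :: "real^'m"
    proof -
      have "a \<bullet> c \<le> b \<bullet> c" if "c \<in> Basis" for c
        using that \<open>\<And>i. a $ i \<le> b $ i\<close> by (auto simp: Basis_vec_def inner_axis)
      then show ?thesis by (simp add: prod_Basis_cart)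
    qed
    then show ?thesis using le' by (simp add: tpart_def wpart_def)
  qed
  also have "\<dots> = ennreal (\<Prod>j\<in>UNIV. u $ j - l $ j)"
    using le' by (subst ennreal_mult[symmetric])
      (auto simp: tpart_def wpart_def prod_nonneg UNIV_Plus_UNIV[symmetric] prod.Plus simp del: UNIV_Plus_UNIV)
  finally show "emeasure (distr (lborel \<Otimes>\<^sub>M lborel) borel tf_join) (box l u) = ennreal (\<Prod>b\<in>Basis. (u - l) \<bullet> b)"
    by (simp add: prod_Basis_cart)
qed simp

lemma nn_integral_lborel_tf:
  fixes f :: "real^('m::finite + 'm) \<Rightarrow> ennreal"
  assumes [measurable]: "f \<in> borel_measurable borel"
  shows "(\<integral>\<^sup>+z. f z \<partial>lborel) = (\<integral>\<^sup>+t. \<integral>\<^sup>+w. f (tf_join (t, w)) \<partial>lborel \<partial>lborel)"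
proof -
  have [measurable]: "tf_join \<in> lborel \<Otimes>\<^sub>M lborel \<rightarrow>\<^sub>M (borel :: (real^('m::finite + 'm)) measure)"
    using borel_measurable_tf_join by (simp add: borel_prod[symmetric] cong: measurable_cong_sets sets_pair_measure_cong)
  have "(\<integral>\<^sup>+z. f z \<partial>lborel) = (\<integral>\<^sup>+p. f (tf_join p) \<partial>(lborel \<Otimes>\<^sub>M lborel))"
    by (subst lborel_tf_join[symmetric], subst nn_integral_distr) auto
  also have "\<dots> = (\<integral>\<^sup>+t. \<integral>\<^sup>+w. f (tf_join (t, w)) \<partial>lborel \<partial>lborel)"
    by (subst lborel.nn_integral_fst[symmetric]) auto
  finally show ?thesis .
qed

section \<open>The short-time Fourier transform with respect to the unit cube\<close>

text \<open>Bounded with finite support, so that \<open>f\<close> times any translate of it is both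
  integrable and square integrable, as \<open>plancherel\<close> requires; its unit norm makes
  \<open>stft\<close> an isometry without constants.\<close>

definition win :: "real^'m \<Rightarrow> complex" where
  "win = indicator (cbox 0 One)"

lemma borel_measurable_win [measurable]: "win \<in> borel_measurable borel"
  by (simp add: win_def)

lemma cmod_win: "cmod (win x) = indicator (cbox 0 One) x"
  by (simp add: win_def indicator_def)

definition atom :: "real^('m::finite + 'm) \<Rightarrow> real^'m \<Rightarrow> complex" where
  "atom = gabor_atom win 0"

lemma borel_measurable_gabor_atom [measurable]:
  assumes [measurable]: "g \<in> borel_measurable borel"
  shows "gabor_atom g ph l \<in> borel_measurable borel"
  unfolding gabor_atom_def[abs_def] by measurable

lemma L2_borel_iff:
  "f \<in> borel_measurable borel \<Longrightarrow> L2 f \<longleftrightarrow> integrable lborel (\<lambda>x. (cmod (f x))\<^sup>2)"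
  by (auto simp: L2_def integrable_completion measurable_completion)

lemma cmod_gabor_atom: "cmod (gabor_atom g ph l x) = cmod (g (x - tpart l))"
  by (simp add: gabor_atom_def norm_mult)

lemma
  fixes g :: "real^'m \<Rightarrow> complex"
  assumes [measurable]: "g \<in> borel_measurable borel" and g: "L2 g"
  shows L2_gabor_atom: "L2 (gabor_atom g ph l)"
    and l2_normsq_gabor_atom: "l2_normsq (gabor_atom g ph l) = l2_normsq g"
proof -
  have i: "integrable lborel (\<lambda>x. (cmod (g x))\<^sup>2)"
    using g by (simp add: L2_borel_iff)
  show "L2 (gabor_atom g ph l)"
    using integrable_lborel_translate[OF i] by (simp add: L2_borel_iff cmod_gabor_atom)
  show "l2_normsq (gabor_atom g ph l) = l2_normsq g"
    unfolding l2_normsq_def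
    by (simp add: integral_completion cmod_gabor_atom integral_lborel_translate[where f="\<lambda>x. (cmod (g x))\<^sup>2"])
qed

lemma
  shows L2_win: "L2 (win :: real^'m \<Rightarrow> complex)"
    and l2_normsq_win: "l2_normsq (win :: real^'m \<Rightarrow> complex) = 1"
proof -
  have e: "(cmod (win x))\<^sup>2 = indicator (cbox 0 One) x" for x :: "real^'m"
    by (simp add: cmod_win indicator_def)
  show "L2 (win :: real^'m \<Rightarrow> complex)"
    by (simp add: L2_borel_iff e)
  show "l2_normsq (win :: real^'m \<Rightarrow> complex) = 1"
    by (simp add: l2_normsq_def e integral_completion measure_lborel_cbox_eq)
qed

lemma L2_atom: "L2 (atom z)"
  and l2_normsq_atom: "l2_normsq (atom z) = 1"
  by (simp_all add: atom_def L2_gabor_atom l2_normsq_gabor_atom L2_win l2_normsq_win)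

lemma l2_inner_lborel:
  assumes [measurable]: "f \<in> borel_measurable borel" "h \<in> borel_measurable borel"
  shows "l2_inner f h = (LINT x|lborel. f x * cnj (h x))"
  unfolding l2_inner_def by (rule integral_completion) measurable

definition stft :: "(real^'m \<Rightarrow> complex) \<Rightarrow> real^('m::finite + 'm) \<Rightarrow> complex" where
  "stft f z = l2_inner f (atom z)"

lemma borel_measurable_atom2 [measurable]:
  "(\<lambda>(z, x). atom z x) \<in> borel_measurable (borel \<Otimes>\<^sub>M borel)"
  unfolding atom_def gabor_atom_def by measurable

lemma borel_measurable_atom [measurable]: "atom z \<in> borel_measurable borel"
  unfolding atom_def by measurable

lemma borel_measurable_stft [measurable]:
  assumes [measurable]: "f \<in> borel_measurable borel"
  shows "stft f \<in> borel_measurable borel"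
proof -
  have "(\<lambda>z. LINT x|lborel. f x * cnj (atom z x)) \<in> borel_measurable borel"
    by (rule lborel.borel_measurable_lebesgue_integral) measurable
  then show ?thesis
    by (simp add: stft_def[abs_def] l2_inner_lborel)
qed

text \<open>For a fixed time \<open>t\<close>, the transform is the Fourier transform of
  \<open>f\<close> cut off to a unit cube at \<open>t\<close>. Plancherel in frequency leaves the
  squared modulus of \<open>f\<close> on that cube, and the set of \<open>t\<close> whose cube
  contains a given \<open>x\<close> has volume 1.\<close>

lemma nn_integral_stft:
  fixes f :: "real^'m \<Rightarrow> complex"
  assumes [measurable]: "f \<in> borel_measurable borel" and f: "L2 f"
  shows "(\<integral>\<^sup>+z. ennreal ((cmod (stft f z))\<^sup>2) \<partial>lborel) = ennreal (l2_normsq f)"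
proof -
  have fi: "integrable lborel (\<lambda>x. (cmod (f x))\<^sup>2)"
    using f by (simp add: L2_borel_iff)
  let ?I = "indicator (cbox 0 One) :: real^'m \<Rightarrow> real"
  define u where "u t x = f x * win (x - t)" for t x
  have [measurable]: "u t \<in> borel_measurable borel" for t
    unfolding u_def by measurable
  have ft: "stft f (tf_join (t, w)) = ft (u t) w" for t w
  proof -
    have "cnj (win y) = win y" for y :: "real^'m" by (simp add: win_def indicator_def)
    then show ?thesis
      by (simp add: stft_def l2_inner_lborel ft_def atom_def gabor_atom_def u_def cis_cnj mult_ac)
  qed
  have u_sq: "(cmod (u t x))\<^sup>2 = (cmod (f x))\<^sup>2 * ?I (x - t)" for t x
    by (simp add: u_def norm_mult cmod_win power_mult_distrib) (simp add: indicator_def)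
  have usq: "integrable lborel (\<lambda>x. (cmod (u t x))\<^sup>2)" for t
    unfolding u_sq by (rule Bochner_Integration.integrable_bound[OF fi]) (auto simp: indicator_def)
  have u1: "integrable lborel (u t)" for t
  proof (rule Bochner_Integration.integrable_bound)
    show "integrable lborel (\<lambda>x. (cmod (f x))\<^sup>2 + ?I (x - t))"
      by (intro Bochner_Integration.integrable_add fi integrable_lborel_translate integrable_real_indicator) auto
    have "a \<le> a\<^sup>2 + 1" for a :: real
    proof -
      have "2 * a \<le> a\<^sup>2 + 1" using two_mult_le_weighted[of 1 a 1] by simp
      then show ?thesis using zero_le_power2[of a] by linarith
    qed
    then show "AE x in lborel. norm (u t x) \<le> norm ((cmod (f x))\<^sup>2 + ?I (x - t))"
      by (auto simp: u_def norm_mult cmod_win indicator_def)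
  qed simp
  have "(\<integral>\<^sup>+z. ennreal ((cmod (stft f z))\<^sup>2) \<partial>lborel)
      = (\<integral>\<^sup>+t. \<integral>\<^sup>+w. ennreal ((cmod (ft (u t) w))\<^sup>2) \<partial>lborel \<partial>lborel)"
    by (subst nn_integral_lborel_tf) (auto simp: ft)
  also have "\<dots> = (\<integral>\<^sup>+t. \<integral>\<^sup>+x. ennreal ((cmod (f x))\<^sup>2 * ?I (x - t)) \<partial>lborel \<partial>lborel)"
  proof (rule nn_integral_cong)
    fix t
    interpret L1_L2 "u t" by unfold_locales (rule u1 usq)+
    show "(\<integral>\<^sup>+w. ennreal ((cmod (ft (u t) w))\<^sup>2) \<partial>lborel) = (\<integral>\<^sup>+x. ennreal ((cmod (f x))\<^sup>2 * ?I (x - t)) \<partial>lborel)"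
      unfolding plancherel N_def u_sq[symmetric] by (subst nn_integral_eq_integral[OF usq]) simp_all
  qed
  also have "\<dots> = (\<integral>\<^sup>+x. \<integral>\<^sup>+t. ennreal ((cmod (f x))\<^sup>2 * ?I (x - t)) \<partial>lborel \<partial>lborel)"
    by (rule lborel_pair.Fubini') measurable
  also have "\<dots> = (\<integral>\<^sup>+x. ennreal ((cmod (f x))\<^sup>2) \<partial>lborel)"
  proof (rule nn_integral_cong)
    fix x
    have "(\<integral>\<^sup>+t. ennreal ((cmod (f x))\<^sup>2 * ?I (x - t)) \<partial>lborel)
        = (\<integral>\<^sup>+t. ennreal ((cmod (f x))\<^sup>2) * indicator (cbox (x - One) x) t \<partial>lborel)"
    proof (rule nn_integral_cong)
      fix t
      have "x - t \<in> cbox 0 One \<longleftrightarrow> t \<in> cbox (x - One) x"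
        unfolding mem_box by (intro ball_cong refl) (auto simp: inner_diff_left)
      then show "ennreal ((cmod (f x))\<^sup>2 * ?I (x - t)) = ennreal ((cmod (f x))\<^sup>2) * indicator (cbox (x - One) x) t"
        by (simp add: indicator_def)
    qed
    also have "\<dots> = ennreal ((cmod (f x))\<^sup>2)"
      by (subst nn_integral_cmult_indicator) (auto simp: inner_diff_left)
    finally show "(\<integral>\<^sup>+t. ennreal ((cmod (f x))\<^sup>2 * ?I (x - t)) \<partial>lborel) = ennreal ((cmod (f x))\<^sup>2)" .
  qed
  also have "\<dots> = ennreal (l2_normsq f)"
    using fi by (simp add: l2_normsq_def integral_completion nn_integral_eq_integral)
  finally show ?thesis .
qed

lemma L2_stft:
  assumes [measurable]: "f \<in> borel_measurable borel" and f: "L2 f"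
  shows "L2 (stft f)"
  using nn_integral_stft[OF assms] by (simp add: L2_borel_iff integrable_iff_bounded)

lemma l2_normsq_stft:
  assumes [measurable]: "f \<in> borel_measurable borel" and f: "L2 f"
  shows "l2_normsq (stft f) = l2_normsq f"
proof -
  have "ennreal (l2_normsq (stft f)) = ennreal (l2_normsq f)"
    using nn_integral_stft[OF assms] L2_stft[OF assms]
    by (simp add: l2_normsq_def[of "stft f"] integral_completion L2_borel_iff nn_integral_eq_integral)
  then show ?thesis
    by (simp add: l2_normsq_nonneg)
qed

lemma l2_normsq_add_scaled:
  assumes f: "L2 f" and h: "L2 h"
  shows "l2_normsq (\<lambda>x. f x + c * h x) = l2_normsq f + 2 * Re (cnj c * l2_inner f h) + (cmod c)\<^sup>2 * l2_normsq h"
proof -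
  let ?s = "\<lambda>x. f x + c * h x"
  have s: "L2 ?s" by (intro L2_add L2_scale f h)
  have "l2_inner ?s ?s = l2_inner f ?s + c * l2_inner h ?s"
    by (simp add: l2_inner_add f h L2_scale s l2_inner_scale)
  also have "l2_inner f ?s = l2_inner f f + cnj c * l2_inner f h"
    by (subst (1 2 3) l2_inner_commute) (simp add: l2_inner_add f h L2_scale l2_inner_scale)
  also have "l2_inner h ?s = cnj (l2_inner f h) + cnj c * l2_inner h h"
    by (subst (1 3) l2_inner_commute) (simp add: l2_inner_add f h L2_scale l2_inner_scale l2_inner_self)
  finally have "complex_of_real (l2_normsq ?s) = of_real (l2_normsq f) + cnj c * l2_inner f h
      + c * (cnj (l2_inner f h) + cnj c * of_real (l2_normsq h))"
    by (simp add: l2_inner_self l2_inner_commute[of h f])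
  then have "l2_normsq ?s = Re (of_real (l2_normsq f) + cnj c * l2_inner f h
      + c * (cnj (l2_inner f h) + cnj c * of_real (l2_normsq h)))"
    by (metis Re_complex_of_real)
  also have "\<dots> = l2_normsq f + 2 * Re (cnj c * l2_inner f h) + (cmod c)\<^sup>2 * l2_normsq h"
    unfolding cmod_power2 by (simp add: algebra_simps power2_eq_square)
  finally show ?thesis .
qed

lemma stft_add_scaled: "L2 f \<Longrightarrow> L2 h \<Longrightarrow> stft (\<lambda>x. f x + c * h x) z = stft f z + c * stft h z"
  by (simp add: stft_def l2_inner_add L2_atom L2_scale l2_inner_scale)

text \<open>Polarization of the norm identity: the coefficients \<open>1\<close> and
  \<open>\<i>\<close> give the real and the imaginary part.\<close>

lemma l2_inner_stft:
  assumes [measurable]: "f \<in> borel_measurable borel" "h \<in> borel_measurable borel"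
    and f: "L2 f" and h: "L2 h"
  shows "l2_inner (stft f) (stft h) = l2_inner f h"
proof -
  have Re: "Re (cnj c * l2_inner (stft f) (stft h)) = Re (cnj c * l2_inner f h)" for c
  proof -
    have "l2_normsq (stft (\<lambda>x. f x + c * h x)) = l2_normsq (\<lambda>x. f x + c * h x)"
      by (intro l2_normsq_stft L2_add L2_scale f h) measurable
    then show ?thesis
      by (simp add: stft_add_scaled[OF f h, abs_def] l2_normsq_add_scaled f h L2_stft l2_normsq_stft)
  qed
  show ?thesis
    using Re[of 1] Re[of \<i>] by (simp add: complex_eq_iff)
qed

text \<open>Covariance: moving the shift \<open>l\<close> from one side of the inner product to the
  other costs only a factor of modulus 1. The arbitrary phase \<open>ph\<close> is absorbed in
  it.\<close>

lemma cmod_stft_gabor_atom: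
  assumes [measurable]: "g \<in> borel_measurable borel"
  shows "cmod (stft (gabor_atom g ph l) z) = cmod (stft g (z - l))"
proof -
  have tw: "tpart (z - l) = tpart z - tpart l" "wpart (z - l) = wpart z - wpart l"
    by (simp_all add: tpart_def wpart_def vec_eq_iff)
  let ?h = "\<lambda>x. gabor_atom g ph l x * cnj (atom z x)"
  have "stft (gabor_atom g ph l) z = (LINT x|lborel. ?h (x - (- tpart l)))"
    unfolding stft_def by (subst integral_lborel_translate) (auto simp: l2_inner_lborel)
  also have "\<dots> = (LINT x|lborel. cis (ph + 2 * pi * (wpart l \<bullet> tpart l) - 2 * pi * (wpart z \<bullet> tpart l))
      * (g x * cnj (atom (z - l) x)))"
  proof (intro Bochner_Integration.integral_cong refl)
    fix x
    have c: "cis ph * cis (2 * pi * (wpart l \<bullet> (x + tpart l))) * cis (- (2 * pi * (wpart z \<bullet> (x + tpart l))))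
      = cis (ph + 2 * pi * (wpart l \<bullet> tpart l) - 2 * pi * (wpart z \<bullet> tpart l)) * cis (- (2 * pi * ((wpart z - wpart l) \<bullet> x)))"
      by (simp add: cis_mult inner_add_right inner_diff_left algebra_simps)
    have "?h (x - (- tpart l)) = (cis ph * cis (2 * pi * (wpart l \<bullet> (x + tpart l))) * cis (- (2 * pi * (wpart z \<bullet> (x + tpart l)))))
        * (g x * cnj (win (x - (tpart z - tpart l))))"
      by (simp add: gabor_atom_def atom_def cis_cnj mult_ac algebra_simps)
    then show "?h (x - (- tpart l)) = cis (ph + 2 * pi * (wpart l \<bullet> tpart l) - 2 * pi * (wpart z \<bullet> tpart l))
      * (g x * cnj (atom (z - l) x))"
      unfolding c by (simp add: gabor_atom_def atom_def cis_cnj tw mult_ac)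
  qed
  also have "\<dots> = cis (ph + 2 * pi * (wpart l \<bullet> tpart l) - 2 * pi * (wpart z \<bullet> tpart l)) * stft g (z - l)"
    by (simp add: stft_def l2_inner_lborel)
  finally show ?thesis by (simp add: norm_mult)
qed

section \<open>Canonical duals\<close>

context l2_frame
begin

lemma form_commute: "form u f = cnj (form f u)"
proof -
  have "l2_inner u (G i) * l2_inner (G i) f = cnj (l2_inner f (G i) * l2_inner (G i) u)" for i
    by (simp add: l2_inner_commute[of u] l2_inner_commute[of "G i" f])
  then show ?thesis
    unfolding form_def by (simp only: infsum_cnj)
qed

text \<open>The inverse frame operator has norm at most \<open>1 / A\<close>: the lower frame bound
  compares \<open>A * l2_normsq v\<close> with the inner product of \<open>h\<close> and
  \<open>v\<close>, and Cauchy-Schwarz cancels one factor.\<close>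

lemma frame_operator_preimage_normsq:
  assumes v: "L2 v" and h: "L2 h" and eq: "form v v = l2_inner h v"
  shows "l2_normsq v \<le> l2_normsq h / A\<^sup>2"
proof (cases "l2_normsq v = 0")
  case True
  then show ?thesis by (simp add: l2_normsq_nonneg)
next
  case False
  then have pos: "0 < l2_normsq v"
    using l2_normsq_nonneg[of v] by simp
  have "(A * l2_normsq v)\<^sup>2 \<le> (energy v)\<^sup>2"
    using lower[OF v] A_pos pos by (intro power_mono) (auto simp: energy_def)
  also have "\<dots> = (cmod (l2_inner h v))\<^sup>2"
    by (simp add: eq[symmetric] form_self v)
  also have "\<dots> \<le> l2_normsq h * l2_normsq v"
    by (rule cmod_l2_inner_sq_le[OF h v])
  finally have "(A\<^sup>2 * l2_normsq v) * l2_normsq v \<le> l2_normsq h * l2_normsq v"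
    by (simp add: power2_eq_square mult_ac)
  then have "A\<^sup>2 * l2_normsq v \<le> l2_normsq h"
    using pos by simp
  with A_pos show ?thesis by (simp add: field_simps)
qed

end

section \<open>Borel representatives of square-integrable functions\<close>

lemma l2_inner_AE_left:
  assumes "AE x in lebesgue. f x = f' x" "f \<in> borel_measurable lebesgue" "f' \<in> borel_measurable lebesgue" "h \<in> borel_measurable lebesgue"
  shows "l2_inner f h = l2_inner f' h"
  unfolding l2_inner_def
proof (rule integral_cong_AE)
  note [measurable] = assms(2-4)
  show "(\<lambda>x. f x * cnj (h x)) \<in> borel_measurable lebesgue" "(\<lambda>x. f' x * cnj (h x)) \<in> borel_measurable lebesgue"
    by measurable
qed (use assms(1) in auto)

lemma L2_AE:
  assumes "L2 f" "AE x in lebesgue. f x = f' x" "f' \<in> borel_measurable lebesgue"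
  shows "L2 f'"
proof -
  note [measurable] = assms(3) L2_measurable[OF assms(1)]
  have "integrable lebesgue (\<lambda>x. (cmod (f x))\<^sup>2) \<longleftrightarrow> integrable lebesgue (\<lambda>x. (cmod (f' x))\<^sup>2)"
    by (rule Bochner_Integration.integrable_cong_AE) (use assms(2) in auto)
  then show ?thesis using assms by (simp add: L2_def)
qed

text \<open>Fubini over translated arguments such as \<open>x - t\<close> needs joint measurability,
  which Borel functions provide but merely Lebesgue measurable ones need not.\<close>

lemma lebesgue_ex_borel:
  fixes f :: "'a::euclidean_space \<Rightarrow> complex"
  assumes f: "f \<in> borel_measurable lebesgue"
  obtains f' where "f' \<in> borel_measurable borel" "AE x in lebesgue. f x = f' x"
proof -
  have "(\<lambda>x. Re (f x)) \<in> borel_measurable lebesgue" "(\<lambda>x. Im (f x)) \<in> borel_measurable lebesgue"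
    using f by auto
  from this[THEN completion_ex_borel_measurable_real]
  obtain r i where [measurable]: "r \<in> borel_measurable lborel" "i \<in> borel_measurable lborel"
    and ae: "AE x in lborel. Re (f x) = r x" "AE x in lborel. Im (f x) = i x"
    by blast
  show thesis
  proof
    show "(\<lambda>x. Complex (r x) (i x)) \<in> borel_measurable borel"
      unfolding Complex_eq by measurable
    have "AE x in lborel. f x = Complex (r x) (i x)"
      using ae by eventually_elim (simp add: complex_eq_iff)
    then show "AE x in lebesgue. f x = Complex (r x) (i x)"
      by (rule AE_completion)
  qed
qed

lemma L2_ex_borel:
  assumes f: "L2 f"
  obtains f' where "f' \<in> borel_measurable borel" "L2 f'" "AE x in lebesgue. f x = f' x"
    "\<And>h. L2 h \<Longrightarrow> l2_inner f' h = l2_inner f h"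
proof -
  obtain f' where f'[measurable]: "f' \<in> borel_measurable borel" and ae: "AE x in lebesgue. f x = f' x"
    using lebesgue_ex_borel[OF L2_measurable[OF f]] .
  have l: "f' \<in> borel_measurable lebesgue"
    by (simp add: measurable_completion)
  show thesis
    by (rule that[OF f' L2_AE[OF f ae l] ae])
       (rule l2_inner_AE_left[OF ae L2_measurable[OF f] l L2_measurable, symmetric])
qed

text \<open>Bridge from the sums in the frame inequalities to integrals over the index set, so that
  Tonelli applies to index and phase space together.\<close>

lemma nn_integral_count_space_infsum:
  fixes f :: "'i \<Rightarrow> real"
  assumes f: "f summable_on UNIV" and nn: "\<And>i. 0 \<le> f i"
  shows "(\<integral>\<^sup>+i. ennreal (f i) \<partial>count_space UNIV) = ennreal (\<Sum>\<^sub>\<infinity>i. f i)"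
proof -
  have s: "Infinite_Set_Sum.abs_summable_on f UNIV"
    by (rule abs_summable_equivalent[THEN iffD1]) (use f nn in simp)
  show ?thesis
    using nn by (simp add: nn_integral_conv_infsetsum[OF s] infsetsum_infsum[OF s])
qed

locale l2_frame_dual = l2_frame G A B for G :: "'i \<Rightarrow> real^'m \<Rightarrow> complex" and A B +
  fixes d :: "'i \<Rightarrow> real^'m \<Rightarrow> complex"
  assumes L2_d: "L2 (d i)"
    and form_d: "L2 f \<Longrightarrow> form (d i) f = l2_inner (G i) f"
begin

lemma l2_normsq_d: "l2_normsq (d i) \<le> l2_normsq (G i) / A\<^sup>2"
  by (intro frame_operator_preimage_normsq L2_d L2_G form_d)

lemma l2_inner_d: "l2_inner (G i) (d i) = of_real (energy (d i))"
  using form_d[OF L2_d[of i], of i] by (simp add: form_self L2_d)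

text \<open>Hermitian symmetry of \<open>form\<close> shows that any two canonical duals give the
  same value, which justifies the definite description and shows that the value is real.\<close>

lemma dual_diag_eq: "dual_diag G i = of_real (energy (d i))"
  unfolding dual_diag_def
proof (rule the_equality)
  have "is_canonical_dual G i (d i)"
    unfolding is_canonical_dual_def using L2_d form_d[unfolded form_def] by blast
  then show "\<exists>e. is_canonical_dual G i e \<and> complex_of_real (energy (d i)) = l2_inner (G i) e"
    using l2_inner_d[of i] by metis
next
  fix c assume "\<exists>e. is_canonical_dual G i e \<and> c = l2_inner (G i) e"
  then obtain e where e: "L2 e" "\<And>f. L2 f \<Longrightarrow> form e f = l2_inner (G i) f" and c: "c = l2_inner (G i) e"
    unfolding is_canonical_dual_def form_def by blast
  have "c = form (d i) e" by (simp add: c form_d e(1))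
  also have "\<dots> = cnj (form e (d i))" by (rule form_commute)
  also have "\<dots> = of_real (energy (d i))" by (simp add: e(2) L2_d l2_inner_d)
  finally show "c = of_real (energy (d i))" .
qed

text \<open>All four claims transfer from the frame itself: with S v = h, self-adjointness of S
  turns the dual coefficients of \<open>h\<close> into frame coefficients of \<open>v\<close>, whose
  norm is controlled by that of \<open>h\<close>.\<close>

lemma
  assumes h: "L2 h"
  shows summable_d: "(\<lambda>i. (cmod (l2_inner (d i) h))\<^sup>2) summable_on UNIV"
    and infsum_d_le: "(\<Sum>\<^sub>\<infinity>i. (cmod (l2_inner (d i) h))\<^sup>2) \<le> \<bar>B\<bar> / A\<^sup>2 * l2_normsq h"
    and reconstruction: "(\<Sum>\<^sub>\<infinity>i. l2_inner h (G i) * l2_inner (d i) h) = of_real (l2_normsq h)"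
    and abs_summable_reconstruction: "(\<lambda>i. norm (l2_inner h (G i) * l2_inner (d i) h)) summable_on UNIV"
proof -
  obtain v where v: "L2 v" "\<And>f. L2 f \<Longrightarrow> form v f = l2_inner h f"
    using frame_operator_surj[OF h] by blast
  have d: "l2_inner (d i) h = l2_inner (G i) v" for i
  proof -
    have "l2_inner (d i) h = cnj (form v (d i))"
      by (simp add: v(2)[OF L2_d] l2_inner_commute[of h])
    also have "\<dots> = l2_inner (G i) v"
      using form_commute[of "d i" v] by (simp add: form_d v)
    finally show ?thesis .
  qed
  have c: "cmod (l2_inner (d i) h) = cmod (l2_inner v (G i))" for i
    by (simp add: d l2_inner_commute[of _ v])
  show "(\<lambda>i. (cmod (l2_inner (d i) h))\<^sup>2) summable_on UNIV"
    unfolding c by (rule summable[OF v(1)])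
  have "(\<Sum>\<^sub>\<infinity>i. (cmod (l2_inner (d i) h))\<^sup>2) \<le> B * l2_normsq v"
    unfolding c by (rule upper[OF v(1)])
  also have "\<dots> \<le> \<bar>B\<bar> * l2_normsq v"
    by (intro mult_right_mono l2_normsq_nonneg) simp
  also have "\<dots> \<le> \<bar>B\<bar> * (l2_normsq h / A\<^sup>2)"
    by (intro mult_left_mono frame_operator_preimage_normsq v h) auto
  finally show "(\<Sum>\<^sub>\<infinity>i. (cmod (l2_inner (d i) h))\<^sup>2) \<le> \<bar>B\<bar> / A\<^sup>2 * l2_normsq h"
    by simp
  have "(\<Sum>\<^sub>\<infinity>i. l2_inner h (G i) * l2_inner (d i) h) = form h v"
    by (simp add: d form_def)
  also have "\<dots> = cnj (form v h)" by (rule form_commute)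
  also have "\<dots> = of_real (l2_normsq h)" by (simp add: v h l2_inner_self)
  finally show "(\<Sum>\<^sub>\<infinity>i. l2_inner h (G i) * l2_inner (d i) h) = of_real (l2_normsq h)" .
  show "(\<lambda>i. norm (l2_inner h (G i) * l2_inner (d i) h)) summable_on UNIV"
    unfolding d by (rule abs_summable_form[OF h v(1)])
qed

end

lemma (in l2_frame) dual_exists:
  obtains d where "\<And>i. d i \<in> borel_measurable borel" "l2_frame_dual G A B d"
proof -
  have "\<exists>e. e \<in> borel_measurable borel \<and> L2 e \<and> (\<forall>f. L2 f \<longrightarrow> form e f = l2_inner (G i) f)" for i
  proof -
    obtain v where v: "L2 v" "\<And>f. L2 f \<Longrightarrow> form v f = l2_inner (G i) f"
      using frame_operator_surj[OF L2_G] by blast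
    obtain e where e: "e \<in> borel_measurable borel" "L2 e" "\<And>h. L2 h \<Longrightarrow> l2_inner e h = l2_inner v h"
      using L2_ex_borel[OF v(1)] by metis
    have "form e f = form v f" for f
      by (simp add: form_def e(3) L2_G)
    with e v show ?thesis by metis
  qed
  then obtain d where "\<And>i. d i \<in> borel_measurable borel \<and> L2 (d i) \<and> (\<forall>f. L2 f \<longrightarrow> form (d i) f = l2_inner (G i) f)"
    by metis
  then show thesis
    by (intro that[of d]) (auto intro!: l2_frame_dual.intro l2_frame_dual_axioms.intro l2_frame_axioms)
qed

section \<open>Parallelepipeds\<close>

text \<open>Described through inverse coordinates, so that enlarging by a shift adds half-widths;
  the centre \<open>c\<close> is given in these coordinates. The half-width is real because boundary
  layers of arbitrary thickness occur.\<close>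

definition par :: "real^'k^'k \<Rightarrow> real^'k \<Rightarrow> real \<Rightarrow> (real^'k) set" where
  "par M c r = {y. \<forall>j. \<bar>(matrix_inv M *v y) $ j - c $ j\<bar> \<le> r}"

lemma matrix_inv_cancel:
  fixes M :: "real^'k^'k"
  assumes "invertible M"
  shows "M ** matrix_inv M = mat 1" "matrix_inv M ** M = mat 1"
  using someI_ex[OF assms[unfolded invertible_def]] by (simp_all add: matrix_inv_def)

lemma par_mono: "r \<le> s \<Longrightarrow> par M c r \<subseteq> par M c s"
  by (auto simp: par_def intro: order_trans)

lemma par_eq_image:
  fixes M :: "real^'k^'k"
  assumes M: "invertible M"
  shows "par M c r = (\<lambda>x. M *v x) ` {x. \<forall>j. \<bar>x $ j - c $ j\<bar> \<le> r}"
proof -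
  have 1: "M *v (matrix_inv M *v y) = y" for y
    using M by (simp add: matrix_vector_mul_assoc matrix_inv_cancel)
  have 2: "matrix_inv M *v (M *v x) = x" for x
    using M by (simp add: matrix_vector_mul_assoc matrix_inv_cancel)
  show ?thesis
    unfolding par_def using 1 2 by (auto simp: image_iff) metis
qed

lemma MQ_eq_par: "invertible M \<Longrightarrow> MQ M n c = par M c (real n / 2)"
  by (simp add: MQ_def cube_def par_eq_image)

lemma par_borel [measurable]: "par M c r \<in> sets borel"
proof -
  have "closed (par M c r)"
    unfolding par_def by (intro closed_Collect_all closed_Collect_le continuous_intros
       matrix_vector_mult_linear_continuous_on continuous_on_component)
  then show ?thesis by simp
qed

text \<open>For invertible \<open>M\<close> this is the absolute value of the determinant; only
  positivity and the scaling in the half-width are used.\<close>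

definition par_vol :: "real^'k^'k \<Rightarrow> real" where
  "par_vol M = measure lborel (par M 0 (1/2))"

lemma emeasure_par_unit:
  fixes M :: "real^'k^'k"
  assumes M: "invertible M"
  shows "emeasure lborel (par M 0 (1/2)) = ennreal (par_vol M)"
proof -
  have "\<bar>t\<bar> \<le> 1/2 \<longleftrightarrow> - (1/2) \<le> t \<and> t \<le> 1/2" for t :: real
    by auto
  then have "{x::real^'k. \<forall>j. \<bar>x $ j - 0 $ j\<bar> \<le> 1/2} = cbox (\<chi> j. - (1/2)) (\<chi> j. 1/2)"
    by (simp only: set_eq_iff mem_Collect_eq mem_box_cart vec_lambda_beta zero_index diff_zero) blast
  then have "par M 0 (1/2) = (\<lambda>x. M *v x) ` cbox (\<chi> j. - (1/2)) (\<chi> j. 1/2)"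
    by (simp only: par_eq_image[OF M])
  then have "compact (par M 0 (1/2))"
    by (auto intro!: compact_continuous_image matrix_vector_mult_linear_continuous_on)
  then have "emeasure lborel (par M 0 (1/2)) \<noteq> \<infinity>"
    using emeasure_compact_finite by fastforce
  then show ?thesis
    unfolding par_vol_def by (intro emeasure_eq_ennreal_measure) simp
qed

lemma emeasure_par:
  fixes M :: "real^'k^'k"
  assumes M: "invertible M" and r: "0 < r"
  shows "emeasure lborel (par M c r) = ennreal (par_vol M * (2 * r) ^ CARD('k))"
proof -
  let ?T = "\<lambda>x. M *v c + (2 * r) *\<^sub>R x"
  have [measurable]: "?T \<in> borel_measurable borel" by measurable
  have pre: "?T -` par M c r = par M 0 (1/2)"
  proof -
    have "matrix_inv M *v (M *v c + (2 * r) *\<^sub>R x) = c + (2 * r) *\<^sub>R (matrix_inv M *v x)" for x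
      using M by (simp add: matrix_vector_right_distrib matrix_vector_mult_scaleR matrix_vector_mul_assoc matrix_inv_cancel)
    then show ?thesis
      using r by (auto simp: par_def abs_mult field_simps)
  qed
  have "emeasure lborel (par M c r)
      = emeasure (Nonnegative_Lebesgue_Integration.density (distr lborel borel ?T) (\<lambda>_. ennreal (\<bar>2 * r\<bar> ^ DIM(real^'k)))) (par M c r)"
    by (subst lborel_affine[of "2 * r" "M *v c"]) (use r in auto)
  also have "\<dots> = ennreal (\<bar>2 * r\<bar> ^ DIM(real^'k)) * emeasure lborel (par M 0 (1/2))"
    by (subst emeasure_density) (auto simp: nn_integral_cmult emeasure_distr pre)
  also have "\<dots> = ennreal (par_vol M * (2 * r) ^ CARD('k))"
    using r by (simp add: emeasure_par_unit[OF M] par_vol_def ennreal_mult' mult.commute)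
  finally show ?thesis .
qed

lemma par_exhaust: "\<exists>n. x \<in> par M 0 (real n)"
proof -
  let ?S = "range (\<lambda>j. \<bar>(matrix_inv M *v x) $ j\<bar>)"
  obtain n where "Max ?S \<le> real n" using real_arch_simple by blast
  moreover have "\<bar>(matrix_inv M *v x) $ j\<bar> \<le> Max ?S" for j
    by (rule Max_ge) auto
  ultimately have "\<bar>(matrix_inv M *v x) $ j\<bar> \<le> real n" for j
    by (rule order_trans[rotated])
  then show ?thesis by (auto simp: par_def)
qed

text \<open>Were it zero, every centred parallelepiped would be null by scaling, and countably many
  of them exhaust the space.\<close>

lemma par_vol_pos:
  fixes M :: "real^'k^'k"
  assumes M: "invertible M"
  shows "0 < par_vol M"
proof (rule ccontr)
  assume "\<not> 0 < par_vol M"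
  then have "par_vol M = 0" by (simp add: par_vol_def not_less measure_le_0_iff)
  then have "par M 0 (real (Suc n)) \<in> null_sets lborel" for n
    using emeasure_par[OF M, of "real (Suc n)" 0] by auto
  then have "(\<Union>n. par M 0 (real (Suc n))) \<in> null_sets lborel"
    by (rule null_sets_UN)
  moreover have "(\<Union>n. par M 0 (real (Suc n))) = UNIV"
  proof (intro set_eqI iffI UNIV_I)
    fix x
    obtain n where "x \<in> par M 0 (real n)" using par_exhaust by blast
    then show "x \<in> (\<Union>n. par M 0 (real (Suc n)))"
      using par_mono[of "real n" "real (Suc n)" M 0] by auto
  qed
  ultimately show False
    by (auto simp: null_sets_def)
qed

lemma par_add: "x \<in> par M c r \<Longrightarrow> k \<in> par M 0 s \<Longrightarrow> x + k \<in> par M c (r + s)"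
proof -
  assume x: "x \<in> par M c r" and k: "k \<in> par M 0 s"
  have "\<bar>(matrix_inv M *v (x + k)) $ j - c $ j\<bar> \<le> r + s" for j
  proof -
    have "\<bar>(matrix_inv M *v x) $ j - c $ j\<bar> \<le> r" "\<bar>(matrix_inv M *v k) $ j\<bar> \<le> s"
      using x k by (auto simp: par_def)
    then show ?thesis by (simp add: matrix_vector_right_distrib)
  qed
  then show ?thesis by (simp add: par_def)
qed

lemma par_uminus: "k \<in> par M 0 s \<Longrightarrow> - k \<in> par M 0 s"
  using matrix_vector_mult_diff_distrib[of "matrix_inv M" 0 k] by (simp add: par_def)

text \<open>The dimension \<open>D\<close> is a variable because a constant for it would carry a type argument.\<close>
locale gabor_frame =
  fixes g :: "real^'m \<Rightarrow> complex" and ph :: "'i::countable \<Rightarrow> real" and lam :: "'i \<Rightarrow> real^('m + 'm)"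
    and A B :: real and d :: "'i \<Rightarrow> real^'m \<Rightarrow> complex"
    and M :: "real^('m + 'm)^('m + 'm)" and c0 :: "real^('m + 'm)" and D :: nat
  assumes g_borel [measurable]: "g \<in> borel_measurable borel"
    and L2_g: "L2 g"
    and d_borel [measurable]: "d i \<in> borel_measurable borel"
    and dual: "l2_frame_dual (\<lambda>i. gabor_atom g (ph i) (lam i)) A B d"
    and M: "invertible M"
    and D: "D = CARD('m + 'm)"
begin

abbreviation "G \<equiv> \<lambda>i. gabor_atom g (ph i) (lam i)"

sublocale l2_frame_dual G A B d by (rule dual)

lemma emeasure_par_D: "0 < r \<Longrightarrow> emeasure lborel (par M c r) = ennreal (par_vol M * (2 * r) ^ D)"
  using emeasure_par[OF M] by (simp only: D)

lemma D_pos: "0 < D"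
  by (simp add: D)

definition V :: "real^('m + 'm) \<Rightarrow> real" where
  "V z = (cmod (stft g z))\<^sup>2"

text \<open>Unlike for \<open>V\<close>, there is no reduction to \<open>z - lam i\<close>: the dual
  elements need not be shifts of one function. Only the integral over \<open>z\<close> and the sum
  over \<open>i\<close> are controlled.\<close>

definition W :: "'i \<Rightarrow> real^('m + 'm) \<Rightarrow> real" where
  "W i z = (cmod (stft (d i) z))\<^sup>2"

lemma measurable_V [measurable]: "V \<in> borel_measurable borel"
  unfolding V_def[abs_def] by measurable

lemma measurable_W [measurable]: "W i \<in> borel_measurable borel"
  unfolding W_def[abs_def] by measurable

lemma cmod_stft_G_sq: "(cmod (stft (G i) z))\<^sup>2 = V (z - lam i)"
  by (simp add: V_def cmod_stft_gabor_atom)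

lemma l2_inner_atom_G: "l2_inner (atom z) (G i) = cnj (stft (G i) z)"
  unfolding stft_def by (rule l2_inner_commute)

lemma nn_integral_V: "(\<integral>\<^sup>+z. ennreal (V z) \<partial>lborel) = ennreal (l2_normsq g)"
  unfolding V_def by (rule nn_integral_stft[OF g_borel L2_g])

lemma nn_integral_V_translate: "(\<integral>\<^sup>+z. ennreal (V (z - l)) \<partial>lborel) = ennreal (l2_normsq g)"
  using nn_integral_lborel_translate[of "\<lambda>z. ennreal (V z)" l] nn_integral_V by simp

lemma nn_integral_W: "(\<integral>\<^sup>+z. ennreal (W i z) \<partial>lborel) \<le> ennreal (l2_normsq g / A\<^sup>2)"
  using l2_normsq_d[of i] unfolding W_def
  by (subst nn_integral_stft[OF d_borel L2_d]) (simp add: l2_normsq_gabor_atom L2_g ennreal_leI)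

text \<open>The Bessel inequality for the unit vector \<open>atom z\<close>, with covariance turning
  its coefficients into values of \<open>V\<close>.\<close>

lemma sum_V_le: "(\<integral>\<^sup>+i. ennreal (V (z - lam i)) \<partial>count_space UNIV) \<le> ennreal \<bar>B\<bar>"
proof -
  have "V (z - lam i) = (cmod (l2_inner (atom z) (G i)))\<^sup>2" for i
    by (simp add: cmod_stft_G_sq[symmetric] l2_inner_atom_G)
  then have "(\<integral>\<^sup>+i. ennreal (V (z - lam i)) \<partial>count_space UNIV) = ennreal (\<Sum>\<^sub>\<infinity>i. (cmod (l2_inner (atom z) (G i)))\<^sup>2)"
    using nn_integral_count_space_infsum[OF summable[OF L2_atom]] by simp
  also have "\<dots> \<le> ennreal \<bar>B\<bar>"
    using upper[OF L2_atom, of z] by (intro ennreal_leI) (simp add: l2_normsq_atom)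
  finally show ?thesis .
qed

lemma sum_W_le: "(\<integral>\<^sup>+i. ennreal (W i z) \<partial>count_space UNIV) \<le> ennreal (\<bar>B\<bar> / A\<^sup>2)"
proof -
  have "(\<integral>\<^sup>+i. ennreal (W i z) \<partial>count_space UNIV) = ennreal (\<Sum>\<^sub>\<infinity>i. (cmod (l2_inner (d i) (atom z)))\<^sup>2)"
    using nn_integral_count_space_infsum[OF summable_d[OF L2_atom]] by (simp add: W_def stft_def)
  also have "\<dots> \<le> ennreal (\<bar>B\<bar> / A\<^sup>2)"
    using infsum_d_le[OF L2_atom, of z] by (intro ennreal_leI) (simp add: l2_normsq_atom)
  finally show ?thesis .
qed

lemma l2_normsq_g_pos: "0 < l2_normsq g"
proof (rule ccontr)
  assume "\<not> 0 < l2_normsq g"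
  then have 0: "l2_normsq g = 0"
    using l2_normsq_nonneg[of g] by simp
  have "l2_inner win (G i) = 0" for i
    using cmod_l2_inner_sq_le[OF L2_win L2_G[of i]] 0
    by (simp add: l2_normsq_gabor_atom L2_g)
  then show False
    using lower[OF L2_win] A_pos by (simp add: l2_normsq_win)
qed

section \<open>Counting points of the index family\<close>

text \<open>Counts indices, hence repeated points with multiplicity. Extended values are needed
  because finiteness on bounded sets is a consequence of the estimates below.\<close>

definition count :: "(real^('m + 'm)) set \<Rightarrow> ennreal" where
  "count E = emeasure (count_space UNIV) {i. lam i \<in> E}"

text \<open>A point of \<open>E\<close> carries the mass of \<open>V\<close> on \<open>K\<close> inside \<open>E'\<close>, while the Bessel bound limits the total mass.\<close>
lemma count_mass_le:
  assumes [measurable]: "K \<in> sets borel" "E' \<in> sets borel"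
    and sub: "\<And>x k. x \<in> E \<Longrightarrow> k \<in> K \<Longrightarrow> x + k \<in> E'"
  shows "count E * (\<integral>\<^sup>+u\<in>K. ennreal (V u) \<partial>lborel) \<le> ennreal \<bar>B\<bar> * emeasure lborel E'"
proof -
  have shift: "(\<integral>\<^sup>+u\<in>K. ennreal (V u) \<partial>lborel) = (\<integral>\<^sup>+z. ennreal (V (z - lam i)) * indicator K (z - lam i) \<partial>lborel)" for i
    by (subst nn_integral_lborel_translate[of "\<lambda>u. ennreal (V u) * indicator K u", symmetric]) auto
  have "count E * (\<integral>\<^sup>+u\<in>K. ennreal (V u) \<partial>lborel)
      = (\<integral>\<^sup>+i. (\<integral>\<^sup>+u\<in>K. ennreal (V u) \<partial>lborel) * indicator {i. lam i \<in> E} i \<partial>count_space UNIV)"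
    unfolding count_def by (subst nn_integral_cmult_indicator) (auto simp: mult.commute)
  also have "\<dots> \<le> (\<integral>\<^sup>+i. \<integral>\<^sup>+z. ennreal (V (z - lam i)) * indicator E' z \<partial>lborel \<partial>count_space UNIV)"
  proof (rule nn_integral_mono)
    fix i
    show "(\<integral>\<^sup>+u\<in>K. ennreal (V u) \<partial>lborel) * indicator {i. lam i \<in> E} i \<le> (\<integral>\<^sup>+z. ennreal (V (z - lam i)) * indicator E' z \<partial>lborel)"
    proof (cases "lam i \<in> E")
      case True
      have "indicator K (z - lam i) \<le> (indicator E' z :: ennreal)" for z
        using sub[OF True, of "z - lam i"] by (auto simp: indicator_def)
      then show ?thesis
        using True unfolding shift[of i] by (auto intro!: nn_integral_mono mult_left_mono)
    qed simp
  qed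
  also have "\<dots> = (\<integral>\<^sup>+z. \<integral>\<^sup>+i. ennreal (V (z - lam i)) * indicator E' z \<partial>count_space UNIV \<partial>lborel)"
    by (rule nn_integral_count_space_nn_integral[symmetric]) auto
  also have "\<dots> = (\<integral>\<^sup>+z. (\<integral>\<^sup>+i. ennreal (V (z - lam i)) \<partial>count_space UNIV) * indicator E' z \<partial>lborel)"
    by (intro nn_integral_cong nn_integral_multc) auto
  also have "\<dots> \<le> (\<integral>\<^sup>+z. ennreal \<bar>B\<bar> * indicator E' z \<partial>lborel)"
    by (intro nn_integral_mono mult_right_mono sum_V_le) auto
  also have "\<dots> = ennreal \<bar>B\<bar> * emeasure lborel E'"
    by (rule nn_integral_cmult_indicator) simp
  finally show ?thesis .
qed

lemma mass_radius_exists: "\<exists>R>0. (\<integral>\<^sup>+u\<in>par M 0 R. ennreal (V u) \<partial>lborel) \<noteq> 0"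
proof (rule ccontr)
  assume neg: "\<not> ?thesis"
  have "AE u in lborel. ennreal (V u) * indicator (par M 0 (real (Suc n))) u = 0" for n
    by (subst nn_integral_0_iff_AE[symmetric]) (use neg in auto)
  then have "AE u in lborel. \<forall>n. ennreal (V u) * indicator (par M 0 (real (Suc n))) u = 0"
    unfolding AE_all_countable by blast
  then have "AE u in lborel. ennreal (V u) = 0"
  proof eventually_elim
    case (elim u)
    obtain n where "u \<in> par M 0 (real n)" using par_exhaust by blast
    then have "u \<in> par M 0 (real (Suc n))"
      using par_mono[of "real n" "real (Suc n)" M 0] by auto
    with elim[rule_format, of n] show ?case by simp
  qed
  then have "(\<integral>\<^sup>+u. ennreal (V u) \<partial>lborel) = 0"
    by (subst nn_integral_0_iff_AE) auto
  then show False
    using l2_normsq_g_pos by (simp add: nn_integral_V)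
qed

text \<open>A fixed half-width whose centred parallelepiped carries positive mass of
  \<open>V\<close>. The counting bounds below all thicken sets by this \<open>R\<close>.\<close>

definition R :: real where
  "R = (SOME R. R > 0 \<and> (\<integral>\<^sup>+u\<in>par M 0 R. ennreal (V u) \<partial>lborel) \<noteq> 0)"

definition mass :: real where
  "mass = enn2real (\<integral>\<^sup>+u\<in>par M 0 R. ennreal (V u) \<partial>lborel)"

lemma R_pos: "0 < R" and mass_pos: "0 < mass"
  and mass_eq: "(\<integral>\<^sup>+u\<in>par M 0 R. ennreal (V u) \<partial>lborel) = ennreal mass"
proof -
  have R: "R > 0 \<and> (\<integral>\<^sup>+u\<in>par M 0 R. ennreal (V u) \<partial>lborel) \<noteq> 0"
    unfolding R_def by (rule someI_ex) (use mass_radius_exists in blast)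
  then show "0 < R" by blast
  have "(\<integral>\<^sup>+u\<in>par M 0 R. ennreal (V u) \<partial>lborel) \<le> (\<integral>\<^sup>+u. ennreal (V u) \<partial>lborel)"
    by (intro nn_integral_mono) (auto simp: indicator_def)
  also have "\<dots> < \<infinity>" by (simp add: nn_integral_V)
  finally have fin: "(\<integral>\<^sup>+u\<in>par M 0 R. ennreal (V u) \<partial>lborel) < \<infinity>" .
  with R show "0 < mass"
    unfolding mass_def by (simp add: enn2real_positive_iff zero_less_iff_neq_zero)
  show "(\<integral>\<^sup>+u\<in>par M 0 R. ennreal (V u) \<partial>lborel) = ennreal mass"
    using fin unfolding mass_def by simp
qed

text \<open>\<open>\<bar>B\<bar> / mass\<close> bounds the points per unit volume; the factor
  \<open>par_vol M\<close> lets later bounds be stated in powers of edge lengths.\<close>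

definition C1 :: real where "C1 = \<bar>B\<bar> / mass * par_vol M"

lemma C1_nonneg: "0 \<le> C1"
  using mass_pos par_vol_pos[OF M] by (simp add: C1_def)

lemma count_le:
  assumes [measurable]: "E' \<in> sets borel"
    and sub: "\<And>x k. x \<in> E \<Longrightarrow> k \<in> par M 0 R \<Longrightarrow> x + k \<in> E'"
    and vol: "emeasure lborel E' = ennreal (par_vol M * t)"
    and t: "0 \<le> t"
  shows "count E \<le> ennreal (C1 * t)"
proof -
  have "count E * ennreal mass \<le> ennreal \<bar>B\<bar> * ennreal (par_vol M * t)"
    using count_mass_le[of "par M 0 R" E' E] sub by (simp add: mass_eq vol)
  then have le: "count E * ennreal mass \<le> ennreal (\<bar>B\<bar> * (par_vol M * t))"
    using t par_vol_pos[OF M] by (simp add: ennreal_mult)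
  have "count E = count E * ennreal mass * ennreal (1 / mass)"
    using mass_pos by (simp add: mult.assoc flip: ennreal_mult)
  also have "\<dots> \<le> ennreal (\<bar>B\<bar> * (par_vol M * t)) * ennreal (1 / mass)"
    by (rule mult_right_mono[OF le]) simp
  also have "\<dots> = ennreal (C1 * t)"
    using mass_pos t par_vol_pos[OF M] by (simp add: C1_def flip: ennreal_mult)
  finally show ?thesis .
qed

lemma count_translate_le:
  assumes r: "0 < r"
  shows "count {y. y + u \<in> par M c0 r} \<le> ennreal (C1 * (2 * (r + R)) ^ D)"
proof (rule count_le[where E'="{y. y + u \<in> par M c0 (r + R)}"])
  show "{y. y + u \<in> par M c0 (r + R)} \<in> sets borel" by measurable
  show "x + k \<in> {y. y + u \<in> par M c0 (r + R)}" if "x \<in> {y. y + u \<in> par M c0 r}" "k \<in> par M 0 R" for x k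
    using par_add[of "x + u" M c0 r k R] that by (simp add: algebra_simps)
  have "emeasure lborel {y. y + u \<in> par M c0 (r + R)} = (\<integral>\<^sup>+y. indicator (par M c0 (r + R)) (y - (- u)) \<partial>lborel)"
  proof -
    have "(\<lambda>y. indicator (par M c0 (r + R)) (y - (- u)) :: ennreal) = indicator {y. y + u \<in> par M c0 (r + R)}"
      by (auto simp: indicator_def fun_eq_iff)
    then show ?thesis by simp
  qed
  also have "\<dots> = emeasure lborel (par M c0 (r + R))"
    by (subst nn_integral_lborel_translate) auto
  also have "\<dots> = ennreal (par_vol M * (2 * (r + R)) ^ D)"
    using r R_pos by (intro emeasure_par_D) simp
  finally show "emeasure lborel {y. y + u \<in> par M c0 (r + R)} = ennreal (par_vol M * (2 * (r + R)) ^ D)" .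
qed (use r R_pos in simp)

lemma count_shell_le:
  assumes r: "R < r" "r \<le> s"
  shows "count (par M c0 s - par M c0 r) \<le> ennreal (C1 * ((2 * (s + R)) ^ D - (2 * (r - R)) ^ D))"
proof (rule count_le[where E'="par M c0 (s + R) - par M c0 (r - R)"])
  show "x + k \<in> par M c0 (s + R) - par M c0 (r - R)" if "x \<in> par M c0 s - par M c0 r" "k \<in> par M 0 R" for x k
  proof -
    have "x + k \<notin> par M c0 (r - R)"
      using par_add[of "x + k" M c0 "r - R" "- k" R] par_uminus[OF that(2)] that(1) by auto
    moreover have "x + k \<in> par M c0 (s + R)"
      using that by (intro par_add) auto
    ultimately show ?thesis by blast
  qed
  have "emeasure lborel (par M c0 (s + R) - par M c0 (r - R)) = emeasure lborel (par M c0 (s + R)) - emeasure lborel (par M c0 (r - R))"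
    using r R_pos by (intro emeasure_Diff) (auto simp: emeasure_par_D intro: par_mono[THEN subsetD, rotated])
  also have "\<dots> = ennreal (par_vol M * (2 * (s + R)) ^ D) - ennreal (par_vol M * (2 * (r - R)) ^ D)"
    using r R_pos by (simp add: emeasure_par_D)
  also have "\<dots> = ennreal (par_vol M * ((2 * (s + R)) ^ D - (2 * (r - R)) ^ D))"
    using r par_vol_pos[OF M] by (subst ennreal_minus) (simp_all add: right_diff_distrib)
  finally show "emeasure lborel (par M c0 (s + R) - par M c0 (r - R)) = ennreal (par_vol M * ((2 * (s + R)) ^ D - (2 * (r - R)) ^ D))" .
  show "0 \<le> (2 * (s + R)) ^ D - (2 * (r - R)) ^ D"
    using r R_pos by (simp add: power_mono)
qed simp

definition P :: "nat \<Rightarrow> (real^('m + 'm)) set" where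
  "P n = par M c0 (real n / 2)"

lemma P_borel [measurable]: "P n \<in> sets borel"
  by (simp add: P_def)

text \<open>Indices whose point is separated from its shift by \<open>u\<close> by the boundary of
  \<open>P n\<close>. It arises from pairs with exactly one member in \<open>P n\<close> on
  substituting \<open>u = z - lam i\<close>.\<close>

definition crossing :: "nat \<Rightarrow> real^('m + 'm) \<Rightarrow> ennreal" where
  "crossing n u = count {y. (y \<in> P n) \<noteq> (y + u \<in> P n)}"

lemma count_translate_P_le:
  assumes n: "0 < n"
  shows "count {y. y + u \<in> P n} \<le> ennreal (C1 * (1 + 2 * R) ^ D * real n ^ D)"
proof -
  have "2 * (real n / 2 + R) \<le> (1 + 2 * R) * real n"
    using n R_pos by (simp add: algebra_simps)
  then have "(2 * (real n / 2 + R)) ^ D \<le> ((1 + 2 * R) * real n) ^ D"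
    using R_pos by (intro power_mono) auto
  then have "C1 * (2 * (real n / 2 + R)) ^ D \<le> C1 * (1 + 2 * R) ^ D * real n ^ D"
    unfolding mult.assoc power_mult_distrib[symmetric] using C1_nonneg by (rule mult_left_mono)
  moreover have "count {y. y + u \<in> P n} \<le> ennreal (C1 * (2 * (real n / 2 + R)) ^ D)"
    using count_translate_le[of "real n / 2" u] n by (simp add: P_def)
  ultimately show ?thesis
    by (meson ennreal_leI order_trans)
qed

lemma crossing_le:
  assumes n: "0 < n"
  shows "crossing n u \<le> ennreal (2 * C1 * (1 + 2 * R) ^ D * real n ^ D)"
proof -
  have "crossing n u \<le> emeasure (count_space UNIV) ({i. lam i \<in> {y. y + 0 \<in> P n}} \<union> {i. lam i \<in> {y. y + u \<in> P n}})"
    unfolding crossing_def count_def by (intro emeasure_mono) auto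
  also have "\<dots> \<le> count {y. y + 0 \<in> P n} + count {y. y + u \<in> P n}"
    unfolding count_def by (intro emeasure_subadditive) auto
  also have "\<dots> \<le> ennreal (C1 * (1 + 2 * R) ^ D * real n ^ D) + ennreal (C1 * (1 + 2 * R) ^ D * real n ^ D)"
    by (intro add_mono count_translate_P_le n)
  also have "\<dots> = ennreal (2 * C1 * (1 + 2 * R) ^ D * real n ^ D)"
    using C1_nonneg R_pos by (subst ennreal_plus[symmetric]) (auto simp: mult.assoc)
  finally show ?thesis .
qed

text \<open>A shift by \<open>u\<close> in \<open>par M 0 s\<close> can change sides only in a layer
  of half-width \<open>s\<close> around the boundary; the additional \<open>R\<close> comes from the
  counting bound.\<close>

lemma crossing_shell_le:
  assumes u: "u \<in> par M 0 s" and s: "0 \<le> s" and n: "2 * (s + R) < real n"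
  shows "crossing n u \<le> ennreal (C1 * ((real n + 2 * (s + R)) ^ D - (real n - 2 * (s + R)) ^ D))"
proof -
  have "{y. (y \<in> P n) \<noteq> (y + u \<in> P n)} \<subseteq> par M c0 (real n / 2 + s) - par M c0 (real n / 2 - s)"
  proof
    fix y assume "y \<in> {y. (y \<in> P n) \<noteq> (y + u \<in> P n)}"
    then consider "y \<in> P n" "y + u \<notin> P n" | "y \<notin> P n" "y + u \<in> P n" by blast
    then show "y \<in> par M c0 (real n / 2 + s) - par M c0 (real n / 2 - s)"
    proof cases
      case 1
      then show ?thesis
        using par_add[of y M c0 "real n / 2 - s" u s] u s par_mono[of "real n / 2" "real n / 2 + s" M c0]
        by (auto simp: P_def)
    next
      case 2
      then show ?thesis
        using par_add[of "y + u" M c0 "real n / 2" "- u" s] par_uminus[OF u] s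
          par_mono[of "real n / 2 - s" "real n / 2" M c0]
        by (auto simp: P_def)
    qed
  qed
  then have "crossing n u \<le> count (par M c0 (real n / 2 + s) - par M c0 (real n / 2 - s))"
    unfolding crossing_def count_def by (intro emeasure_mono) auto
  also have "\<dots> \<le> ennreal (C1 * ((2 * (real n / 2 + s + R)) ^ D - (2 * (real n / 2 - s - R)) ^ D))"
    using n s by (intro count_shell_le) auto
  finally show ?thesis
    by (simp add: algebra_simps)
qed

text \<open>For fixed \<open>u\<close> the layer has fixed thickness, so the leading terms
  \<open>real n ^ D\<close> of its two powers cancel.\<close>

lemma crossing_tendsto:
  "(\<lambda>n. ennreal (1 / real n ^ D) * crossing n u) \<longlonglongrightarrow> 0"
proof -
  obtain k where k: "u \<in> par M 0 (real k)" using par_exhaust by blast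
  let ?a = "2 * (real k + R)"
  have "(\<lambda>n. C1 * ((1 + ?a / real n) ^ D - (1 - ?a / real n) ^ D)) \<longlonglongrightarrow> C1 * ((1 + 0) ^ D - (1 - 0) ^ D)"
    by (intro tendsto_intros lim_const_over_n)
  then have lim: "(\<lambda>n. ennreal (C1 * ((1 + ?a / real n) ^ D - (1 - ?a / real n) ^ D))) \<longlonglongrightarrow> ennreal 0"
    by (intro tendsto_ennrealI) simp
  obtain n0 :: nat where n0: "?a < real n0" using reals_Archimedean2 by blast
  have le: "ennreal (1 / real n ^ D) * crossing n u \<le> ennreal (C1 * ((1 + ?a / real n) ^ D - (1 - ?a / real n) ^ D))"
    if "n0 \<le> n" for n
  proof -
    have n: "?a < real n" using n0 that by linarith
    then have n': "0 < real n" using R_pos by (smt (verit) of_nat_0_le_iff)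
    have "ennreal (1 / real n ^ D) * crossing n u
        \<le> ennreal (1 / real n ^ D) * ennreal (C1 * ((real n + ?a) ^ D - (real n - ?a) ^ D))"
      using k n by (intro mult_left_mono crossing_shell_le) auto
    also have "\<dots> = ennreal (1 / real n ^ D * (C1 * ((real n + ?a) ^ D - (real n - ?a) ^ D)))"
      by (rule ennreal_mult'[symmetric]) simp
    also have "1 / real n ^ D * (C1 * ((real n + ?a) ^ D - (real n - ?a) ^ D))
        = C1 * (((real n + ?a) / real n) ^ D - ((real n - ?a) / real n) ^ D)"
      by (simp add: power_divide flip: diff_divide_distrib)
    also have "(real n + ?a) / real n = 1 + ?a / real n"
      using n' by (simp add: add_divide_distrib)
    also have "(real n - ?a) / real n = 1 - ?a / real n"
      using n' by (simp add: diff_divide_distrib)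
    finally show ?thesis .
  qed
  show ?thesis
  proof (rule tendsto_sandwich[OF _ _ tendsto_const])
    show "(\<lambda>n. ennreal (C1 * ((1 + ?a / real n) ^ D - (1 - ?a / real n) ^ D))) \<longlonglongrightarrow> 0"
      using lim by simp
    show "\<forall>\<^sub>F n in sequentially. ennreal (1 / real n ^ D) * crossing n u \<le> ennreal (C1 * ((1 + ?a / real n) ^ D - (1 - ?a / real n) ^ D))"
      using le by (auto simp: eventually_sequentially)
  qed simp
qed

end

section \<open>Comparison of the trace with the volume\<close>

context gabor_frame
begin

lemma borel_measurable_index_pair:
  assumes "\<And>i. (\<lambda>z. f (i, z)) \<in> borel_measurable borel"
  shows "f \<in> borel_measurable (count_space (UNIV :: 'i set) \<Otimes>\<^sub>M (lborel :: (real^('m + 'm)) measure))"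
  using assms by (intro measurable_pair_measure_countable1) auto

lemma measurable_crossing [measurable]: "crossing n \<in> borel_measurable borel"
proof -
  interpret sigma_finite_measure "count_space (UNIV :: 'i set)"
    by (rule sigma_finite_measure_count_space)
  let ?f = "\<lambda>(i, u). indicator {u. (lam i \<in> P n) \<noteq> (lam i + u \<in> P n)} u :: ennreal"
  have "?f \<in> borel_measurable (count_space UNIV \<Otimes>\<^sub>M lborel)"
    by (rule borel_measurable_index_pair) simp
  from measurable_pair_swap[OF this]
  have "(\<lambda>(u, i). ?f (i, u)) \<in> borel_measurable (lborel \<Otimes>\<^sub>M count_space UNIV)" by simp
  then have "(\<lambda>u. \<integral>\<^sup>+i. ?f (i, u) \<partial>count_space UNIV) \<in> borel_measurable lborel"
    by (intro borel_measurable_nn_integral) (simp add: case_prod_beta')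
  moreover have "(\<integral>\<^sup>+i. ?f (i, u) \<partial>count_space UNIV) = crossing n u" for u
  proof -
    have "(\<lambda>i. ?f (i, u)) = indicator {i. lam i \<in> {y. (y \<in> P n) \<noteq> (y + u \<in> P n)}}"
      by (auto simp: indicator_def fun_eq_iff)
    then show ?thesis
      unfolding crossing_def count_def by (simp only: nn_integral_indicator sets_count_space Pow_UNIV UNIV_I)
  qed
  ultimately have "(\<lambda>u. crossing n u) \<in> borel_measurable lborel"
    by (simp only:)
  then show ?thesis by simp
qed

definition mV :: "('i \<Rightarrow> (real^('m + 'm)) set) \<Rightarrow> ennreal" where
  "mV Q = (\<integral>\<^sup>+i. \<integral>\<^sup>+z. ennreal (V (z - lam i)) * indicator (Q i) z \<partial>lborel \<partial>count_space UNIV)"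

definition mW :: "('i \<Rightarrow> (real^('m + 'm)) set) \<Rightarrow> ennreal" where
  "mW Q = (\<integral>\<^sup>+i. \<integral>\<^sup>+z. ennreal (W i z) * indicator (Q i) z \<partial>lborel \<partial>count_space UNIV)"

definition F :: "'i \<Rightarrow> real^('m + 'm) \<Rightarrow> complex" where
  "F i z = cnj (stft (G i) z) * stft (d i) z"

lemma measurable_F [measurable]: "F i \<in> borel_measurable borel"
  unfolding F_def[abs_def] by measurable

text \<open>Cauchy-Schwarz over pairs of an index and a phase-space point. An indicator equals its
  square and so can be placed in both factors.\<close>

lemma nn_integral_F_sq_le:
  assumes [measurable]: "\<And>i. Q i \<in> sets borel"
  shows "(\<integral>\<^sup>+(i, z). ennreal (cmod (F i z)) * indicator (Q i) z \<partial>(count_space UNIV \<Otimes>\<^sub>M lborel))\<^sup>2 \<le> mV Q * mW Q"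
proof -
  let ?P = "count_space (UNIV :: 'i set) \<Otimes>\<^sub>M (lborel :: (real^('m + 'm)) measure)"
  let ?f = "\<lambda>(i, z). ennreal (cmod (stft (G i) z)) * indicator (Q i) z"
  let ?h = "\<lambda>(i, z). ennreal (cmod (stft (d i) z)) * indicator (Q i) z"
  have [measurable]: "?f \<in> borel_measurable ?P" "?h \<in> borel_measurable ?P"
    by (rule borel_measurable_index_pair, simp)+
  have 1: "(\<integral>\<^sup>+(i, z). ennreal (cmod (F i z)) * indicator (Q i) z \<partial>?P) = (\<integral>\<^sup>+p. ?f p * ?h p \<partial>?P)"
    by (intro nn_integral_cong) (auto simp: F_def norm_mult ennreal_mult indicator_def)
  have 2: "(\<integral>\<^sup>+p. ?f p ^ 2 \<partial>?P) = mV Q"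
  proof -
    have "(\<integral>\<^sup>+p. ?f p ^ 2 \<partial>?P) = (\<integral>\<^sup>+i. \<integral>\<^sup>+z. ?f (i, z) ^ 2 \<partial>lborel \<partial>count_space UNIV)"
      by (rule lborel.nn_integral_fst[symmetric]) measurable
    also have "\<dots> = mV Q"
      unfolding mV_def cmod_stft_G_sq[symmetric]
      by (intro nn_integral_cong) (auto simp: ennreal_power indicator_def)
    finally show ?thesis .
  qed
  have 3: "(\<integral>\<^sup>+p. ?h p ^ 2 \<partial>?P) = mW Q"
  proof -
    have "(\<integral>\<^sup>+p. ?h p ^ 2 \<partial>?P) = (\<integral>\<^sup>+i. \<integral>\<^sup>+z. ?h (i, z) ^ 2 \<partial>lborel \<partial>count_space UNIV)"
      by (rule lborel.nn_integral_fst[symmetric]) measurable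
    also have "\<dots> = mW Q"
      unfolding mW_def W_def
      by (intro nn_integral_cong) (auto simp: ennreal_power indicator_def)
    finally show ?thesis .
  qed
  show ?thesis
    unfolding 1 2[symmetric] 3[symmetric] by (rule Cauchy_Schwarz_nn_integral) measurable
qed

definition rows :: "nat \<Rightarrow> 'i \<Rightarrow> (real^('m + 'm)) set" where
  "rows n i = (if lam i \<in> P n then UNIV else {})"

definition cross :: "nat \<Rightarrow> 'i \<Rightarrow> (real^('m + 'm)) set" where
  "cross n i = {z. (lam i \<in> P n) \<noteq> (z \<in> P n)}"

lemma rows_borel [measurable]: "rows n i \<in> sets borel"
  by (simp add: rows_def)

lemma cross_borel [measurable]: "cross n i \<in> sets borel"
  unfolding cross_def by measurable

lemma rows_integral_le:
  assumes "\<And>i. (\<integral>\<^sup>+z. f i z \<partial>lborel) \<le> c"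
  shows "(\<integral>\<^sup>+i. \<integral>\<^sup>+z. f i z * indicator (rows n i) z \<partial>lborel \<partial>count_space UNIV) \<le> c * count (P n)"
proof -
  have "(\<integral>\<^sup>+i. \<integral>\<^sup>+z. f i z * indicator (rows n i) z \<partial>lborel \<partial>count_space UNIV)
      \<le> (\<integral>\<^sup>+i. c * indicator {i. lam i \<in> P n} i \<partial>count_space UNIV)"
    by (intro nn_integral_mono) (auto simp: rows_def assms)
  also have "\<dots> = c * count (P n)"
    unfolding count_def by (rule nn_integral_cmult_indicator) simp
  finally show ?thesis .
qed

lemma columns_integral_le:
  assumes [measurable]: "\<And>i. f i \<in> borel_measurable borel" "E \<in> sets borel"
    and le: "\<And>z. (\<integral>\<^sup>+i. f i z \<partial>count_space UNIV) \<le> c"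
  shows "(\<integral>\<^sup>+i. \<integral>\<^sup>+z. f (i::'i) z * indicator E (z::real^('m + 'm)) \<partial>lborel \<partial>count_space UNIV) \<le> c * emeasure lborel E"
proof -
  have "(\<integral>\<^sup>+i. \<integral>\<^sup>+z. f i z * indicator E z \<partial>lborel \<partial>count_space UNIV)
      = (\<integral>\<^sup>+z. \<integral>\<^sup>+i. f i z * indicator E z \<partial>count_space UNIV \<partial>lborel)"
    by (rule nn_integral_count_space_nn_integral[symmetric]) auto
  also have "\<dots> = (\<integral>\<^sup>+z. (\<integral>\<^sup>+i. f i z \<partial>count_space UNIV) * indicator E z \<partial>lborel)"
    by (intro nn_integral_cong nn_integral_multc) auto
  also have "\<dots> \<le> (\<integral>\<^sup>+z. c * indicator E z \<partial>lborel)"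
    by (intro nn_integral_mono mult_right_mono le) auto
  also have "\<dots> = c * emeasure lborel E"
    by (rule nn_integral_cmult_indicator) simp
  finally show ?thesis .
qed

lemma mV_rows: "mV (rows n) \<le> ennreal (l2_normsq g) * count (P n)"
  unfolding mV_def by (rule rows_integral_le) (simp add: nn_integral_V_translate)

lemma mW_rows: "mW (rows n) \<le> ennreal (l2_normsq g / A\<^sup>2) * count (P n)"
  unfolding mW_def by (rule rows_integral_le) (rule nn_integral_W)

lemma mV_columns: "E \<in> sets borel \<Longrightarrow> mV (\<lambda>_. E) \<le> ennreal \<bar>B\<bar> * emeasure lborel E"
  unfolding mV_def by (rule columns_integral_le) (auto intro: sum_V_le)

lemma mW_columns: "E \<in> sets borel \<Longrightarrow> mW (\<lambda>_. E) \<le> ennreal (\<bar>B\<bar> / A\<^sup>2) * emeasure lborel E"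
  unfolding mW_def by (rule columns_integral_le) (auto intro: sum_W_le)

lemma mV_cross: "mV (cross n) = (\<integral>\<^sup>+u. ennreal (V u) * crossing n u \<partial>lborel)"
proof -
  let ?S = "\<lambda>i. {u. (lam i \<in> P n) \<noteq> (lam i + u \<in> P n)}"
  have "mV (cross n) = (\<integral>\<^sup>+i. \<integral>\<^sup>+u. ennreal (V u) * indicator (?S i) u \<partial>lborel \<partial>count_space UNIV)"
    unfolding mV_def
  proof (rule nn_integral_cong)
    fix i
    have "(\<integral>\<^sup>+z. ennreal (V (z - lam i)) * indicator (cross n i) z \<partial>lborel)
        = (\<integral>\<^sup>+z. ennreal (V (z - lam i)) * indicator (?S i) (z - lam i) \<partial>lborel)"
      by (intro nn_integral_cong) (auto simp: cross_def indicator_def)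
    also have "\<dots> = (\<integral>\<^sup>+u. ennreal (V u) * indicator (?S i) u \<partial>lborel)"
      by (rule nn_integral_lborel_translate[where f="\<lambda>u. ennreal (V u) * indicator (?S i) u"]) measurable
    finally show "(\<integral>\<^sup>+z. ennreal (V (z - lam i)) * indicator (cross n i) z \<partial>lborel)
        = (\<integral>\<^sup>+u. ennreal (V u) * indicator (?S i) u \<partial>lborel)" .
  qed
  also have "\<dots> = (\<integral>\<^sup>+u. \<integral>\<^sup>+i. ennreal (V u) * indicator (?S i) u \<partial>count_space UNIV \<partial>lborel)"
    by (rule nn_integral_count_space_nn_integral[symmetric]) auto
  also have "\<dots> = (\<integral>\<^sup>+u. ennreal (V u) * crossing n u \<partial>lborel)"
  proof (rule nn_integral_cong)
    fix u
    have "(\<integral>\<^sup>+i. ennreal (V u) * indicator (?S i) u \<partial>count_space UNIV)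
        = (\<integral>\<^sup>+i. ennreal (V u) * indicator {i. lam i \<in> {y. (y \<in> P n) \<noteq> (y + u \<in> P n)}} i \<partial>count_space UNIV)"
      by (intro nn_integral_cong) (auto simp: indicator_def)
    also have "\<dots> = ennreal (V u) * crossing n u"
      unfolding crossing_def count_def by (rule nn_integral_cmult_indicator) simp
    finally show "(\<integral>\<^sup>+i. ennreal (V u) * indicator (?S i) u \<partial>count_space UNIV) = ennreal (V u) * crossing n u" .
  qed
  finally show ?thesis .
qed

text \<open>Deliberately crude: the mixed pairs lie in the rows with index point in
  \<open>P n\<close> or in the columns over \<open>P n\<close>, and order \<open>real n ^ D\<close>
  is all that is asked of the dual factor.\<close>

lemma mW_cross: "mW (cross n) \<le> mW (rows n) + mW (\<lambda>_. P n)"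
proof -
  have "mW (cross n) \<le> (\<integral>\<^sup>+i. (\<integral>\<^sup>+z. ennreal (W i z) * indicator (rows n i) z \<partial>lborel)
      + (\<integral>\<^sup>+z. ennreal (W i z) * indicator (P n) z \<partial>lborel) \<partial>count_space UNIV)"
    unfolding mW_def
  proof (rule nn_integral_mono)
    fix i
    have "(\<integral>\<^sup>+z. ennreal (W i z) * indicator (cross n i) z \<partial>lborel)
        \<le> (\<integral>\<^sup>+z. ennreal (W i z) * indicator (rows n i) z + ennreal (W i z) * indicator (P n) z \<partial>lborel)"
      by (intro nn_integral_mono) (auto simp: cross_def rows_def indicator_def)
    also have "\<dots> = (\<integral>\<^sup>+z. ennreal (W i z) * indicator (rows n i) z \<partial>lborel)
        + (\<integral>\<^sup>+z. ennreal (W i z) * indicator (P n) z \<partial>lborel)"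
      by (rule nn_integral_add) measurable
    finally show "(\<integral>\<^sup>+z. ennreal (W i z) * indicator (cross n i) z \<partial>lborel)
        \<le> (\<integral>\<^sup>+z. ennreal (W i z) * indicator (rows n i) z \<partial>lborel)
        + (\<integral>\<^sup>+z. ennreal (W i z) * indicator (P n) z \<partial>lborel)" .
  qed
  also have "\<dots> = mW (rows n) + mW (\<lambda>_. P n)"
    unfolding mW_def by (rule nn_integral_add) auto
  finally show ?thesis .
qed

definition vol :: "nat \<Rightarrow> real" where
  "vol n = par_vol M * real n ^ D"

lemma vol_pos: "0 < n \<Longrightarrow> 0 < vol n"
  using par_vol_pos[OF M] by (simp add: vol_def)

lemma emeasure_P: "0 < n \<Longrightarrow> emeasure lborel (P n) = ennreal (vol n)"
  unfolding P_def vol_def by (subst emeasure_par_D) auto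

lemma count_P_le: "0 < n \<Longrightarrow> count (P n) \<le> ennreal (C1 * (1 + 2 * R) ^ D * real n ^ D)"
  using count_translate_P_le[of n 0] by simp

definition Lam :: "nat \<Rightarrow> 'i set" where
  "Lam n = {i. lam i \<in> P n}"

lemma
  assumes n: "0 < n"
  shows finite_Lam: "finite (Lam n)"
    and card_Lam_le: "real (card (Lam n)) \<le> C1 * (1 + 2 * R) ^ D * real n ^ D"
proof -
  have le: "emeasure (count_space UNIV) (Lam n) \<le> ennreal (C1 * (1 + 2 * R) ^ D * real n ^ D)"
    using count_P_le[OF n] by (simp add: count_def Lam_def)
  then have "emeasure (count_space UNIV) (Lam n) < \<infinity>"
    by (rule order_le_less_trans) simp
  then show fin: "finite (Lam n)"
    by (simp add: emeasure_count_space split: if_splits)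
  have "ennreal (real (card (Lam n))) \<le> ennreal (C1 * (1 + 2 * R) ^ D * real n ^ D)"
    using le fin by (simp add: ennreal_of_nat_eq_real_of_nat)
  then show "real (card (Lam n)) \<le> C1 * (1 + 2 * R) ^ D * real n ^ D"
    by (rule ennreal_le_iff[THEN iffD1, rotated]) (use C1_nonneg R_pos in simp)
qed

lemma integral_F: "(LINT z|lborel. F i z) = of_real (energy (d i))"
proof -
  have "(LINT z|lborel. F i z) = l2_inner (stft (d i)) (stft (G i))"
    by (subst l2_inner_lborel) (auto simp: F_def[abs_def] mult.commute)
  also have "\<dots> = l2_inner (d i) (G i)"
    by (intro l2_inner_stft L2_d L2_G) measurable
  also have "\<dots> = of_real (energy (d i))"
    by (subst l2_inner_commute) (simp add: l2_inner_d)
  finally show ?thesis .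
qed

lemma integral_count_F: "(LINT i|count_space UNIV. F i z) = 1"
proof -
  have F: "F i z = l2_inner (atom z) (G i) * l2_inner (d i) (atom z)" for i
    unfolding F_def l2_inner_atom_G by (simp add: stft_def)
  have s: "Infinite_Set_Sum.abs_summable_on (\<lambda>i. F i z) UNIV"
    unfolding F by (rule abs_summable_equivalent[THEN iffD1]) (rule abs_summable_reconstruction[OF L2_atom])
  have "(LINT i|count_space UNIV. F i z) = (\<Sum>\<^sub>\<infinity>i. F i z)"
    using infsetsum_infsum[OF s] by (simp add: infsetsum_def)
  also have "\<dots> = 1"
    unfolding F by (simp add: reconstruction[OF L2_atom] l2_normsq_atom)
  finally show ?thesis .
qed

lemma integrable_F:
  assumes Q: "\<And>i. Q i \<in> sets borel" and fin: "mV Q < \<infinity>" "mW Q < \<infinity>"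
  shows "integrable (count_space UNIV \<Otimes>\<^sub>M lborel) (\<lambda>(i, z). indicator (Q i) z *\<^sub>R F i z)"
proof (rule integrableI_bounded)
  note [measurable] = Q
  let ?P = "count_space (UNIV :: 'i set) \<Otimes>\<^sub>M (lborel :: (real^('m + 'm)) measure)"
  show "(\<lambda>(i, z). indicator (Q i) z *\<^sub>R F i z) \<in> borel_measurable ?P"
    by (rule borel_measurable_index_pair) simp
  have "(\<integral>\<^sup>+p. ennreal (norm (case p of (i, z) \<Rightarrow> indicator (Q i) z *\<^sub>R F i z)) \<partial>?P)
      = (\<integral>\<^sup>+(i, z). ennreal (cmod (F i z)) * indicator (Q i) z \<partial>?P)"
    by (intro nn_integral_cong) (auto simp: indicator_def)
  moreover have "(\<integral>\<^sup>+(i, z). ennreal (cmod (F i z)) * indicator (Q i) z \<partial>?P)\<^sup>2 < \<infinity>"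
    using fin by (intro order_le_less_trans[OF nn_integral_F_sq_le[OF Q]]) (simp add: ennreal_mult_less_top)
  ultimately show "(\<integral>\<^sup>+p. ennreal (norm (case p of (i, z) \<Rightarrow> indicator (Q i) z *\<^sub>R F i z)) \<partial>?P) < \<infinity>"
    by (simp add: power_less_top_ennreal)
qed

definition T :: "nat \<Rightarrow> real" where
  "T n = (\<Sum>i\<in>Lam n. energy (d i))"

text \<open>The same \<open>F\<close> is integrated over two regions, here over \<open>z\<close>
  first, which yields the trace; \<open>columns_integral\<close> sums over the index first and
  yields the volume. Integrability over both regions is what allows subtracting them.\<close>

lemma rows_integral:
  assumes n: "0 < n"
  shows "integrable (count_space UNIV \<Otimes>\<^sub>M lborel) (\<lambda>(i, z). indicator (rows n i) z *\<^sub>R F i z)"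
    and "integral\<^sup>L (count_space UNIV \<Otimes>\<^sub>M lborel) (\<lambda>(i, z). indicator (rows n i) z *\<^sub>R F i z) = of_real (T n)"
proof -
  interpret pm: pair_sigma_finite "count_space (UNIV :: 'i set)" "lborel :: (real^('m + 'm)) measure"
    by (intro pair_sigma_finite.intro sigma_finite_measure_count_space sigma_finite_lborel)
  have "count (P n) < \<infinity>"
    using count_P_le[OF n] by (rule order_le_less_trans) simp
  then have "mV (rows n) < \<infinity>" "mW (rows n) < \<infinity>"
    by (auto intro!: order_le_less_trans[OF mV_rows] order_le_less_trans[OF mW_rows] simp: ennreal_mult_less_top)
  then show int: "integrable (count_space UNIV \<Otimes>\<^sub>M lborel) (\<lambda>(i, z). indicator (rows n i) z *\<^sub>R F i z)"
    by (intro integrable_F) auto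
  have "integral\<^sup>L (count_space UNIV \<Otimes>\<^sub>M lborel) (\<lambda>(i, z). indicator (rows n i) z *\<^sub>R F i z)
      = (LINT i|count_space UNIV. LINT z|lborel. indicator (rows n i) z *\<^sub>R F i z)"
    by (rule pm.integral_fst[OF int, symmetric])
  also have "\<dots> = (LINT i|count_space UNIV. (if i \<in> Lam n then complex_of_real (energy (d i)) else 0))"
    by (intro Bochner_Integration.integral_cong) (auto simp: rows_def Lam_def integral_F)
  also have "\<dots> = (\<Sum>i\<in>{i. (if i \<in> Lam n then complex_of_real (energy (d i)) else 0) \<noteq> 0}. (if i \<in> Lam n then complex_of_real (energy (d i)) else 0))"
    by (subst lebesgue_integral_count_space_finite_support)
       (auto intro: finite_subset[OF _ finite_Lam[OF n]] split: if_splits)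
  also have "\<dots> = (\<Sum>i\<in>Lam n. complex_of_real (energy (d i)))"
    by (rule sum.mono_neutral_cong_left) (auto simp: finite_Lam n split: if_splits)
  finally show "integral\<^sup>L (count_space UNIV \<Otimes>\<^sub>M lborel) (\<lambda>(i, z). indicator (rows n i) z *\<^sub>R F i z) = of_real (T n)"
    by (simp add: T_def)
qed

lemma columns_integral:
  assumes n: "0 < n"
  shows "integrable (count_space (UNIV :: 'i set) \<Otimes>\<^sub>M lborel) (\<lambda>(i, z). indicator (P n) z *\<^sub>R F i z)"
    and "integral\<^sup>L (count_space UNIV \<Otimes>\<^sub>M lborel) (\<lambda>(i, z). indicator (P n) z *\<^sub>R F i z) = of_real (vol n)"
proof -
  interpret pm: pair_sigma_finite "count_space (UNIV :: 'i set)" "lborel :: (real^('m + 'm)) measure"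
    by (intro pair_sigma_finite.intro sigma_finite_measure_count_space sigma_finite_lborel)
  have "mV (\<lambda>_. P n) < \<infinity>" "mW (\<lambda>_. P n) < \<infinity>"
    by (auto intro!: order_le_less_trans[OF mV_columns] order_le_less_trans[OF mW_columns]
        simp: ennreal_mult_less_top emeasure_P n)
  then show int: "integrable (count_space (UNIV :: 'i set) \<Otimes>\<^sub>M lborel) (\<lambda>(i, z). indicator (P n) z *\<^sub>R F i z)"
    by (intro integrable_F) auto
  have "integral\<^sup>L (count_space UNIV \<Otimes>\<^sub>M lborel) (\<lambda>(i, z). indicator (P n) z *\<^sub>R F i z)
      = (LINT z|lborel. LINT i|count_space UNIV. indicator (P n) z *\<^sub>R F i z)"
    by (rule pm.integral_snd[OF int, symmetric])
  also have "\<dots> = (LINT z|lborel. complex_of_real (indicator (P n) z))"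
    by (intro Bochner_Integration.integral_cong) (auto simp: integral_count_F indicator_def)
  also have "\<dots> = of_real (LINT z|lborel. indicator (P n) z)"
    by (rule integral_complex_of_real)
  also have "(LINT z|lborel. indicator (P n) z) = measure lborel (P n)"
    by simp
  also have "\<dots> = vol n"
    using vol_pos[OF n] by (simp add: measure_def emeasure_P n)
  finally show "integral\<^sup>L (count_space UNIV \<Otimes>\<^sub>M lborel) (\<lambda>(i, z). indicator (P n) z *\<^sub>R F i z) = of_real (vol n)" .
qed

lemma T_vol_diff_sq_le:
  assumes n: "0 < n"
  shows "ennreal \<bar>T n - vol n\<bar> ^ 2 \<le> mV (cross n) * mW (cross n)"
proof -
  let ?P = "count_space (UNIV :: 'i set) \<Otimes>\<^sub>M (lborel :: (real^('m + 'm)) measure)"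
  let ?f = "\<lambda>(i, z). indicator (rows n i) z *\<^sub>R F i z" and ?h = "\<lambda>(i, z). indicator (P n) z *\<^sub>R F i z"
  have int: "integrable ?P (\<lambda>p. ?f p - ?h p)"
    by (intro Bochner_Integration.integrable_diff rows_integral columns_integral n)
  have "(LINT p|?P. ?f p - ?h p) = integral\<^sup>L ?P ?f - integral\<^sup>L ?P ?h"
    by (intro Bochner_Integration.integral_diff rows_integral columns_integral n)
  then have "complex_of_real (T n - vol n) = (LINT p|?P. ?f p - ?h p)"
    by (simp only: rows_integral(2)[OF n] columns_integral(2)[OF n] of_real_diff)
  then have "ennreal \<bar>T n - vol n\<bar> = ennreal (norm (LINT p|?P. ?f p - ?h p))"
    by (metis norm_of_real)
  also have "\<dots> \<le> (\<integral>\<^sup>+p. ennreal (norm (?f p - ?h p)) \<partial>?P)"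
    by (rule integral_norm_bound_ennreal[OF int])
  \<comment> \<open>On pairs with both members in \<open>P n\<close> the two terms cancel, so only
    the symmetric difference of the two regions remains.\<close>
  also have "\<dots> = (\<integral>\<^sup>+(i, z). ennreal (cmod (F i z)) * indicator (cross n i) z \<partial>?P)"
    by (intro nn_integral_cong) (auto simp: rows_def cross_def indicator_def)
  finally have "ennreal \<bar>T n - vol n\<bar> ^ 2 \<le> (\<integral>\<^sup>+(i, z). ennreal (cmod (F i z)) * indicator (cross n i) z \<partial>?P)\<^sup>2"
    by (rule power_mono) simp
  also have "\<dots> \<le> mV (cross n) * mW (cross n)"
    by (rule nn_integral_F_sq_le) simp
  finally show ?thesis .
qed

text \<open>Dominated convergence in the displacement \<open>u\<close>: the normalized crossing
  numbers tend to 0 pointwise and are bounded uniformly in \<open>u\<close>, while \<open>V\<close>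
  is integrable.\<close>

lemma boundary_tendsto: "(\<lambda>n. ennreal (1 / real n ^ D) * mV (cross n)) \<longlonglongrightarrow> 0"
proof -
  let ?c = "2 * C1 * (1 + 2 * R) ^ D"
  have eq: "ennreal (1 / real n ^ D) * mV (cross n)
      = (\<integral>\<^sup>+u. ennreal (V u) * (ennreal (1 / real n ^ D) * crossing n u) \<partial>lborel)" for n
    unfolding mV_cross by (subst nn_integral_cmult[symmetric]) (auto simp: mult.left_commute)
  have "(\<lambda>n. \<integral>\<^sup>+u. ennreal (V u) * (ennreal (1 / real n ^ D) * crossing n u) \<partial>lborel)
      \<longlonglongrightarrow> (\<integral>\<^sup>+u. 0 \<partial>(lborel :: (real^('m + 'm)) measure))"
  proof (rule nn_integral_dominated_convergence)
    show "(\<integral>\<^sup>+u. ennreal (V u) * ennreal ?c \<partial>lborel) < \<infinity>"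
      by (subst nn_integral_multc) (auto simp: nn_integral_V ennreal_mult_less_top)
    show "AE u in lborel. ennreal (V u) * (ennreal (1 / real n ^ D) * crossing n u) \<le> ennreal (V u) * ennreal ?c" for n
    proof (intro AE_I2 mult_left_mono)
      fix u
      show "ennreal (1 / real n ^ D) * crossing n u \<le> ennreal ?c"
      \<comment> \<open>For \<open>n = 0\<close> the scaling factor itself is 0, by division by zero
        and \<open>0 < D\<close>.\<close>
      proof (cases "n = 0")
        case False
        then have "ennreal (1 / real n ^ D) * crossing n u \<le> ennreal (1 / real n ^ D) * ennreal (?c * real n ^ D)"
          by (intro mult_left_mono crossing_le) auto
        also have "\<dots> = ennreal ?c"
          using False by (simp flip: ennreal_mult')
        finally show ?thesis .
      qed (simp add: zero_power[OF D_pos])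
    qed simp
    show "AE u in lborel. (\<lambda>n. ennreal (V u) * (ennreal (1 / real n ^ D) * crossing n u)) \<longlonglongrightarrow> 0"
    proof (rule AE_I2)
      fix u
      have "(\<lambda>n. ennreal (V u) * (ennreal (1 / real n ^ D) * crossing n u)) \<longlonglongrightarrow> ennreal (V u) * 0"
        by (intro ennreal_tendsto_cmult crossing_tendsto) simp
      then show "(\<lambda>n. ennreal (V u) * (ennreal (1 / real n ^ D) * crossing n u)) \<longlonglongrightarrow> 0" by simp
    qed
  qed auto
  then show ?thesis unfolding eq by simp
qed

theorem T_asymptotics: "(\<lambda>n. T n / real n ^ D) \<longlonglongrightarrow> par_vol M"
proof -
  \<comment> \<open>The two summands bound the dual mass of the rows, through the number of points
    in \<open>P n\<close>, and of the columns, through its volume, both per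
    \<open>real n ^ D\<close>.\<close>
  define K where "K = l2_normsq g / A\<^sup>2 * (C1 * (1 + 2 * R) ^ D) + \<bar>B\<bar> / A\<^sup>2 * par_vol M"
  have K: "0 \<le> K"
    using C1_nonneg R_pos par_vol_pos[OF M] by (simp add: K_def l2_normsq_nonneg)
  let ?x = "\<lambda>n. (T n - vol n) / real n ^ D"
  have le: "ennreal ((?x n)\<^sup>2) \<le> ennreal (1 / real n ^ D) * mV (cross n) * ennreal K" if n: "0 < n" for n
  proof -
    have "mW (cross n) \<le> ennreal (l2_normsq g / A\<^sup>2) * count (P n) + ennreal (\<bar>B\<bar> / A\<^sup>2) * emeasure lborel (P n)"
      by (intro order_trans[OF mW_cross] add_mono mW_rows mW_columns) simp
    also have "\<dots> \<le> ennreal (l2_normsq g / A\<^sup>2) * ennreal (C1 * (1 + 2 * R) ^ D * real n ^ D) + ennreal (\<bar>B\<bar> / A\<^sup>2) * ennreal (vol n)"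
      by (intro add_mono mult_left_mono count_P_le n) (auto simp: emeasure_P n)
    also have "\<dots> = ennreal (K * real n ^ D)"
      using C1_nonneg R_pos vol_pos[OF n]
      by (simp add: l2_normsq_nonneg K_def vol_def algebra_simps flip: ennreal_mult ennreal_plus)
    finally have W: "mW (cross n) \<le> ennreal (K * real n ^ D)" .
    have "ennreal ((?x n)\<^sup>2) = ennreal \<bar>T n - vol n\<bar> ^ 2 * (ennreal (1 / real n ^ D) * ennreal (1 / real n ^ D))"
      by (simp add: power_divide power2_eq_square ennreal_power flip: ennreal_mult)
    also have "\<dots> \<le> (mV (cross n) * ennreal (K * real n ^ D)) * (ennreal (1 / real n ^ D) * ennreal (1 / real n ^ D))"
      by (intro mult_right_mono order_trans[OF T_vol_diff_sq_le[OF n]] mult_left_mono W) auto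
    also have "\<dots> = ennreal (1 / real n ^ D) * mV (cross n) * (ennreal (K * real n ^ D) * ennreal (1 / real n ^ D))"
      by (simp only: mult_ac)
    also have "ennreal (K * real n ^ D) * ennreal (1 / real n ^ D) = ennreal K"
      using K n by (simp flip: ennreal_mult)
    finally show ?thesis .
  qed
  have "(\<lambda>n. ennreal K * (ennreal (1 / real n ^ D) * mV (cross n))) \<longlonglongrightarrow> ennreal K * 0"
    by (intro ennreal_tendsto_cmult boundary_tendsto) simp
  then have lim: "(\<lambda>n. ennreal (1 / real n ^ D) * mV (cross n) * ennreal K) \<longlonglongrightarrow> 0"
    by (simp add: mult.commute)
  have "(\<lambda>n. ennreal ((?x n)\<^sup>2)) \<longlonglongrightarrow> 0"
    by (rule tendsto_sandwich[OF _ _ tendsto_const lim])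
       (use le in \<open>auto simp: eventually_sequentially intro!: exI[of _ 1]\<close>)
  then have "(\<lambda>n. (?x n)\<^sup>2) \<longlonglongrightarrow> 0"
    by (simp add: ennreal_tendsto_0_iff)
  then have "(\<lambda>n. sqrt ((?x n)\<^sup>2)) \<longlonglongrightarrow> sqrt 0"
    by (rule tendsto_real_sqrt)
  then have "(\<lambda>n. \<bar>?x n\<bar>) \<longlonglongrightarrow> 0"
    by (simp only: real_sqrt_abs real_sqrt_zero)
  then have "?x \<longlonglongrightarrow> 0"
    by (rule tendsto_rabs_zero_cancel)
  then have "(\<lambda>n. ?x n + par_vol M) \<longlonglongrightarrow> 0 + par_vol M"
    by (intro tendsto_intros)
  moreover have "\<forall>\<^sub>F n in sequentially. ?x n + par_vol M = T n / real n ^ D"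
    using eventually_gt_at_top[of 0] by eventually_elim (simp add: vol_def diff_divide_distrib)
  ultimately show ?thesis
    by (simp add: tendsto_cong)
qed

end

section \<open>Passage to the ultrafilter limit\<close>

text \<open>Compactness provides a cluster point, and along an ultrafilter a cluster point is a
  limit: a neighbourhood that is not eventually entered is eventually avoided.\<close>

lemma ultrafilter_bounded_tendsto:
  fixes x :: "nat \<Rightarrow> real"
  assumes p: "free_ultrafilter p" and K: "compact K" and x: "eventually (\<lambda>n. x n \<in> K) p"
  obtains c where "(x \<longlongrightarrow> c) p"
proof -
  let ?F = "filtermap x p"
  have "?F \<noteq> bot" "eventually (\<lambda>y. y \<in> K) ?F"
    using p x by (auto simp: free_ultrafilter_def filtermap_bot_iff eventually_filtermap)
  then obtain c where c: "inf (nhds c) ?F \<noteq> bot"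
    using K unfolding compact_filter by blast
  have "eventually (\<lambda>n. x n \<in> U) p" if U: "open U" "c \<in> U" for U
  proof (rule ccontr)
    assume "\<not> ?thesis"
    then have "eventually (\<lambda>n. n \<notin> {n. x n \<in> U}) p"
      using p unfolding free_ultrafilter_def by (metis (mono_tags, lifting) eventually_mono mem_Collect_eq)
    then have "eventually (\<lambda>y. y \<notin> U) ?F"
      by (simp add: eventually_filtermap)
    moreover have "eventually (\<lambda>y. y \<in> U) (nhds c)"
      using U by (rule eventually_nhds_in_open)
    ultimately have "eventually (\<lambda>_. False) (inf (nhds c) ?F)"
      unfolding eventually_inf by blast
    with c show False by (simp add: trivial_limit_def[symmetric])
  qed
  then show thesis
    by (intro that topological_tendstoI)
qed

lemma free_ultrafilter_le_sequentially:
  assumes "free_ultrafilter p"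
  shows "p \<le> sequentially"
proof (rule filter_leI)
  fix Q assume "eventually Q sequentially"
  then obtain m where m: "\<And>n. m \<le> n \<Longrightarrow> Q n"
    unfolding eventually_sequentially by blast
  have "eventually (\<lambda>n. n \<notin> {..<m}) p"
    using assms unfolding free_ultrafilter_def by blast
  then show "eventually Q p"
    by eventually_elim (use m in auto)
qed

context gabor_frame
begin

lemma Lambda_n_eq: "Lambda_n lam M c0 n = Lam n"
  by (simp add: Lambda_n_def Lam_def P_def MQ_eq_par[OF M])

lemma measure_MQ: "0 < n \<Longrightarrow> measure lborel (MQ M n c0) = vol n"
  using emeasure_P[of n] vol_pos[of n] by (simp add: MQ_eq_par[OF M] P_def measure_def)

text \<open>Cauchy-Schwarz bounds every diagonal value uniformly. Since the trace grows like the
  volume, this forces a positive density.\<close>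

lemma T_le: "T n \<le> l2_normsq g / A * real (card (Lam n))"
proof -
  have "energy (d i) \<le> l2_normsq g / A" for i
  proof (rule power2_le_imp_le)
    have "(energy (d i))\<^sup>2 = (cmod (l2_inner (G i) (d i)))\<^sup>2"
      by (simp add: l2_inner_d)
    also have "\<dots> \<le> l2_normsq (G i) * l2_normsq (d i)"
      by (rule cmod_l2_inner_sq_le[OF L2_G L2_d])
    also have "\<dots> \<le> l2_normsq (G i) * (l2_normsq (G i) / A\<^sup>2)"
      by (intro mult_left_mono l2_normsq_d l2_normsq_nonneg)
    also have "\<dots> = (l2_normsq g / A)\<^sup>2"
      by (simp add: l2_normsq_gabor_atom L2_g power2_eq_square)
    finally show "(energy (d i))\<^sup>2 \<le> (l2_normsq g / A)\<^sup>2" .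
  qed (use A_pos l2_normsq_nonneg[of g] in simp)
  then have "T n \<le> (\<Sum>i\<in>Lam n. l2_normsq g / A)"
    unfolding T_def by (intro sum_mono)
  then show ?thesis by (simp add: mult.commute)
qed

lemma T_over_vol_tendsto: "(\<lambda>n. T n / vol n) \<longlonglongrightarrow> 1"
proof -
  have "(\<lambda>n. T n / real n ^ D / par_vol M) \<longlonglongrightarrow> par_vol M / par_vol M"
    using par_vol_pos[OF M] by (intro tendsto_divide T_asymptotics tendsto_const) simp
  then show ?thesis
    using par_vol_pos[OF M] by (simp add: vol_def mult.commute)
qed

theorem frame_measure_eq:
  assumes p: "free_ultrafilter p"
  shows "frame_measure G lam M c0 p = complex_of_real (1 / density lam p M c0)"
proof -
  have p0: "p \<noteq> bot" using p by (simp add: free_ultrafilter_def)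
  note seq = filter_leD[OF free_ultrafilter_le_sequentially[OF p]]
  let ?dens = "\<lambda>n. real (card (Lam n)) / vol n"
  let ?C = "C1 * (1 + 2 * R) ^ D / par_vol M"
  have "\<forall>\<^sub>F n in sequentially. ?dens n \<in> {0..?C}"
    using eventually_gt_at_top[of 0]
  proof eventually_elim
    case (elim n)
    have "real (card (Lam n)) / vol n \<le> (C1 * (1 + 2 * R) ^ D * real n ^ D) / vol n"
      using card_Lam_le[OF elim] vol_pos[OF elim] by (intro divide_right_mono) auto
    also have "\<dots> = ?C"
      using elim by (simp add: vol_def)
    finally show ?case
      using vol_pos[OF elim] by simp
  qed
  from ultrafilter_bounded_tendsto[OF p compact_Icc seq[OF this]]
  obtain c where c: "(?dens \<longlongrightarrow> c) p" .
  have vol: "\<forall>\<^sub>F n in p. 0 < vol n"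
    by (intro seq eventually_mono[OF eventually_gt_at_top[of 0]] vol_pos)
  have T: "((\<lambda>n. T n / vol n) \<longlongrightarrow> 1) p"
    using T_over_vol_tendsto free_ultrafilter_le_sequentially[OF p] by (rule tendsto_mono[rotated])
  have "1 \<le> l2_normsq g / A * c"
  proof (rule tendsto_le[OF p0 _ T])
    show "((\<lambda>n. l2_normsq g / A * ?dens n) \<longlongrightarrow> l2_normsq g / A * c) p"
      by (intro tendsto_mult_left c)
    show "\<forall>\<^sub>F n in p. T n / vol n \<le> l2_normsq g / A * ?dens n"
      using vol
    proof eventually_elim
      case (elim n)
      then show ?case
        using divide_right_mono[OF T_le, of "vol n" n] by simp
    qed
  qed
  then have c0: "c \<noteq> 0" by auto
  have dens: "density lam p M c0 = c"
    unfolding density_def plim_def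
  proof (rule tendsto_Lim[OF p0])
    have "\<forall>\<^sub>F n in p. ?dens n = real (card (Lambda_n lam M c0 n)) / measure lborel (MQ M n c0)"
      by (rule seq) (use eventually_gt_at_top[of 0] in \<open>eventually_elim, simp add: Lambda_n_eq measure_MQ\<close>)
    with c show "((\<lambda>n. real (card (Lambda_n lam M c0 n)) / measure lborel (MQ M n c0)) \<longlongrightarrow> c) p"
      by (rule Lim_transform_eventually)
  qed
  have "frame_measure G lam M c0 p = complex_of_real (1 / c)"
    unfolding frame_measure_def plim_def
  proof (rule tendsto_Lim[OF p0])
    \<comment> \<open>The volume cancels once it is positive; if \<open>Lam n\<close> is empty, both
      quotients are 0 by convention.\<close>
    have lim: "((\<lambda>n. complex_of_real ((T n / vol n) / ?dens n)) \<longlongrightarrow> complex_of_real (1 / c)) p"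
      by (intro tendsto_of_real tendsto_divide T c c0)
    have "\<forall>\<^sub>F n in p. complex_of_real ((T n / vol n) / ?dens n)
        = 1 / of_nat (card (Lambda_n lam M c0 n)) * (\<Sum>i\<in>Lambda_n lam M c0 n. dual_diag G i)"
      using vol by eventually_elim (simp add: Lambda_n_eq dual_diag_eq T_def)
    with lim show "((\<lambda>n. 1 / of_nat (card (Lambda_n lam M c0 n)) * (\<Sum>i\<in>Lambda_n lam M c0 n. dual_diag G i))
        \<longlongrightarrow> complex_of_real (1 / c)) p"
      by (rule Lim_transform_eventually)
  qed
  then show ?thesis by (simp add: dens)
qed

end

lemma AE_lebesgue_translate:
  fixes Q :: "'a::euclidean_space \<Rightarrow> bool"
  assumes "AE x in lebesgue. Q x"
  shows "AE x in lebesgue. Q (x - v)"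
proof -
  obtain N where "\<And>x. x \<in> space lborel - N \<Longrightarrow> Q x" and "N \<in> null_sets lborel"
    using AE_E3[OF assms[unfolded AE_completion_iff]] by blast
  then have N: "N \<in> null_sets lborel" "{x. \<not> Q x} \<subseteq> N" by auto
  then have [measurable]: "N \<in> sets borel" by auto
  have "(\<integral>\<^sup>+x. indicator N (x - v) \<partial>lborel) = (\<integral>\<^sup>+x. indicator N x \<partial>lborel)"
    by (rule nn_integral_lborel_translate) measurable
  also have "\<dots> = 0" using N by (simp add: null_setsD1)
  finally have "AE x in lborel. (indicator N (x - v) :: ennreal) = 0"
    by (subst (asm) nn_integral_0_iff_AE) auto
  then have "AE x in lborel. Q (x - v)"
    by eventually_elim (use N in \<open>auto simp: indicator_def\<close>)
  then show ?thesis by (rule AE_completion)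
qed

theorem theorem9p4:
  fixes g :: "real^'m \<Rightarrow> complex"
    and lam :: "'i::countable \<Rightarrow> real^('m + 'm)"
    and ph :: "'i \<Rightarrow> real"
    and c0 :: "real^('m + 'm)"
    and M :: "real^('m + 'm)^('m + 'm)"
  assumes "L2 g"
    and "is_frame (\<lambda>i. gabor_atom g (ph i) (lam i))"
    and "invertible M"
  shows "\<forall>p. free_ultrafilter p \<longrightarrow>
    frame_measure (\<lambda>i. gabor_atom g (ph i) (lam i)) lam M c0 p = complex_of_real (1 / density lam p M c0)"
proof (intro allI impI)
  fix p assume p: "free_ultrafilter p"
  let ?G = "\<lambda>i. gabor_atom g (ph i) (lam i)"
  have L2_G: "L2 (?G i)" for i
    using assms(2) by (simp add: is_frame_def)
  obtain A B where AB: "0 < A"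
    "\<And>f. L2 f \<Longrightarrow> (\<lambda>i. (cmod (l2_inner f (?G i)))\<^sup>2) summable_on UNIV \<and>
        A * l2_normsq f \<le> (\<Sum>\<^sub>\<infinity>i. (cmod (l2_inner f (?G i)))\<^sup>2) \<and>
        (\<Sum>\<^sub>\<infinity>i. (cmod (l2_inner f (?G i)))\<^sup>2) \<le> B * l2_normsq f"
    using assms(2) unfolding is_frame_def by blast
  \<comment> \<open>The analysis above is for a Borel window. Passing to \<open>h\<close> changes
    each atom on a null set only, so inner products, canonical duals and the frame measure are
    unaffected.\<close>
  obtain h where h: "h \<in> borel_measurable borel" "L2 h" and ae: "AE x in lebesgue. g x = h x"
    using L2_ex_borel[OF assms(1)] by metis
  let ?H = "\<lambda>i. gabor_atom h (ph i) (lam i)"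
  have L2_H: "L2 (?H i)" for i
    by (rule L2_gabor_atom[OF h])
  have "AE x in lebesgue. ?G i x = ?H i x" for i
    using AE_lebesgue_translate[OF ae, of "tpart (lam i)"]
    by eventually_elim (simp add: gabor_atom_def)
  then have left: "l2_inner (?G i) f = l2_inner (?H i) f" if "L2 f" for i f
    by (intro l2_inner_AE_left L2_measurable L2_G L2_H that)
  have right: "l2_inner f (?G i) = l2_inner f (?H i)" if "L2 f" for i f
    using left[OF that] by (subst (1 2) l2_inner_commute) simp
  have "is_canonical_dual ?G i e = is_canonical_dual ?H i e" for i e
    unfolding is_canonical_dual_def by (auto simp: left right)
  then have "dual_diag ?G i = dual_diag ?H i" for i
    unfolding dual_diag_def using left by (intro arg_cong[where f=The] ext) (auto simp: is_canonical_dual_def)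
  then have "frame_measure ?G lam M c0 p = frame_measure ?H lam M c0 p"
    by (simp add: frame_measure_def)
  moreover
  have "l2_frame ?H A B"
    by unfold_locales (use AB L2_H right in auto)
  then obtain d where d: "\<And>i. d i \<in> borel_measurable borel" "l2_frame_dual ?H A B d"
    using l2_frame.dual_exists by blast
  have "gabor_frame h ph lam A B d M (CARD('m + 'm))"
    using h d assms(3) by (intro gabor_frame.intro) auto
  then have "frame_measure ?H lam M c0 p = complex_of_real (1 / density lam p M c0)"
    using p by (rule gabor_frame.frame_measure_eq)
  ultimately show "frame_measure ?G lam M c0 p = complex_of_real (1 / density lam p M c0)"
    by simp
qed

end
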